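(* Let $(\Omega,\mathcal F,\mu,T)$ be an ergodic probability-preserving invertible dynamical system, $c:\Omega\to\,]0,+\infty[$ a measurable function, and let $(X_t)_{t\ge0}$ be the associated variable-speed continuous-time random walk among conductances on $\mathbb Z$ (see context). (1) If $1/c$ is $\mu$-integrable then, for $\mu$-almost every environment $\omega$ and for every real $x_0$, $$\lim_{t\to+\infty}\sqrt t\;\mathbb P_0^\omega\left[X_t=[x_0\sqrt t]\right]=\frac{\sqrt{\int\frac1c\,d\mu}}{2\sqrt\pi}\,\exp\left(-\frac{\int\frac1c\,d\mu}{4}\,x_0^2\right),$$ where $[x]$ denotes the integer part of $x$. (2) If $1/c$ is not $\mu$-integrable then, for $\mu$-almost every environment $\omega$ and for every $x\in\mathbb Z$, $$\lim_{t\to+\infty}\sqrt t\;\mathbb P_0^\omega[X_t=x]=+\infty.$$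
   Context: $\mu$ is a probability measure on the measurable space $(\Omega,\mathcal F)$, and $T:\Omega\to\Omega$ is invertible, bi-measurable, preserves $\mu$, and is ergodic (every invariant measurable set has measure $0$ or $1$). For $\omega\in\Omega$ (the environment) and $x\in\mathbb Z$, the conductance of the edge $\{x,x+1\}$ is $c(x,x+1)(\omega)=c(x+1,x)(\omega):=c(T^x\omega)$. Put $\overline c(x)(\omega):=c(x-1,x)(\omega)+c(x,x+1)(\omega)$. For fixed $\omega$, let $(S_n)_{n\ge0}$ be, under $\mathbb P_{x_0}^\omega$, the Markov chain on $\mathbb Z$ with $S_0=x_0$ and transition probabilities $\mathbb P^\omega_{x_0}[S_{n+1}=x\pm1\mid S_n=x]=c(x,x\pm1)(\omega)/\overline c(x)(\omega)$. Given the realization of $(S_n)_{n\ge0}$, let $(T_n)_{n\ge1}$ be independent exponential random variables, $T_n$ having mean $\overline c(S_{n-1})^{-1}$. Put $J_0:=0$, $J_n:=T_1+\cdots+T_n$ for $n\ge1$, and $X_t:=S_n$ for $J_n\le t<J_{n+1}$. Then $(X_t)_{t\ge0}$ is (for fixed $\omega$) a continuous-time Markov chain on $\mathbb Z$, non-explosive, jumping from $x$ to $x\pm1$ at rate $c(x,x\pm1)(\omega)$. *)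

theory Defs
  imports "HOL-Probability.Probability"
begin

locale invertible_ergodic_system = prob_space \<mu> for \<mu> :: "'w measure" +
  fixes T :: "'w \<Rightarrow> 'w"
  assumes T_bij: "bij_betw T (space \<mu>) (space \<mu>)"
    and T_measurable: "T \<in> measurable \<mu> \<mu>"
    and T_inv_measurable: "inv_into (space \<mu>) T \<in> measurable \<mu> \<mu>"
    and T_preserves: "distr \<mu> \<mu> T = \<mu>"
    and T_ergodic: "\<And>A. A \<in> sets \<mu> \<Longrightarrow> T -` A \<inter> space \<mu> = A \<Longrightarrow> prob A = 0 \<or> prob A = 1"

definition int_iterate :: "'w set \<Rightarrow> ('w \<Rightarrow> 'w) \<Rightarrow> int \<Rightarrow> 'w \<Rightarrow> 'w" where
  "int_iterate \<Omega> T x = (if 0 \<le> x then T ^^ nat x else inv_into \<Omega> T ^^ nat (- x))"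

definition conductance ::
    "'w set \<Rightarrow> ('w \<Rightarrow> 'w) \<Rightarrow> ('w \<Rightarrow> real) \<Rightarrow> 'w \<Rightarrow> int \<Rightarrow> int \<Rightarrow> real" where
  "conductance \<Omega> T c \<omega> x y =
     (if y = x + 1 then c (int_iterate \<Omega> T x \<omega>)
      else if x = y + 1 then c (int_iterate \<Omega> T y \<omega>)
      else 0)"

definition total_conductance :: "(int \<Rightarrow> int \<Rightarrow> real) \<Rightarrow> int \<Rightarrow> real" where
  "total_conductance k x = k (x - 1) x + k x (x + 1)"

definition exponential_law :: "real \<Rightarrow> real measure" where
  "exponential_law l = density lborel (\<lambda>u. ennreal (exponential_density l u))"

definition chain_sigma_algebra :: "'s measure \<Rightarrow> (nat \<Rightarrow> 's \<Rightarrow> int) \<Rightarrow> 's measure" where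
  "chain_sigma_algebra P S =
     vimage_algebra (space P) (\<lambda>y n. S n y) (\<Pi>\<^sub>M n\<in>UNIV. count_space UNIV)"

text \<open>
  Under \<open>P\<close>, the process \<open>S\<close> is the Markov chain started at \<open>x0\<close> among the
  conductances \<open>k\<close> and \<open>\<tau> 1, \<tau> 2, \<dots>\<close> are its holding times (\<open>\<tau> 0\<close> is not used).
  Assumption \<open>holding_times\<close> is the conditional law of the holding times given the whole
  trajectory of \<open>S\<close>: a product of exponential laws, \<open>\<tau> i\<close> having rate, that is inverse mean,
  \<open>total_conductance k (S (i - 1))\<close>.
\<close>

locale variable_speed_walk = prob_space P for P :: "'s measure" +
  fixes k :: "int \<Rightarrow> int \<Rightarrow> real" and x0 :: int
    and S :: "nat \<Rightarrow> 's \<Rightarrow> int" and \<tau> :: "nat \<Rightarrow> 's \<Rightarrow> real"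
  assumes S_measurable: "\<And>n. S n \<in> measurable P (count_space UNIV)"
    and S_start: "AE y in P. S 0 y = x0"
    and S_step_right: "\<And>n h. prob {y \<in> space P. \<forall>i\<le>n. S i y = h i} \<noteq> 0 \<Longrightarrow>
          cond_prob P (\<lambda>y. S (Suc n) y = h n + 1) (\<lambda>y. \<forall>i\<le>n. S i y = h i)
            = k (h n) (h n + 1) / total_conductance k (h n)"
    and S_step_left: "\<And>n h. prob {y \<in> space P. \<forall>i\<le>n. S i y = h i} \<noteq> 0 \<Longrightarrow>
          cond_prob P (\<lambda>y. S (Suc n) y = h n - 1) (\<lambda>y. \<forall>i\<le>n. S i y = h i)
            = k (h n) (h n - 1) / total_conductance k (h n)"
    and \<tau>_measurable: "\<And>n. \<tau> n \<in> borel_measurable P"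
    and holding_times: "\<And>n B. (\<And>i. i \<in> {1..n} \<Longrightarrow> B i \<in> sets borel) \<Longrightarrow>
          AE y in P. real_cond_exp P (chain_sigma_algebra P S)
              (indicator {z \<in> space P. \<forall>i\<in>{1..n}. \<tau> i z \<in> B i}) y
            = (\<Prod>i\<in>{1..n}. measure (exponential_law (total_conductance k (S (i - 1) y))) (B i))"

definition jump_time :: "(nat \<Rightarrow> 's \<Rightarrow> real) \<Rightarrow> nat \<Rightarrow> 's \<Rightarrow> real" where
  "jump_time \<tau> n y = (\<Sum>i\<in>{1..n}. \<tau> i y)"

text \<open>
  The index of the interval between consecutive jump times that contains \<open>t\<close> is almost surely
  unique where it exists.  It is written with \<open>LEAST\<close> so that the walk stays measurable on the
  null sets where some holding time is not positive or where no such index exists.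
\<close>

definition walk_position ::
    "(nat \<Rightarrow> 's \<Rightarrow> int) \<Rightarrow> (nat \<Rightarrow> 's \<Rightarrow> real) \<Rightarrow> real \<Rightarrow> 's \<Rightarrow> int" where
  "walk_position S \<tau> t y =
     S (LEAST n. jump_time \<tau> n y \<le> t \<and> t < jump_time \<tau> (Suc n) y) y"

end

(* Let r = 1/c be the resistance field.  Killing the walk when it leaves [-N, N] turns the
   law of X_t into the solution u^N of a finite symmetric linear system u' = L u, and everything
   is deduced from identities for this system.

   Put d_0 = 1 and d_1 = the sum of the resistances from 0 to x, and choose d_(k+2) with
   L d_(k+2) = d_k.  Then the mean of d_k(X_t) is t^(k/2) / (k/2)! for even k and 0 for odd k.
   By the ergodic theorem d_k(x) is asymptotic to a multiple of x^k, which gives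
   the convergence of all moments of X_t / sqrt t, hence the central limit theorem.  The same
   functions with k = 2 bound the probability to leave a box (so the walk does not explode).

   In dimension one, the Cauchy-Schwarz inequality for the Dirichlet form gives
   (p_t(y) - p_t(x))^2 <= p_t(0)/t * (sum of the resistances between x and y),
   that is, equicontinuity of sqrt t * p_t on the scale sqrt t.  This upgrades the central limit
   theorem to the local one.  If r is not integrable, then d_2(x) / x^2 tends to infinity, so X_t
   stays in [-eps sqrt t, eps sqrt t] with high probability, and
   p_2t(0) >= (sum over the box of u_t)^2 / (size of the box) is much larger than 1 / sqrt t. *)

theory Submission imports Defs begin

section \<open>Birkhoff's theorem for ergodic maps\<close>

text \<open>Means of unbounded functions cannot be differentiated term by term on all of Z while
  explosion is not excluded. Inside a box all sums are finite, at the price of two boundary terms: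
  the probability of leaving on each side times the value of the function at the exit point.
  Markov's inequality with a \<open>heat_poly\<close> of larger even degree makes them vanish as the
  box grows, so the mean identities become exact only in the limit, and in the moment argument N
  tends to infinity before t does. That \<open>killed\<close> solves the linear system is derived
  from the jump description, by summing over the number n of jumps the identity: mean time spent up
  to t in the state reached after n jumps = probability of having left it by t, divided by its rate.
  The bound on increments contains p_t(0), so the local theorem also needs sqrt t * p_t(0) to be
  bounded. The increment bound supplies this itself: over a window of length sqrt t the kernel stays
  comparable with p_t(0), while the mass is at most 1. If r is not integrable, the ergodic theorem
  is applied to truncations of r, and \<open>heat_poly r 2\<close> is monotone in r.\<close>

locale ergodic_map = prob_space M for M :: "'w measure" +
  fixes T :: "'w \<Rightarrow> 'w"
  assumes measurable_map [measurable]: "T \<in> measurable M M"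
    and map_preserves: "distr M M T = M"
    and map_ergodic: "\<And>A. A \<in> sets M \<Longrightarrow> T -` A \<inter> space M = A \<Longrightarrow> prob A = 0 \<or> prob A = 1"
begin

lemma map_in_space: "w \<in> space M \<Longrightarrow> T w \<in> space M"
  using measurable_map by (rule measurable_space)

lemma integrable_comp_map: "integrable M f \<Longrightarrow> integrable M (\<lambda>w. f (T w))" for f :: "'w \<Rightarrow> real"
  by (rule integrable_distr[OF measurable_map]) (simp add: map_preserves)

lemma integral_comp_map:
  "integrable M f \<Longrightarrow> (\<integral>w. f (T w) \<partial>M) = (\<integral>w. f w \<partial>M)" for f :: "'w \<Rightarrow> real"
  using integral_distr[of T M M f] by (simp add: map_preserves)

abbreviation ergodic_sum :: "('w \<Rightarrow> real) \<Rightarrow> nat \<Rightarrow> 'w \<Rightarrow> real" where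
  "ergodic_sum f n w \<equiv> \<Sum>i<n. f ((T ^^ i) w)"

lemma iterate_in_space: "w \<in> space M \<Longrightarrow> (T ^^ n) w \<in> space M"
  by (induction n) (auto intro: map_in_space)

text \<open>The maximum of the ergodic sums with 1, ..., n + 1 terms. The recursion exhibits the
  relation between the maxima at \<open>w\<close> and at \<open>T w\<close> on which the maximal
  argument rests.\<close>

fun max_ergodic_sum :: "('w \<Rightarrow> real) \<Rightarrow> nat \<Rightarrow> 'w \<Rightarrow> real" where
  "max_ergodic_sum f 0 w = f w"
| "max_ergodic_sum f (Suc n) w = f w + max 0 (max_ergodic_sum f n (T w))"

lemma integrable_max_ergodic_sum:
  assumes "integrable M f" shows "integrable M (max_ergodic_sum f n)"
proof (induction n)
  case 0 then show ?case using assms by (simp add: eta_contract_eq fun_eq_iff cong: Bochner_Integration.integrable_cong)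
next
  case (Suc n)
  have "integrable M (\<lambda>w. f w + max 0 (max_ergodic_sum f n (T w)))"
    using assms integrable_comp_map[OF Suc] by (intro Bochner_Integration.integrable_add integrable_max) auto
  then show ?case by (simp cong: Bochner_Integration.integrable_cong)
qed

lemma max_ergodic_sum_Suc_ge: "max_ergodic_sum f n w \<le> max_ergodic_sum f (Suc n) w"
proof (induction n arbitrary: w)
  case (Suc n) show ?case using Suc[of "T w"] by (simp del: max_ergodic_sum.simps(2) add: max_ergodic_sum.simps(2)[of f _ w])
qed auto

lemma max_ergodic_sum_mono: "m \<le> n \<Longrightarrow> max_ergodic_sum f m w \<le> max_ergodic_sum f n w"
  using lift_Suc_mono_le[of "\<lambda>n. max_ergodic_sum f n w"] max_ergodic_sum_Suc_ge by blast

lemma ergodic_sum_le_max: "(\<Sum>i<Suc n. f ((T ^^ i) w)) \<le> max_ergodic_sum f n w"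
proof (induction n arbitrary: w)
  case (Suc n)
  have "(\<Sum>i<Suc (Suc n). f ((T ^^ i) w)) = f w + (\<Sum>i<Suc n. f ((T ^^ i) (T w)))"
    by (subst sum.lessThan_Suc_shift) (simp add: funpow_swap1)
  also have "\<dots> \<le> f w + max_ergodic_sum f n (T w)" using Suc[of "T w"] by linarith
  also have "\<dots> \<le> max_ergodic_sum f (Suc n) w" by simp
  finally show ?case .
qed simp

text \<open>Write F_n for the maxima. The difference of F_(n+1) and F_n o T equals f - min 0 (F_n o
  T) and has nonnegative integral, because F_n increases in n and \<open>T\<close> preserves the
  measure. Where the sums are unbounded it converges to f. If this invariant set had full measure,
  the integral of f would be nonnegative.\<close>

lemma ergodic_sums_bounded_above:
  fixes f :: "'w \<Rightarrow> real"
  assumes f: "integrable M f" and neg: "(\<integral>w. f w \<partial>M) < 0"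
  shows "AE w in M. \<exists>B. \<forall>n. ergodic_sum f n w \<le> B"
proof -
  let ?F = "max_ergodic_sum f"
  have [measurable]: "?F n \<in> borel_measurable M" for n
    using integrable_max_ergodic_sum[OF f, of n] by auto
  have [measurable]: "f \<in> borel_measurable M" using f by auto
  define A where "A = {w \<in> space M. \<forall>B::nat. \<exists>n. ?F n w > real B}"
  have A: "A \<in> sets M" unfolding A_def by measurable
  have unb: "(\<forall>B::nat. \<exists>n. ?F n w > real B) \<longleftrightarrow> (\<forall>B::nat. \<exists>n. ?F n (T w) > real B)" for w
  proof
    assume L: "\<forall>B::nat. \<exists>n. ?F n w > real B"
    show "\<forall>B::nat. \<exists>n. ?F n (T w) > real B"
    proof
      fix B :: nat
      \<comment> \<open>Raising the bound by an integer above |f w| pays for the one term by which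
        the sums along \<open>w\<close> and along \<open>T w\<close> differ.\<close>
      obtain n where n: "?F n w > real (B + nat \<lceil>\<bar>f w\<bar>\<rceil>)" using L by blast
      then have "?F (Suc n) w > real B + \<bar>f w\<bar>"
        using max_ergodic_sum_Suc_ge[of f n w] by (auto simp del: max_ergodic_sum.simps) linarith
      then show "\<exists>n. ?F n (T w) > real B" by (intro exI[of _ n]) (auto simp: max_def split: if_splits)
    qed
  next
    assume R: "\<forall>B::nat. \<exists>n. ?F n (T w) > real B"
    show "\<forall>B::nat. \<exists>n. ?F n w > real B"
    proof
      fix B :: nat
      obtain n where n: "?F n (T w) > real (B + nat \<lceil>\<bar>f w\<bar>\<rceil>)" using R by blast
      then have "?F n (T w) > real B + \<bar>f w\<bar>" by (auto) linarith
      then show "\<exists>n. ?F n w > real B" by (intro exI[of _ "Suc n"]) (auto simp: max_def)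
    qed
  qed
  have inv: "T -` A \<inter> space M = A"
  proof (intro set_eqI)
    fix w
    show "w \<in> T -` A \<inter> space M \<longleftrightarrow> w \<in> A"
      using map_in_space[of w] by (simp only: A_def vimage_eq Int_iff mem_Collect_eq unb[of w]) blast
  qed
  have "prob A \<noteq> 1"
  proof
    assume "prob A = 1"
    then have AE: "AE w in M. w \<in> A" using A prob_eq_1 by blast
    \<comment> \<open>In this form \<open>D\<close> is dominated by |f| + |f o T|, since F_n is at
      least f; in the form \<open>Deq\<close> its integral is a difference of two consecutive
      integrals of maxima.\<close>
    define D where "D n w = f w - min 0 (?F n (T w))" for n w
    have Deq: "D n w = ?F (Suc n) w - ?F n (T w)" for n w by (auto simp: D_def)
    have lim: "(\<lambda>n. \<integral>w. D n w \<partial>M) \<longlonglongrightarrow> (\<integral>w. f w \<partial>M)"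
    proof (rule integral_dominated_convergence)
      show "integrable M (\<lambda>w. \<bar>f w\<bar> + \<bar>f (T w)\<bar>)"
        using f integrable_comp_map[OF f] by auto
      show "AE w in M. norm (D n w) \<le> \<bar>f w\<bar> + \<bar>f (T w)\<bar>" for n
      proof (rule AE_I2)
        fix w
        have "f (T w) \<le> ?F n (T w)" using max_ergodic_sum_mono[of 0 n f "T w"] by simp
        then show "norm (D n w) \<le> \<bar>f w\<bar> + \<bar>f (T w)\<bar>" unfolding D_def by (auto simp: min_def)
      qed
      show "AE w in M. (\<lambda>n. D n w) \<longlonglongrightarrow> f w"
        using AE
      proof (rule AE_mp, intro AE_I2 impI)
        fix w assume "w \<in> A"
        then have "T w \<in> A" using inv by blast
        \<comment> \<open>From this index on the minimum in \<open>D\<close> is 0, so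
          \<open>D n w\<close> is constantly \<open>f w\<close>.\<close>
        then obtain m where m: "?F m (T w) > 0"
          unfolding A_def by (auto dest!: spec[of _ "0::nat"])
        have "eventually (\<lambda>n. D n w = f w) sequentially"
          using eventually_ge_at_top[of m]
        proof eventually_elim
          case (elim n)
          then have "?F n (T w) > 0" using m max_ergodic_sum_mono[OF elim, of f "T w"] by linarith
          then show ?case by (simp add: D_def)
        qed
        then show "(\<lambda>n. D n w) \<longlonglongrightarrow> f w" by (rule tendsto_eventually)
      qed
    qed (auto simp: D_def)
    have "0 \<le> (\<integral>w. D n w \<partial>M)" for n
    proof -
      have "(\<integral>w. D n w \<partial>M) = (\<integral>w. ?F (Suc n) w \<partial>M) - (\<integral>w. ?F n w \<partial>M)"
        unfolding Deq
        by (subst Bochner_Integration.integral_diff)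
          (use integrable_max_ergodic_sum[OF f] integrable_comp_map integral_comp_map in auto)
      moreover have "(\<integral>w. ?F n w \<partial>M) \<le> (\<integral>w. ?F (Suc n) w \<partial>M)"
        by (rule integral_mono[OF integrable_max_ergodic_sum[OF f] integrable_max_ergodic_sum[OF f]])
          (rule max_ergodic_sum_Suc_ge)
      ultimately show ?thesis by simp
    qed
    with lim have "0 \<le> (\<integral>w. f w \<partial>M)" by (intro LIMSEQ_le_const) auto
    with neg show False by simp
  qed
  then have "prob A = 0" using map_ergodic[OF A inv] by blast
  then have "AE w in M. w \<notin> A" using A by (subst AE_iff_measurable[of A]) (auto simp: emeasure_eq_measure A_def)
  then show ?thesis
  proof (rule AE_mp, intro AE_I2 impI)
    fix w assume "w \<in> space M" "w \<notin> A"
    then obtain B :: nat where B: "\<And>n. ?F n w \<le> real B" unfolding A_def by (auto simp: not_less)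
    have "ergodic_sum f n w \<le> real B" for n
    proof (cases n)
      case (Suc m) then show ?thesis using ergodic_sum_le_max[of f w m] B[of m] by (auto simp del: sum.lessThan_Suc)
    qed simp
    then show "\<exists>B. \<forall>n. ergodic_sum f n w \<le> B" by blast
  qed
qed

text \<open>The sums of \<open>f - b\<close> are bounded above, and a bounded excess disappears
  after division by n.\<close>

lemma ergodic_averages_eventually_le:
  fixes f :: "'w \<Rightarrow> real"
  assumes f: "integrable M f" and less: "(\<integral>w. f w \<partial>M) < b"
  shows "AE w in M. \<forall>e>0. \<forall>\<^sub>F n in sequentially. ergodic_sum f n w / n \<le> b + e"
proof -
  have "AE w in M. \<exists>B. \<forall>n. (\<Sum>i<n. f ((T ^^ i) w) - b) \<le> B"
    by (rule ergodic_sums_bounded_above[where f="\<lambda>w. f w - b"]) (use f less in \<open>auto simp: prob_space\<close>)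
  then show ?thesis
  proof (rule AE_mp, intro AE_I2 impI allI)
    fix w and e :: real
    assume "\<exists>B. \<forall>n. (\<Sum>i<n. f ((T ^^ i) w) - b) \<le> B" and e: "e > 0"
    then obtain B where B: "\<And>n. ergodic_sum f n w - n * b \<le> B" by (auto simp: sum_subtractf)
    have "eventually (\<lambda>n. real n > 0 \<and> real n > B / e) sequentially"
      by (intro eventually_conj filterlim_real_sequentially[unfolded filterlim_at_top_dense, rule_format])
    then show "\<forall>\<^sub>F n in sequentially. ergodic_sum f n w / n \<le> b + e"
    proof eventually_elim
      case (elim n)
      then have "B < n * e" using e by (simp add: field_simps)
      then have "ergodic_sum f n w \<le> n * (b + e)" using B[of n] by (simp add: algebra_simps)
      then show ?case using elim by (simp add: field_simps)
    qed
  qed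
qed

text \<open>The exceptional null set must not depend on the gap between b and the integral;
  countably many gaps 1 / (m + 1) are enough.\<close>

lemma ergodic_averages_limsup:
  fixes f :: "'w \<Rightarrow> real"
  assumes f: "integrable M f"
  shows "AE w in M. \<forall>e>0. \<forall>\<^sub>F n in sequentially. ergodic_sum f n w / n < (\<integral>w. f w \<partial>M) + e"
proof -
  have "AE w in M. \<forall>m. \<forall>e>0. \<forall>\<^sub>F n in sequentially.
      ergodic_sum f n w / n \<le> ((\<integral>w. f w \<partial>M) + inverse (real (Suc m))) + e"
    unfolding AE_all_countable using f by (intro allI ergodic_averages_eventually_le) auto
  then show ?thesis
  proof (rule AE_mp, intro AE_I2 impI allI)
    fix w and e :: real
    assume *: "\<forall>m. \<forall>e>0. \<forall>\<^sub>F n in sequentially.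
      ergodic_sum f n w / n \<le> ((\<integral>w. f w \<partial>M) + inverse (real (Suc m))) + e" and e: "e > 0"
    obtain m where m: "inverse (real (Suc m)) < e / 2" using reals_Archimedean[of "e/2"] e by auto
    have "\<forall>\<^sub>F n in sequentially.
      ergodic_sum f n w / n \<le> ((\<integral>w. f w \<partial>M) + inverse (real (Suc m))) + e/2" using * e by simp
    then show "\<forall>\<^sub>F n in sequentially. ergodic_sum f n w / n < (\<integral>w. f w \<partial>M) + e"
      by eventually_elim (use m in linarith)
  qed
qed

theorem birkhoff:
  fixes f :: "'w \<Rightarrow> real"
  assumes f: "integrable M f"
  shows "AE w in M. (\<lambda>n. ergodic_sum f n w / n) \<longlonglongrightarrow> (\<integral>w. f w \<partial>M)"
proof -
  have g: "integrable M (\<lambda>w. - f w)" using f by simp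
  show ?thesis
    using ergodic_averages_limsup[OF f] ergodic_averages_limsup[OF g]
  proof eventually_elim
    case (elim w)
    show ?case
    proof (rule order_tendstoI)
      fix a assume "a < (\<integral>w. f w \<partial>M)"
      with elim(2)[rule_format, of "(\<integral>w. f w \<partial>M) - a"]
      show "\<forall>\<^sub>F n in sequentially. a < ergodic_sum f n w / n"
        by (auto simp: sum_negf)
    next
      fix a assume "(\<integral>w. f w \<partial>M) < a"
      with elim(1)[rule_format, of "a - (\<integral>w. f w \<partial>M)"]
      show "\<forall>\<^sub>F n in sequentially. ergodic_sum f n w / n < a"
        by auto
    qed
  qed
qed

end

section \<open>Ergodic averages along both half-lines\<close>

context invertible_ergodic_system
begin

abbreviation T_inv :: "'w \<Rightarrow> 'w" where "T_inv \<equiv> inv_into (space \<mu>) T"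

lemma ergodic_map_forward: "ergodic_map \<mu> T"
  by unfold_locales (use T_measurable T_preserves T_ergodic in auto)

lemma T_inv_T: "\<omega> \<in> space \<mu> \<Longrightarrow> T_inv (T \<omega>) = \<omega>"
  using T_bij by (simp add: bij_betw_def inv_into_f_f)

text \<open>A set invariant under the inverse map is invariant under \<open>T\<close>, so ergodicity
  passes to the inverse system.\<close>

lemma ergodic_map_backward: "ergodic_map \<mu> T_inv"
proof unfold_locales
  show "distr \<mu> \<mu> T_inv = \<mu>"
  proof -
    have "distr \<mu> \<mu> T_inv = distr (distr \<mu> \<mu> T) \<mu> T_inv" by (simp add: T_preserves)
    also have "\<dots> = distr \<mu> \<mu> (T_inv \<circ> T)" by (rule distr_distr[OF T_inv_measurable T_measurable])
    also have "\<dots> = distr \<mu> \<mu> (\<lambda>\<omega>. \<omega>)" by (rule distr_cong) (auto simp: T_inv_T)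
    finally show ?thesis by simp
  qed
  fix A assume A: "A \<in> sets \<mu>" "T_inv -` A \<inter> space \<mu> = A"
  have sp: "T \<omega> \<in> space \<mu>" "T_inv \<omega> \<in> space \<mu>" if "\<omega> \<in> space \<mu>" for \<omega>
    using that T_measurable T_inv_measurable by (auto intro: measurable_space)
  have "T -` A \<inter> space \<mu> = A"
  proof (intro equalityI subsetI)
    fix \<omega> assume "\<omega> \<in> T -` A \<inter> space \<mu>"
    then show "\<omega> \<in> A" using A(2) sp T_inv_T by (metis IntD1 IntD2 vimage_eq)
  next
    fix \<omega> assume w: "\<omega> \<in> A"
    then have "\<omega> \<in> space \<mu>" using A(1) sets.sets_into_space by blast
    then show "\<omega> \<in> T -` A \<inter> space \<mu>" using A(2) sp T_inv_T w by (metis IntI vimage_eq)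
  qed
  then show "prob A = 0 \<or> prob A = 1" using T_ergodic A(1) by blast
qed (use T_inv_measurable in auto)

text \<open>The edges left of the origin are indexed by -1, -2, ..., so the backward theorem is
  applied to f composed with one inverse step.\<close>

lemma birkhoff_two_sided:
  fixes f :: "'w \<Rightarrow> real"
  assumes f: "integrable \<mu> f"
  shows "AE \<omega> in \<mu>. (\<lambda>n. (\<Sum>i<n. f (int_iterate (space \<mu>) T (int i) \<omega>)) / n) \<longlonglongrightarrow> (\<integral>\<omega>. f \<omega> \<partial>\<mu>)
     \<and> (\<lambda>n. (\<Sum>i<n. f (int_iterate (space \<mu>) T (- int i - 1) \<omega>)) / n) \<longlonglongrightarrow> (\<integral>\<omega>. f \<omega> \<partial>\<mu>)"
proof -
  interpret F: ergodic_map \<mu> T by (rule ergodic_map_forward)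
  interpret B: ergodic_map \<mu> T_inv by (rule ergodic_map_backward)
  have g: "integrable \<mu> (\<lambda>\<omega>. f (T_inv \<omega>))" using B.integrable_comp_map[OF f] .
  have eq: "f (int_iterate (space \<mu>) T (- int i - 1) \<omega>) = f (T_inv ((T_inv ^^ i) \<omega>))" for i \<omega>
  proof -
    have "nat (- (- int i - 1)) = Suc i" by simp
    then show ?thesis by (simp add: int_iterate_def)
  qed
  show ?thesis
    using F.birkhoff[OF f] B.birkhoff[OF g] unfolding B.integral_comp_map[OF f] eq
    by eventually_elim (simp add: int_iterate_def)
qed

lemma int_iterate_in_space: "\<omega> \<in> space \<mu> \<Longrightarrow> int_iterate (space \<mu>) T x \<omega> \<in> space \<mu>"
  using ergodic_map.iterate_in_space[OF ergodic_map_forward] ergodic_map.iterate_in_space[OF ergodic_map_backward]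
  by (auto simp: int_iterate_def)

end

section \<open>Discrete integrals and caloric polynomials\<close>

text \<open>Discrete primitive vanishing at 0; the sign for negative arguments makes
  \<open>isum_step\<close> valid on all of Z.\<close>

definition isum :: "(int \<Rightarrow> real) \<Rightarrow> int \<Rightarrow> real" where
  "isum f x = (if 0 \<le> x then \<Sum>z\<in>{0..<x}. f z else - (\<Sum>z\<in>{x..<0}. f z))"

lemma isum_0 [simp]: "isum f 0 = 0"
  by (simp add: isum_def)

lemma isum_step: "isum f (x + 1) = isum f x + f x"
proof (cases "0 \<le> x")
  case True
  then have "{0..<x+1} = insert x {0..<x}" by auto
  with True show ?thesis by (simp add: isum_def)
next
  case False
  then have "{x..<0} = insert x {x+1..<0}" by auto
  with False show ?thesis by (auto simp: isum_def)
qed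

lemma isum_of_nat: "isum f (int n) = (\<Sum>i<n. f (int i))"
  by (induction n) (simp_all add: isum_step[of f "int _", simplified add.commute] add.commute)

lemma isum_minus_of_nat: "isum f (- int n) = - (\<Sum>i<n. f (- int i - 1))"
proof (induction n)
  case (Suc n)
  have "isum f (- int n) = isum f (- int n - 1) + f (- int n - 1)"
    using isum_step[of f "- int n - 1"] by simp
  moreover have "- int (Suc n) = - int n - 1" by simp
  ultimately show ?case using Suc by (simp only: sum.lessThan_Suc)
qed simp

lemma isum_diff: "x \<le> y \<Longrightarrow> isum f y - isum f x = (\<Sum>z\<in>{x..<y}. f z)"
proof (induction y rule: int_ge_induct)
  case (step y)
  then have "{x..<y+1} = insert y {x..<y}" by auto
  with step show ?case by (simp add: isum_step)
qed simp

lemma isum_mono: "(\<And>z. 0 \<le> f z) \<Longrightarrow> x \<le> y \<Longrightarrow> isum f x \<le> isum f y"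
  using isum_diff[of x y f] sum_nonneg[of "{x..<y}" f] by force

lemma isum_one: "isum (\<lambda>_. 1) x = of_int x"
  by (auto simp: isum_def)

text \<open>The functions d_k of the overview. The shift to y + 1 makes the flux of the new function
  through the edge {y, y + 1} a primitive of the old one at the right endpoint, so that the fluxes
  through the two edges at x differ by exactly the old function at x.\<close>

fun heat_poly :: "(int \<Rightarrow> real) \<Rightarrow> nat \<Rightarrow> int \<Rightarrow> real" where
  "heat_poly r 0 = (\<lambda>x. 1)"
| "heat_poly r (Suc 0) = isum r"
| "heat_poly r (Suc (Suc k)) = isum (\<lambda>y. r y * isum (heat_poly r k) (y + 1))"

text \<open>On the negative side both primitives change sign and the signs cancel. This is why
  positivity is available in even degrees.\<close>

lemma isum_isum_nonneg:
  assumes "\<And>y. 0 \<le> r y" "\<And>y. 0 \<le> f y"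
  shows "0 \<le> isum (\<lambda>y. r y * isum f (y + 1)) x"
proof (cases "0 \<le> x")
  case True
  have "0 \<le> (\<Sum>z\<in>{0..<x}. r z * isum f (z + 1))"
    using isum_mono[of f 0] assms by (intro sum_nonneg mult_nonneg_nonneg) auto
  with True show ?thesis by (simp add: isum_def)
next
  case False
  have "(\<Sum>z\<in>{x..<0}. r z * isum f (z + 1)) \<le> 0"
    using isum_mono[of f _ 0] assms by (intro sum_nonpos mult_nonneg_nonpos) auto
  with False show ?thesis by (simp add: isum_def)
qed

lemma heat_poly_even_nonneg: "(\<And>y. 0 \<le> r y) \<Longrightarrow> 0 \<le> heat_poly r (2 * j) x"
  by (induction j arbitrary: x) (auto intro: isum_isum_nonneg)

text \<open>The difference is again a double primitive, with weight \<open>s - r\<close>. It serves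
  to compare the resistances with their truncations.\<close>

lemma heat_poly_2_mono:
  assumes "\<And>y. 0 \<le> r y" "\<And>y. r y \<le> s y"
  shows "heat_poly r 2 x \<le> heat_poly s 2 x"
proof -
  have "0 \<le> isum (\<lambda>y. (s y - r y) * isum (\<lambda>_. 1) (y + 1)) x"
    using assms by (intro isum_isum_nonneg) auto
  also have "\<dots> = heat_poly s 2 x - heat_poly r 2 x"
    by (auto simp: isum_def numeral_2_eq_2 algebra_simps sum_subtractf)
  finally show ?thesis by simp
qed

section \<open>Asymptotics of caloric polynomials from averaged resistances\<close>

lemma stolz_cesaro_weighted:
  fixes a w :: "nat \<Rightarrow> real"
  assumes w: "\<And>i. 0 < w i" and W: "filterlim (\<lambda>n. \<Sum>i<n. w i) at_top sequentially"
    and lim: "(\<lambda>i. a i / w i) \<longlonglongrightarrow> \<alpha>"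
  shows "(\<lambda>n. (\<Sum>i<n. a i) / (\<Sum>i<n. w i)) \<longlonglongrightarrow> \<alpha>"
proof (rule LIMSEQ_I)
  let ?d = "\<lambda>i. \<bar>a i - \<alpha> * w i\<bar>"
  fix e :: real assume e: "0 < e"
  then obtain m where m: "\<And>i. i \<ge> m \<Longrightarrow> norm (a i / w i - \<alpha>) < e / 2"
    using LIMSEQ_D[OF lim, of "e/2"] by auto
  have m': "?d i \<le> e / 2 * w i" if "i \<ge> m" for i
  proof -
    have "?d i = \<bar>a i / w i - \<alpha>\<bar> * w i"
      using w[of i] by (simp add: abs_mult_pos field_simps)
    also have "\<dots> \<le> e / 2 * w i" using m[OF that] w[of i] by (intro mult_right_mono) auto
    finally show ?thesis .
  qed
  define C where "C = (\<Sum>i<m. ?d i)"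
  have "eventually (\<lambda>n. (\<Sum>i<n. w i) > max 0 (2 * C / e)) sequentially"
    using W unfolding filterlim_at_top_dense by blast
  then have "eventually (\<lambda>n. norm ((\<Sum>i<n. a i) / (\<Sum>i<n. w i) - \<alpha>) < e) sequentially"
    using eventually_ge_at_top[of m]
  proof eventually_elim
    case (elim n)
    let ?W = "\<Sum>i<n. w i"
    have W0: "?W > 0" and WC: "C < e / 2 * ?W" using elim e by (auto simp: field_simps)
    have "(\<Sum>i<n. a i) - \<alpha> * ?W = (\<Sum>i<n. a i - \<alpha> * w i)"
      by (simp add: sum_subtractf sum_distrib_left)
    then have "\<bar>(\<Sum>i<n. a i) - \<alpha> * ?W\<bar> \<le> (\<Sum>i<n. ?d i)" by (simp add: sum_abs)
    also have "\<dots> = C + (\<Sum>i\<in>{m..<n}. ?d i)"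
      unfolding C_def using elim by (simp flip: atLeast0LessThan add: sum.atLeastLessThan_concat)
    also have "(\<Sum>i\<in>{m..<n}. ?d i) \<le> (\<Sum>i\<in>{m..<n}. e / 2 * w i)"
      by (intro sum_mono m') auto
    also have "\<dots> \<le> e / 2 * ?W" unfolding sum_distrib_left[symmetric]
      using e w by (intro mult_left_mono sum_mono2) (auto intro: less_imp_le)
    finally have "\<bar>(\<Sum>i<n. a i) - \<alpha> * ?W\<bar> < e * ?W" using WC by simp
    moreover have "\<bar>(\<Sum>i<n. a i) / ?W - \<alpha>\<bar> * ?W = \<bar>(\<Sum>i<n. a i) - \<alpha> * ?W\<bar>"
      using W0 by (simp add: abs_mult_pos field_simps)
    ultimately have "\<bar>(\<Sum>i<n. a i) / ?W - \<alpha>\<bar> * ?W < e * ?W" by simp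
    then show ?case using W0 by simp
  qed
  then show "\<exists>no. \<forall>n\<ge>no. norm ((\<Sum>i<n. a i) / (\<Sum>i<n. w i) - \<alpha>) < e"
    by (simp add: eventually_sequentially)
qed

lemma shift_ratio_power: "(\<lambda>n. (real (Suc n) / real n) ^ k) \<longlonglongrightarrow> 1"
proof -
  have "(\<lambda>n. (real (Suc n) / real n) ^ k) \<longlonglongrightarrow> 1 ^ k"
    by (intro tendsto_power) real_asymp
  then show ?thesis by simp
qed

lemma tendsto_div_power_Suc:
  fixes f :: "nat \<Rightarrow> real"
  assumes "(\<lambda>n. f n / real n ^ k) \<longlonglongrightarrow> a"
  shows "(\<lambda>n. f (Suc n) / real n ^ k) \<longlonglongrightarrow> a"
proof -
  have "(\<lambda>n. f (Suc n) / real (Suc n) ^ k * (real (Suc n) / real n) ^ k) \<longlonglongrightarrow> a * 1"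
    using LIMSEQ_Suc[OF assms] shift_ratio_power by (rule tendsto_mult)
  moreover have "f (Suc n) / real (Suc n) ^ k * (real (Suc n) / real n) ^ k = f (Suc n) / real n ^ k" for n
    by (simp add: power_divide del: of_nat_Suc)
  ultimately show ?thesis by simp
qed

text \<open>Only the averages of \<open>r\<close> converge, not \<open>r\<close> itself. The
  differences of the (k+1)-st powers of the partial sums of \<open>r\<close>, taken as weights,
  contain \<open>r i\<close> as a factor; the irregular factor thus cancels in the quotient r i * f
  i / w i, and Stolz-Cesaro applies.\<close>

lemma weighted_power_sum:
  fixes r f :: "nat \<Rightarrow> real"
  assumes r: "\<And>i. 0 < r i" and A: "0 < A"
    and R: "(\<lambda>n. (\<Sum>i<n. r i) / n) \<longlonglongrightarrow> A" and f: "(\<lambda>n. f n / real n ^ k) \<longlonglongrightarrow> \<alpha>"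
  shows "(\<lambda>n. (\<Sum>i<n. r i * f i) / real n ^ Suc k) \<longlonglongrightarrow> A * \<alpha> / Suc k"
proof -
  define R' where "R' n = (\<Sum>i<n. r i)" for n
  define w where "w i = R' (Suc i) ^ Suc k - R' i ^ Suc k" for i
  have R'_nonneg: "0 \<le> R' n" for n unfolding R'_def using r by (intro sum_nonneg) (auto intro: less_imp_le)
  have R'_Suc: "R' (Suc n) = R' n + r n" for n by (simp add: R'_def)
  have w: "0 < w i" for i
    unfolding w_def R'_Suc using R'_nonneg[of i] r[of i] power_strict_mono[of "R' i" "R' i + r i" "Suc k"] by simp
  have sum_w: "(\<Sum>i<n. w i) = R' n ^ Suc k" for n
    unfolding w_def by (subst sum_lessThan_telescope) (simp add: R'_def)
  have R'lim: "(\<lambda>n. R' n / real n) \<longlonglongrightarrow> A" using R by (simp add: R'_def)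
  have R'top: "filterlim R' at_top sequentially"
  proof -
    have "filterlim (\<lambda>n. R' n / real n * real n) at_top sequentially"
      by (rule filterlim_tendsto_pos_mult_at_top[OF R'lim A filterlim_real_sequentially])
    moreover have "R' n / real n * real n = R' n" for n by (cases "n = 0") (simp_all add: R'_def)
    ultimately show ?thesis by simp
  qed
  have W: "filterlim (\<lambda>n. \<Sum>i<n. w i) at_top sequentially"
    unfolding sum_w by (rule filterlim_pow_at_top[OF _ R'top]) simp
  have R'S: "(\<lambda>n. R' (Suc n) / real n) \<longlonglongrightarrow> A"
    using tendsto_div_power_Suc[of R' 1 A] R'lim by simp
  \<comment> \<open>The cofactor of \<open>r i\<close> in \<open>w i\<close>: k + 1 products of k
    consecutive partial sums, hence asymptotic to (k + 1) * A^k * i^k.\<close>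
  define q where "q i = (\<Sum>p<Suc k. (R' (Suc i)) ^ p * (R' i) ^ (k - p))" for i
  have w_eq: "w i = r i * q i" for i
  proof -
    have "w i = (R' (Suc i) - R' i) * (\<Sum>p<Suc k. R' (Suc i) ^ p * R' i ^ (k - p))"
      unfolding w_def by (rule diff_power_eq_sum)
    then show ?thesis by (simp add: q_def R'_Suc)
  qed
  have qlim: "(\<lambda>i. q i / real i ^ k) \<longlonglongrightarrow> real (Suc k) * A ^ k"
  proof -
    have eq: "(\<Sum>p<Suc k. (R' (Suc i) / real i) ^ p * (R' i / real i) ^ (k - p)) = q i / real i ^ k" for i
      unfolding q_def sum_divide_distrib
    proof (rule sum.cong[OF refl])
      fix p assume "p \<in> {..<Suc k}"
      then have "real i ^ k = real i ^ p * real i ^ (k - p)" by (simp flip: power_add)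
      then show "(R' (Suc i) / real i) ^ p * (R' i / real i) ^ (k - p) = R' (Suc i) ^ p * R' i ^ (k - p) / real i ^ k"
        by (simp add: power_divide)
    qed
    have "(\<lambda>i. \<Sum>p<Suc k. (R' (Suc i) / real i) ^ p * (R' i / real i) ^ (k - p)) \<longlonglongrightarrow> (\<Sum>p<Suc k. A ^ p * A ^ (k - p))"
      by (intro tendsto_intros R'lim R'S)
    moreover have "(\<Sum>p<Suc k. A ^ p * A ^ (k - p)) = (\<Sum>p<Suc k. A ^ k)"
      by (intro sum.cong) (auto simp flip: power_add)
    ultimately show ?thesis unfolding eq by simp
  qed
  have "(\<lambda>i. (f i / real i ^ k) / (q i / real i ^ k)) \<longlonglongrightarrow> \<alpha> / (real (Suc k) * A ^ k)"
    by (intro tendsto_divide f qlim) (use A in auto)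
  then have "(\<lambda>i. (r i * f i) / w i) \<longlonglongrightarrow> \<alpha> / (real (Suc k) * A ^ k)"
  proof (rule Lim_transform_eventually)
    show "\<forall>\<^sub>F i in sequentially. f i / real i ^ k / (q i / real i ^ k) = r i * f i / w i"
      using eventually_gt_at_top[of 0]
      by eventually_elim (use r in \<open>simp add: w_eq less_imp_neq[symmetric]\<close>)
  qed
  from stolz_cesaro_weighted[OF w W this]
  have "(\<lambda>n. (\<Sum>i<n. r i * f i) / R' n ^ Suc k * (R' n / real n) ^ Suc k)
      \<longlonglongrightarrow> \<alpha> / (real (Suc k) * A ^ k) * A ^ Suc k"
    unfolding sum_w by (intro tendsto_mult tendsto_power R'lim)
  then have "(\<lambda>n. (\<Sum>i<n. r i * f i) / real n ^ Suc k) \<longlonglongrightarrow> \<alpha> / (real (Suc k) * A ^ k) * A ^ Suc k"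
  proof (rule Lim_transform_eventually)
    have "eventually (\<lambda>n. R' n > 0) sequentially" using R'top by (simp add: filterlim_at_top_dense)
    then show "\<forall>\<^sub>F n in sequentially. (\<Sum>i<n. r i * f i) / R' n ^ Suc k * (R' n / real n) ^ Suc k
        = (\<Sum>i<n. r i * f i) / real n ^ Suc k"
      by eventually_elim (simp add: power_divide)
  qed
  moreover have "\<alpha> / (real (Suc k) * A ^ k) * A ^ Suc k = A * \<alpha> / Suc k" using A by simp
  ultimately show ?thesis by simp
qed

text \<open>f x is asymptotic to \<alpha> * x^k at both ends with the same coefficient; the signed
  denominator on the left accounts for the parity of k.\<close>

definition growth :: "(int \<Rightarrow> real) \<Rightarrow> nat \<Rightarrow> real \<Rightarrow> bool" where
  "growth f k \<alpha> \<longleftrightarrow> (\<lambda>n. f (int n) / real n ^ k) \<longlonglongrightarrow> \<alpha>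
     \<and> (\<lambda>n. f (- int n) / (- real n) ^ k) \<longlonglongrightarrow> \<alpha>"

text \<open>Counterpart of integrating x^k against a medium of mean density \<open>A\<close>. The
  left half-line is reflected, the sign (-1)^k being moved into the function.\<close>

lemma growth_isum:
  assumes r: "\<And>y. 0 < r y" and A: "0 < A" and R: "growth (isum r) 1 A" and f: "growth f k \<alpha>"
  shows "growth (isum (\<lambda>y. r y * f y)) (Suc k) (A * \<alpha> / Suc k)"
  unfolding growth_def
proof
  show "(\<lambda>n. isum (\<lambda>y. r y * f y) (int n) / real n ^ Suc k) \<longlonglongrightarrow> A * \<alpha> / Suc k"
    unfolding isum_of_nat using R f r A
    by (intro weighted_power_sum) (auto simp: growth_def isum_of_nat)
  have R': "(\<lambda>n. (\<Sum>i<n. r (- int i - 1)) / n) \<longlonglongrightarrow> A"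
    using R by (simp add: growth_def isum_minus_of_nat)
  have "(\<lambda>n. ((-1) ^ k * f (- int n)) / real n ^ k) \<longlonglongrightarrow> \<alpha>"
  proof -
    have "f (- int n) / (- real n) ^ k = ((-1) ^ k * f (- int n)) / real n ^ k" for n
      by (subst power_minus) (simp add: divide_simps)
    then show ?thesis using f by (simp add: growth_def)
  qed
  from tendsto_div_power_Suc[OF this]
  \<comment> \<open>The left primitive samples \<open>f\<close> at -i - 1, whence the shift by
    one.\<close>
  have f': "(\<lambda>n. ((-1) ^ k * f (- int n - 1)) / real n ^ k) \<longlonglongrightarrow> \<alpha>"
    by (simp add: algebra_simps minus_diff_commute)
  have *: "(\<lambda>n. (\<Sum>i<n. r (- int i - 1) * ((-1) ^ k * f (- int i - 1))) / real n ^ Suc k) \<longlonglongrightarrow> A * \<alpha> / Suc k"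
    by (rule weighted_power_sum[OF r A R' f'])
  have "isum (\<lambda>y. r y * f y) (- int n) / (- real n) ^ Suc k
      = (\<Sum>i<n. r (- int i - 1) * ((-1) ^ k * f (- int i - 1))) / real n ^ Suc k" for n
  proof -
    have "(\<Sum>i<n. r (- int i - 1) * ((-1) ^ k * f (- int i - 1))) = (-1) ^ k * (\<Sum>i<n. r (- int i - 1) * f (- int i - 1))"
      by (simp add: sum_distrib_left mult_ac)
    moreover have "(- real n) ^ Suc k = - ((-1) ^ k * real n ^ Suc k)" by (subst power_minus) simp
    ultimately show ?thesis by (cases "even k") (simp_all add: isum_minus_of_nat)
  qed
  with * show "(\<lambda>n. isum (\<lambda>y. r y * f y) (- int n) / (- real n) ^ Suc k) \<longlonglongrightarrow> A * \<alpha> / Suc k" by simp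
qed

lemma growth_shift:
  assumes f: "growth f k \<alpha>"
  shows "growth (\<lambda>y. f (y + 1)) k \<alpha>"
  unfolding growth_def
proof
  show "(\<lambda>n. f (int n + 1) / real n ^ k) \<longlonglongrightarrow> \<alpha>"
    using f tendsto_div_power_Suc[of "\<lambda>n. f (int n)" k \<alpha>] by (simp add: growth_def add.commute)
  have "(\<lambda>n. f (- int n) / (- real n) ^ k / (real (Suc n) / real n) ^ k) \<longlonglongrightarrow> \<alpha> / 1"
    using f shift_ratio_power by (intro tendsto_divide) (auto simp: growth_def)
  then have "(\<lambda>n. f (- int n) / (- real (Suc n)) ^ k) \<longlonglongrightarrow> \<alpha> / 1"
  proof (rule Lim_transform_eventually)
    show "\<forall>\<^sub>F n in sequentially. f (- int n) / (- real n) ^ k / (real (Suc n) / real n) ^ k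
        = f (- int n) / (- real (Suc n)) ^ k"
      using eventually_gt_at_top[of 0]
    proof eventually_elim
      case (elim n)
      have "(- real n) ^ k * (real (Suc n) / real n) ^ k = (- real (Suc n)) ^ k"
        unfolding power_mult_distrib[symmetric] using elim by (simp del: of_nat_Suc)
      then show ?case by (simp only: divide_divide_eq_left)
    qed
  qed
  then have "(\<lambda>n. f (- int (Suc n) + 1) / (- real (Suc n)) ^ k) \<longlonglongrightarrow> \<alpha>" by simp
  then show "(\<lambda>n. f (- int n + 1) / (- real n) ^ k) \<longlonglongrightarrow> \<alpha>" by (rule LIMSEQ_imp_Suc)
qed

lemma growth_one: "growth (\<lambda>x. 1) 0 1"
  by (simp add: growth_def)

lemma growth_isum_one: "growth (isum (\<lambda>x. 1)) 1 1"
  unfolding growth_def isum_one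
  by (auto intro!: tendsto_eventually eventually_mono[OF eventually_gt_at_top[of 0]])

text \<open>Two degrees cost two primitives, only one of them weighted by \<open>r\<close>: the
  coefficient gains one factor \<open>A\<close> and 1 / ((k + 1) (k + 2)). The odd chain starts with
  the weighted primitive \<open>isum r\<close>, hence the exponent k / 2 rounded up.\<close>

lemma growth_heat_poly:
  assumes r: "\<And>y. 0 < r y" and A: "0 < A" and R: "growth (isum r) 1 A"
  shows "growth (heat_poly r k) k (A ^ (Suc k div 2) / fact k)"
proof (induction k rule: less_induct)
  case (less k)
  consider "k = 0" | "k = 1" | j where "k = Suc (Suc j)"
    by (metis One_nat_def not0_implies_Suc)
  then show ?case
  proof cases
    case 3
    define a where "a = A ^ (Suc j div 2) / fact j"
    have "growth (heat_poly r j) j a" unfolding a_def using less 3 by simp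
    then have "growth (isum (heat_poly r j)) (Suc j) (a / Suc j)"
      using growth_isum[of "\<lambda>_. 1" 1 "heat_poly r j" j a] growth_isum_one by simp
    then have "growth (\<lambda>y. isum (heat_poly r j) (y + 1)) (Suc j) (a / Suc j)"
      by (rule growth_shift)
    then have "growth (heat_poly r k) k (A * (a / Suc j) / Suc (Suc j))"
      unfolding 3 heat_poly.simps by (rule growth_isum[OF r A R])
    moreover have "A * (a / Suc j) / Suc (Suc j) = A ^ (Suc k div 2) / fact k"
      unfolding a_def 3 by (simp add: field_simps)
    ultimately show ?thesis by simp
  qed (use R growth_one in auto)
qed

text \<open>The finitely many points where the asymptotics are not yet accurate go into the
  constant. The bound holds at every x and can be summed against a law on Z.\<close>

lemma growth_approx:
  assumes f: "growth f k \<alpha>" and e: "0 < e"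
  shows "\<exists>C\<ge>0. \<forall>x. \<bar>f x - \<alpha> * of_int x ^ k\<bar> \<le> e * \<bar>of_int x\<bar> ^ k + C"
proof -
  have "\<forall>\<^sub>F n in sequentially. \<bar>f (int n) / real n ^ k - \<alpha>\<bar> < e \<and> \<bar>f (- int n) / (- real n) ^ k - \<alpha>\<bar> < e"
    using f e unfolding growth_def tendsto_iff dist_real_def by (intro eventually_conj) auto
  then obtain n0 where n0: "\<And>n. n \<ge> n0 \<Longrightarrow> \<bar>f (int n) / real n ^ k - \<alpha>\<bar> < e"
      "\<And>n. n \<ge> n0 \<Longrightarrow> \<bar>f (- int n) / (- real n) ^ k - \<alpha>\<bar> < e"
    unfolding eventually_sequentially by blast
  define C where "C = (\<Sum>x\<in>{- int n0..int n0}. \<bar>f x - \<alpha> * of_int x ^ k\<bar>)"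
  have "\<bar>f x - \<alpha> * of_int x ^ k\<bar> \<le> e * \<bar>of_int x\<bar> ^ k + C" for x
  proof (cases "x \<in> {- int n0..int n0}")
    case True
    then have "\<bar>f x - \<alpha> * of_int x ^ k\<bar> \<le> C" unfolding C_def by (intro member_le_sum) auto
    with e show ?thesis by (simp add: add_increasing)
  next
    case False
    have "\<bar>f x / of_int x ^ k - \<alpha>\<bar> < e"
    proof (cases "0 \<le> x")
      case True then show ?thesis using n0(1)[of "nat x"] False by simp
    next
      case neg: False then show ?thesis using n0(2)[of "nat (- x)"] False by simp
    qed
    moreover have x: "x \<noteq> 0" using False by auto
    then have "\<bar>f x - \<alpha> * of_int x ^ k\<bar> = \<bar>f x / of_int x ^ k - \<alpha>\<bar> * \<bar>of_int x ^ k\<bar>"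
      by (simp add: divide_simps flip: abs_mult)
    ultimately have "\<bar>f x - \<alpha> * of_int x ^ k\<bar> \<le> e * \<bar>of_int x ^ k\<bar>" by (simp add: mult_right_mono)
    moreover have "0 \<le> C" unfolding C_def by (simp add: sum_nonneg)
    ultimately show ?thesis by (simp add: power_abs)
  qed
  moreover have "0 \<le> C" unfolding C_def by (simp add: sum_nonneg)
  ultimately show ?thesis by blast
qed

lemma tendsto_ratio_power:
  fixes f g :: "nat \<Rightarrow> real" and s :: real
  assumes f: "(\<lambda>n. f n / (s * real n) ^ k) \<longlonglongrightarrow> a" and g: "(\<lambda>n. g n / (s * real n) ^ m) \<longlonglongrightarrow> b"
    and "b \<noteq> 0" "k < m" "s \<noteq> 0"
  shows "(\<lambda>n. f n / g n) \<longlonglongrightarrow> 0"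
proof -
  have "(\<lambda>n. 1 / (s * real n)) \<longlonglongrightarrow> 0"
    using tendsto_mult[OF tendsto_const[of "1/s"] lim_1_over_n] by simp
  then have "(\<lambda>n. (1 / (s * real n)) ^ (m - k)) \<longlonglongrightarrow> 0"
    using tendsto_power[of "\<lambda>n. 1 / (s * real n)" 0 sequentially "m - k"] \<open>k < m\<close> by simp
  then have "(\<lambda>n. (f n / (s * real n) ^ k) / (g n / (s * real n) ^ m) * (1 / (s * real n)) ^ (m - k)) \<longlonglongrightarrow> (a / b) * 0"
    using assms by (intro tendsto_mult tendsto_divide) auto
  then have "(\<lambda>n. f n / g n) \<longlonglongrightarrow> (a / b) * 0"
  proof (rule Lim_transform_eventually)
    show "\<forall>\<^sub>F n in sequentially. (f n / (s * real n) ^ k) / (g n / (s * real n) ^ m) * (1 / (s * real n)) ^ (m - k) = f n / g n"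
      using eventually_gt_at_top[of 0]
    proof eventually_elim
      case (elim n)
      have "(s * real n) ^ m = (s * real n) ^ k * (s * real n) ^ (m - k)" using \<open>k < m\<close> by (simp flip: power_add)
      then show ?case using elim \<open>s \<noteq> 0\<close> by (simp add: power_one_over divide_simps)
    qed
  qed
  then show ?thesis by simp
qed

lemma growth_ratio:
  assumes f: "growth f k a" and g: "growth g m b" and "b \<noteq> 0" "k < m"
  shows "(\<lambda>n. f (int n) / g (int n)) \<longlonglongrightarrow> 0" "(\<lambda>n. f (- int n) / g (- int n)) \<longlonglongrightarrow> 0"
  using tendsto_ratio_power[of "\<lambda>n. f (int n)" 1 k a "\<lambda>n. g (int n)" m b]
    tendsto_ratio_power[of "\<lambda>n. f (- int n)" "-1" k a "\<lambda>n. g (- int n)" m b] assms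
  by (auto simp: growth_def)

section \<open>The heat flow killed outside a box\<close>

lemma sum_telescope_int:
  fixes W :: "int \<Rightarrow> real"
  assumes "a - 1 \<le> b" shows "(\<Sum>x\<in>{a..b}. W x - W (x - 1)) = W b - W (a - 1)"
  using assms
proof (induction b rule: int_ge_induct)
  case (step b)
  then have "{a..b+1} = insert (b+1) {a..b}" by auto
  with step show ?case by simp
qed simp

text \<open>The tool by which differential inequalities for the flow are integrated; derivatives
  within the interval suffice, as the flow has only a one-sided derivative at time 0.\<close>

lemma increment_lower_bound:
  fixes f :: "real \<Rightarrow> real"
  assumes "\<And>t. t \<in> {a..b} \<Longrightarrow> (f has_real_derivative f' t) (at t within {a..b})"
    and "\<And>t. t \<in> {a..b} \<Longrightarrow> l \<le> f' t" and "a \<le> b"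
  shows "l * (b - a) \<le> f b - f a"
proof (cases "a < b")
  case True
  obtain x where "x \<in> {a<..<b}" "f b - f a = f' x * (b - a)"
    using mvt_simple[OF True, of f "\<lambda>t. (*) (f' t)"] assms(1)
    by (auto simp: has_field_derivative_def)
  with assms(2)[of x] assms(3) show ?thesis by (simp add: mult_right_mono)
qed (use assms in auto)

lemma increment_abs_bound:
  fixes f :: "real \<Rightarrow> real"
  assumes f: "\<And>t. t \<in> {a..b} \<Longrightarrow> (f has_real_derivative f' t) (at t within {a..b})"
    and f': "\<And>t. t \<in> {a..b} \<Longrightarrow> \<bar>f' t\<bar> \<le> l" and "a \<le> b"
  shows "\<bar>f b - f a\<bar> \<le> l * (b - a)"
proof -
  have "- l * (b - a) \<le> f b - f a"
    using f f' \<open>a \<le> b\<close> by (intro increment_lower_bound[of a b f f']) (auto simp: abs_le_iff minus_le_iff)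
  moreover have "- l * (b - a) \<le> - f b - - f a"
    using f' \<open>a \<le> b\<close> by (intro increment_lower_bound[of a b _ "\<lambda>t. - f' t"]) (auto simp: abs_le_iff intro!: derivative_intros f)
  ultimately show ?thesis by simp
qed

definition gen :: "(int \<Rightarrow> real) \<Rightarrow> (int \<Rightarrow> real) \<Rightarrow> int \<Rightarrow> real" where
  "gen c f x = c x * (f (x + 1) - f x) + c (x - 1) * (f (x - 1) - f x)"

lemma gen_heat_poly:
  assumes c: "\<And>x. 0 < c x"
  shows "gen c (heat_poly (\<lambda>x. 1 / c x) (Suc (Suc k))) x = heat_poly (\<lambda>x. 1 / c x) k x"
proof -
  let ?r = "\<lambda>x. 1 / c x"
  let ?g = "isum (heat_poly ?r k)"
  let ?f = "heat_poly ?r (Suc (Suc k))"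
  have 1: "?f (y + 1) - ?f y = ?g (y + 1) / c y" for y by (simp add: isum_step)
  have "c x * (?f (x + 1) - ?f x) = ?g (x + 1)" using c[of x] by (simp only: 1) simp
  moreover have "c (x - 1) * (?f (x - 1) - ?f x) = - ?g x"
    using 1[of "x - 1"] c[of "x - 1"] by (simp add: field_simps)
  ultimately show ?thesis unfolding gen_def by (simp only: isum_step)
qed

lemma gen_heat_poly_low:
  assumes c: "\<And>x. 0 < c x"
  shows "gen c (heat_poly (\<lambda>x. 1 / c x) 0) x = 0" "gen c (heat_poly (\<lambda>x. 1 / c x) (Suc 0)) x = 0"
proof -
  show "gen c (heat_poly (\<lambda>x. 1 / c x) 0) x = 0" by (simp add: gen_def)
  have "c y * (isum (\<lambda>x. 1 / c x) (y + 1) - isum (\<lambda>x. 1 / c x) y) = 1" for y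
    using c[of y] by (simp add: isum_step)
  from this[of x] this[of "x - 1"]
  show "gen c (heat_poly (\<lambda>x. 1 / c x) (Suc 0)) x = 0" by (simp add: gen_def algebra_simps)
qed

text \<open>The discrete Wronskian \<open>W\<close> telescopes. As \<open>v\<close> vanishes just
  outside the box, the boundary terms are the outward fluxes of \<open>v\<close> times the values of
  \<phi> at the exit points.\<close>

lemma green_formula:
  fixes v \<phi> :: "int \<Rightarrow> real"
  assumes "v (int N + 1) = 0" "v (- int N - 1) = 0"
  shows "(\<Sum>x\<in>{- int N..int N}. gen c v x * \<phi> x)
    = (\<Sum>x\<in>{- int N..int N}. v x * gen c \<phi> x)
      - c (int N) * v (int N) * \<phi> (int N + 1) - c (- int N - 1) * v (- int N) * \<phi> (- int N - 1)"
proof -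
  define W where "W x = c x * (v (x + 1) * \<phi> x - v x * \<phi> (x + 1))" for x
  have "gen c v x * \<phi> x - v x * gen c \<phi> x = W x - W (x - 1)" for x
    by (simp add: gen_def W_def algebra_simps)
  then have "(\<Sum>x\<in>{- int N..int N}. gen c v x * \<phi> x - v x * gen c \<phi> x) = W (int N) - W (- int N - 1)"
    by (simp only:) (rule sum_telescope_int, simp)
  then show ?thesis using assms by (simp add: W_def sum_subtractf)
qed

text \<open>Summation by parts. The edges start at -N - 1 because both edges leading out of the box
  carry energy.\<close>

lemma dirichlet_form_eq:
  fixes v w :: "int \<Rightarrow> real"
  assumes "w (int N + 1) = 0" "w (- int N - 1) = 0"
  shows "(\<Sum>x\<in>{- int N - 1..int N}. c x * (v (x + 1) - v x) * (w (x + 1) - w x))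
    = - (\<Sum>x\<in>{- int N..int N}. w x * gen c v x)"
proof -
  define V where "V x = c x * (v (x + 1) - v x)" for x
  define W where "W x = V x * w (x + 1)" for x
  have "c x * (v (x + 1) - v x) * (w (x + 1) - w x) = (W x - W (x - 1)) - w x * gen c v x" for x
    by (simp add: gen_def W_def V_def algebra_simps)
  then have "(\<Sum>x\<in>{- int N - 1..int N}. c x * (v (x + 1) - v x) * (w (x + 1) - w x))
      = (\<Sum>x\<in>{- int N - 1..int N}. W x - W (x - 1)) - (\<Sum>x\<in>{- int N - 1..int N}. w x * gen c v x)"
    by (simp add: sum_subtractf)
  also have "(\<Sum>x\<in>{- int N - 1..int N}. W x - W (x - 1)) = W (int N) - W (- int N - 1 - 1)"
    by (rule sum_telescope_int) simp
  also have "\<dots> = 0" unfolding W_def by (simp only: diff_add_cancel assms mult_zero_right diff_self)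
  also have "(\<Sum>x\<in>{- int N - 1..int N}. w x * gen c v x) = (\<Sum>x\<in>{- int N..int N}. w x * gen c v x)"
  proof (rule sum.mono_neutral_right)
    have "x = - int N - 1" if "x \<in> {- int N - 1..int N} - {- int N..int N}" for x using that by auto
    then show "\<forall>x\<in>{- int N - 1..int N} - {- int N..int N}. w x * gen c v x = 0" using assms(2) by (metis mult_zero_left)
  qed auto
  finally show ?thesis by simp
qed

text \<open>\<open>c x\<close> is the conductance of the edge {x, x + 1}. The equation is required
  in the box only: at the exit points \<open>u\<close> stays 0, although \<open>gen c (u t)\<close>
  need not vanish there.\<close>

locale killed_heat_flow =
  fixes c :: "int \<Rightarrow> real" and N :: nat and u :: "real \<Rightarrow> int \<Rightarrow> real"
  assumes c_pos: "\<And>x. 0 < c x"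
    and u_nonneg: "\<And>t x. 0 \<le> t \<Longrightarrow> 0 \<le> u t x"
    and u_outside: "\<And>t x. x \<notin> {- int N..int N} \<Longrightarrow> u t x = 0"
    and u_start: "\<And>x. u 0 x = (if x = 0 then 1 else 0)"
    and u_deriv: "\<And>t x. 0 \<le> t \<Longrightarrow> x \<in> {- int N..int N} \<Longrightarrow>
          ((\<lambda>t. u t x) has_real_derivative gen c (u t) x) (at t within {0..})"
begin

abbreviation box :: "int set" where "box \<equiv> {- int N..int N}"
abbreviation resistance :: "int \<Rightarrow> real" where "resistance \<equiv> \<lambda>x. 1 / c x"
abbreviation hpoly :: "nat \<Rightarrow> int \<Rightarrow> real" where "hpoly \<equiv> heat_poly resistance"

lemma u_deriv_Icc:
  "0 \<le> t \<Longrightarrow> 0 \<le> a \<Longrightarrow> x \<in> box \<Longrightarrow>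
    ((\<lambda>t. u t x) has_real_derivative gen c (u t) x) (at t within {a..b})"
  by (rule DERIV_subset[OF u_deriv]) auto

lemma u_continuous: "continuous_on {0..b} (\<lambda>t. u t x)"
proof (cases "x \<in> box")
  case True
  then show ?thesis
    by (intro DERIV_continuous_on[where D="\<lambda>t. gen c (u t) x"] u_deriv_Icc) auto
qed (simp add: u_outside)

lemma u_boundary [simp]: "u t (int N + 1) = 0" "u t (- int N - 1) = 0"
  by (auto intro: u_outside)

text \<open>Integrated outward flux at the right end: the probability of having left the box on this
  side by time t.\<close>

definition exit_right :: "real \<Rightarrow> real" where
  "exit_right t = integral {0..t} (\<lambda>s. c (int N) * u s (int N))"

definition exit_left :: "real \<Rightarrow> real" where
  "exit_left t = integral {0..t} (\<lambda>s. c (- int N - 1) * u s (- int N))"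

text \<open>\<open>stopped_mean \<phi> t\<close> is the expectation of \<open>\<phi>\<close> at time \<open>t\<close> for the walk stopped when it
  leaves the box.\<close>

definition stopped_mean :: "(int \<Rightarrow> real) \<Rightarrow> real \<Rightarrow> real" where
  "stopped_mean \<phi> t = (\<Sum>x\<in>box. u t x * \<phi> x) + \<phi> (int N + 1) * exit_right t + \<phi> (- int N - 1) * exit_left t"

lemma exit_nonneg: "0 \<le> t \<Longrightarrow> 0 \<le> exit_right t" "0 \<le> t \<Longrightarrow> 0 \<le> exit_left t"
  unfolding exit_right_def exit_left_def
  by (intro integral_nonneg integrable_continuous_interval continuous_intros u_continuous
      mult_nonneg_nonneg less_imp_le[OF c_pos] u_nonneg; simp)+

lemma exit_deriv:
  assumes "t \<in> {0..b}"
  shows "(exit_right has_real_derivative c (int N) * u t (int N)) (at t within {0..b})"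
    "(exit_left has_real_derivative c (- int N - 1) * u t (- int N)) (at t within {0..b})"
  unfolding exit_right_def[abs_def] exit_left_def[abs_def]
  by (intro integral_has_real_derivative[OF _ assms] continuous_intros u_continuous)+

lemma stopped_mean_0: "stopped_mean \<phi> 0 = \<phi> 0"
  by (simp add: stopped_mean_def exit_right_def exit_left_def u_start if_distrib[of "\<lambda>a. a * _"] sum.delta cong: if_cong)

text \<open>Dynkin's formula: the boundary terms of Green's formula cancel against the growth of the
  exit masses.\<close>

lemma stopped_mean_deriv:
  assumes t: "t \<in> {0..b}"
  shows "(stopped_mean \<phi> has_real_derivative (\<Sum>x\<in>box. u t x * gen c \<phi> x)) (at t within {0..b})"
proof -
  have "(stopped_mean \<phi> has_real_derivative
      ((\<Sum>x\<in>box. gen c (u t) x * \<phi> x) + \<phi> (int N + 1) * (c (int N) * u t (int N))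
       + \<phi> (- int N - 1) * (c (- int N - 1) * u t (- int N)))) (at t within {0..b})"
    unfolding stopped_mean_def[abs_def] using t
    by (intro DERIV_add DERIV_sum DERIV_cmult DERIV_cmult_right u_deriv_Icc exit_deriv) auto
  moreover have "(\<Sum>x\<in>box. gen c (u t) x * \<phi> x) + \<phi> (int N + 1) * (c (int N) * u t (int N))
       + \<phi> (- int N - 1) * (c (- int N - 1) * u t (- int N)) = (\<Sum>x\<in>box. u t x * gen c \<phi> x)"
    by (subst green_formula) auto
  ultimately show ?thesis by simp
qed

lemma stopped_mean_harmonic:
  assumes "\<And>x. gen c \<phi> x = 0" and t: "0 \<le> t"
  shows "stopped_mean \<phi> t = \<phi> 0"
proof -
  have "\<bar>stopped_mean \<phi> t - stopped_mean \<phi> 0\<bar> \<le> 0 * (t - 0)"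
    by (rule increment_abs_bound[OF stopped_mean_deriv]) (use assms in auto)
  then show ?thesis by (simp add: stopped_mean_0)
qed

lemma stopped_mean_heat_poly_0: "0 \<le> t \<Longrightarrow> stopped_mean (hpoly 0) t = 1"
  using stopped_mean_harmonic[OF gen_heat_poly_low(1)[where c=c, OF c_pos]] by simp

lemma stopped_mean_heat_poly_1: "0 \<le> t \<Longrightarrow> stopped_mean (hpoly (Suc 0)) t = 0"
  using stopped_mean_harmonic[OF gen_heat_poly_low(2)[where c=c, OF c_pos]] by simp

lemma total_mass: "0 \<le> t \<Longrightarrow> (\<Sum>x\<in>box. u t x) + exit_right t + exit_left t = 1"
  using stopped_mean_heat_poly_0[of t] by (simp add: stopped_mean_def)

lemma resistance_nonneg: "0 \<le> resistance x"
  using c_pos[of x] by simp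

text \<open>The derivative in degree 2j + 2 is the mean of degree 2j over the walk still in the box;
  adding the nonnegative boundary terms bounds it by the stopped mean of degree 2j, to which the
  induction applies.\<close>

lemma stopped_mean_even_le: "0 \<le> t \<Longrightarrow> stopped_mean (hpoly (2 * j)) t \<le> t ^ j / fact j"
proof (induction j arbitrary: t)
  case 0 then show ?case using stopped_mean_heat_poly_0[of t] by simp
next
  case (Suc j)
  let ?p = "hpoly (2 * j)" and ?q = "hpoly (2 * Suc j)"
  have gen: "gen c ?q x = ?p x" for x
    using gen_heat_poly[where c=c and k="2 * j", OF c_pos] by simp
  have "0 * (t - 0) \<le> (t ^ Suc j / fact (Suc j) - stopped_mean ?q t) - (0 ^ Suc j / fact (Suc j) - stopped_mean ?q 0)"
  proof (rule increment_lower_bound)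
    fix s assume s: "s \<in> {0..t}"
    show "((\<lambda>s. s ^ Suc j / fact (Suc j) - stopped_mean ?q s) has_real_derivative
        s ^ j / fact j - (\<Sum>x\<in>box. u s x * gen c ?q x)) (at s within {0..t})"
    proof (rule DERIV_diff[OF _ stopped_mean_deriv[OF s]])
      have "((\<lambda>s. s ^ Suc j / fact (Suc j)) has_real_derivative (of_nat (Suc j) * s ^ j) / fact (Suc j)) (at s within {0..t})"
        using DERIV_pow[of "Suc j" s "{0..t}"] by (intro DERIV_cdivide) simp
      then show "((\<lambda>s. s ^ Suc j / fact (Suc j)) has_real_derivative s ^ j / fact j) (at s within {0..t})"
        by (simp del: of_nat_Suc)
    qed
    have "(\<Sum>x\<in>box. u s x * gen c ?q x) \<le> stopped_mean ?p s"
    proof -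
      have "0 \<le> ?p (int N + 1) * exit_right s" "0 \<le> ?p (- int N - 1) * exit_left s"
        using s by (intro mult_nonneg_nonneg exit_nonneg heat_poly_even_nonneg resistance_nonneg; simp)+
      then show ?thesis unfolding gen stopped_mean_def by linarith
    qed
    also have "\<dots> \<le> s ^ j / fact j" using Suc.IH s by auto
    finally show "0 \<le> s ^ j / fact j - (\<Sum>x\<in>box. u s x * gen c ?q x)" by simp
  qed (use Suc.prems in auto)
  then show ?case by (simp add: stopped_mean_0)
qed

text \<open>Markov's inequality: in even degree all three parts of the stopped mean are
  nonnegative.\<close>

lemma exit_le:
  assumes "0 \<le> t"
  shows "hpoly (2 * j) (int N + 1) * exit_right t \<le> t ^ j / fact j"
    "hpoly (2 * j) (- int N - 1) * exit_left t \<le> t ^ j / fact j"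
proof -
  let ?p = "hpoly (2 * j)"
  have "0 \<le> (\<Sum>x\<in>box. u t x * ?p x)"
    using assms by (intro sum_nonneg mult_nonneg_nonneg u_nonneg heat_poly_even_nonneg resistance_nonneg) auto
  moreover have "0 \<le> ?p (int N + 1) * exit_right t" "0 \<le> ?p (- int N - 1) * exit_left t"
    using assms by (intro mult_nonneg_nonneg exit_nonneg heat_poly_even_nonneg resistance_nonneg; simp)+
  ultimately show "?p (int N + 1) * exit_right t \<le> t ^ j / fact j" "?p (- int N - 1) * exit_left t \<le> t ^ j / fact j"
    using stopped_mean_even_le[OF assms, of j] unfolding stopped_mean_def by linarith+
qed

section \<open>Symmetry, energy decay and increments of the flow\<close>

definition energy :: "(int \<Rightarrow> real) \<Rightarrow> real" where
  "energy v = (\<Sum>x\<in>{- int N - 1..int N}. c x * (v (x + 1) - v x) * (v (x + 1) - v x))"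

text \<open>The pairing of the flow at time s with the flow at time 2t - s is constant in s, because
  \<open>gen\<close> is symmetric on functions vanishing outside the box. The two sides are its
  values at s = 0 and at s = t.\<close>

lemma u_symmetry:
  assumes t: "0 \<le> t"
  shows "u (2 * t) 0 = (\<Sum>x\<in>box. u t x ^ 2)"
proof -
  define h where "h s = (\<Sum>x\<in>box. u s x * u (2 * t - s) x)" for s
  have "\<bar>h t - h 0\<bar> \<le> 0 * (t - 0)"
  proof (rule increment_abs_bound)
    fix s assume s: "s \<in> {0..t}"
    have refl_deriv: "((\<lambda>s. u (2 * t - s) x) has_real_derivative - gen c (u (2 * t - s)) x) (at s within {0..t})"
      if "x \<in> box" for x
    proof -
      have "((\<lambda>t. u t x) \<circ> (\<lambda>s. 2 * t - s) has_real_derivative gen c (u (2 * t - s)) x * (- 1)) (at s within {0..t})"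
      proof (rule DERIV_image_chain)
        show "((\<lambda>t. u t x) has_real_derivative gen c (u (2 * t - s)) x) (at (2 * t - s) within (\<lambda>s. 2 * t - s) ` {0..t})"
          by (rule DERIV_subset[OF u_deriv]) (use that s in auto)
        show "((\<lambda>s. 2 * t - s) has_real_derivative - 1) (at s within {0..t})"
          by (auto intro!: derivative_eq_intros)
      qed
      then show ?thesis by (simp add: o_def)
    qed
    show "(h has_real_derivative (\<Sum>x\<in>box. gen c (u s) x * u (2 * t - s) x + (- gen c (u (2 * t - s)) x) * u s x))
        (at s within {0..t})"
      unfolding h_def[abs_def] using s by (intro DERIV_sum DERIV_mult u_deriv_Icc refl_deriv) auto
    have "(\<Sum>x\<in>box. gen c (u s) x * u (2 * t - s) x) = (\<Sum>x\<in>box. gen c (u (2 * t - s)) x * u s x)"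
      by (subst green_formula) (auto simp: mult.commute)
    then show "\<bar>\<Sum>x\<in>box. gen c (u s) x * u (2 * t - s) x + (- gen c (u (2 * t - s)) x) * u s x\<bar> \<le> 0"
      by (simp add: sum_subtractf)
  qed (use t in auto)
  then have "h t = h 0" by simp
  moreover have "h 0 = u (2 * t) 0"
    by (simp add: h_def u_start if_distrib[of "\<lambda>a. a * _"] sum.delta cong: if_cong)
  ultimately show ?thesis by (simp add: h_def power2_eq_square)
qed

text \<open>The derivative of the energy is -2 times the sum over the box of the squares of
  \<open>gen c (u t)\<close>.\<close>

lemma energy_antimono:
  assumes "0 \<le> s" "s \<le> t"
  shows "energy (u t) \<le> energy (u s)"
proof -
  \<comment> \<open>The time derivative at every site: 0 outside the box, where \<open>u\<close> is
    constant, so that summation by parts applies to it.\<close>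
  define u' where "u' t x = (if x \<in> box then gen c (u t) x else 0)" for t x
  have u': "((\<lambda>t. u t x) has_real_derivative u' t x) (at t within {s..b})" if "s \<le> t" for t b x
    using u_deriv_Icc[of t s x b] assms that by (cases "x \<in> box") (auto simp: u'_def u_outside)
  have "0 * (t - s) \<le> - energy (u t) - - energy (u s)"
  proof (rule increment_lower_bound)
    fix a assume a: "a \<in> {s..t}"
    let ?d = "\<Sum>x\<in>{- int N - 1..int N}. (c x * (u a (x + 1) - u a x)) * (u' a (x + 1) - u' a x)
        + (c x * (u' a (x + 1) - u' a x)) * (u a (x + 1) - u a x)"
    show "((\<lambda>t. - energy (u t)) has_real_derivative - ?d) (at a within {s..t})"
      unfolding energy_def using a
      by (intro DERIV_minus DERIV_sum DERIV_mult' DERIV_cmult DERIV_diff u') auto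
    have "?d = 2 * (\<Sum>x\<in>{- int N - 1..int N}. c x * (u a (x + 1) - u a x) * (u' a (x + 1) - u' a x))"
      unfolding sum_distrib_left by (intro sum.cong) auto
    also have "\<dots> = - 2 * (\<Sum>x\<in>box. u' a x * gen c (u a) x)"
      by (subst dirichlet_form_eq) (auto simp: u'_def)
    also have "\<dots> \<le> 0" by (auto simp: u'_def intro!: sum_nonneg)
    finally show "0 \<le> - ?d" by simp
  qed (use assms in auto)
  then show ?thesis by simp
qed

text \<open>The sum of squares of \<open>u\<close> decreases at twice the rate given by the energy.
  On [t/2, t] the energy is at least its final value, and the sum of squares at time t/2 is
  \<open>u t 0\<close> by symmetry.\<close>

lemma energy_le:
  assumes t: "0 \<le> t"
  shows "t * energy (u t) \<le> u t 0"
proof -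
  have "energy (u t) * (t - t / 2) \<le> - (\<Sum>x\<in>box. u t x ^ 2) / 2 - - (\<Sum>x\<in>box. u (t / 2) x ^ 2) / 2"
  proof (rule increment_lower_bound)
    fix s assume s: "s \<in> {t / 2..t}"
    show "((\<lambda>t. - (\<Sum>x\<in>box. u t x ^ 2) / 2) has_real_derivative energy (u s)) (at s within {t / 2..t})"
    proof -
      have "((\<lambda>t. - (\<Sum>x\<in>box. u t x ^ 2) / 2) has_real_derivative
         - (\<Sum>x\<in>box. of_nat 2 * (gen c (u s) x * u s x ^ (2 - Suc 0))) / 2) (at s within {t / 2..t})"
        using s t by (intro DERIV_cdivide DERIV_minus DERIV_sum DERIV_power u_deriv_Icc) auto
      moreover have "energy (u s) = - (\<Sum>x\<in>box. u s x * gen c (u s) x)"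
        unfolding energy_def by (rule dirichlet_form_eq) auto
      ultimately show ?thesis by (simp add: sum_distrib_left[symmetric] mult.commute)
    qed
    show "energy (u t) \<le> energy (u s)" using s t by (intro energy_antimono) auto
  qed (use t in auto)
  also have "\<dots> \<le> u t 0 / 2" using u_symmetry[of "t / 2"] t by (simp add: sum_nonneg)
  finally show ?thesis by (simp add: mult.commute)
qed

lemma increment_square_le:
  assumes xy: "x \<le> y"
  shows "(u t y - u t x)\<^sup>2 \<le> energy (u t) * (isum resistance y - isum resistance x)"
proof -
  let ?d = "\<lambda>z. u t (z + 1) - u t z"
  have "u t y - u t x = (\<Sum>z\<in>{x..<y}. ?d z)"
    using xy
  proof (induction y rule: int_ge_induct)
    case (step y)
    then have "{x..<y+1} = insert y {x..<y}" by auto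
    with step show ?case by simp
  qed simp
  \<comment> \<open>The split into sqrt c times the increment and 1 / sqrt c makes Cauchy-Schwarz
    produce energy times resistance.\<close>
  also have "\<dots> = (\<Sum>z\<in>{x..<y}. (sqrt (c z) * ?d z) * (1 / sqrt (c z)))"
    using c_pos by (intro sum.cong) (auto simp: less_imp_neq[symmetric])
  finally have "(u t y - u t x)\<^sup>2 \<le> (\<Sum>z\<in>{x..<y}. (sqrt (c z) * ?d z)\<^sup>2) * (\<Sum>z\<in>{x..<y}. (1 / sqrt (c z))\<^sup>2)"
    using Cauchy_Schwarz_ineq_sum by metis
  also have "(\<Sum>z\<in>{x..<y}. (1 / sqrt (c z))\<^sup>2) = isum resistance y - isum resistance x"
    unfolding isum_diff[OF xy] using c_pos by (intro sum.cong) (auto simp: power_divide less_imp_le)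
  also have "(\<Sum>z\<in>{x..<y}. (sqrt (c z) * ?d z)\<^sup>2) = (\<Sum>z\<in>{x..<y}. c z * ?d z * ?d z)"
    using c_pos by (intro sum.cong) (auto simp: power_mult_distrib power2_eq_square less_imp_le)
  also have "\<dots> = (\<Sum>z\<in>{x..<y} \<inter> {- int N - 1..int N}. c z * ?d z * ?d z)"
  proof (rule sum.mono_neutral_right)
    show "\<forall>z\<in>{x..<y} - {x..<y} \<inter> {- int N - 1..int N}. c z * ?d z * ?d z = 0"
    proof
      fix z assume "z \<in> {x..<y} - {x..<y} \<inter> {- int N - 1..int N}"
      then have "z \<notin> box" "z + 1 \<notin> box" by auto
      then show "c z * ?d z * ?d z = 0" using u_outside[of z t] u_outside[of "z + 1" t] by simp
    qed
  qed auto
  also have "\<dots> \<le> energy (u t)"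
    unfolding energy_def by (rule sum_mono2) (auto simp: mult.assoc less_imp_le[OF c_pos])
  finally show ?thesis
    using xy isum_mono[of resistance x y] resistance_nonneg by (simp add: mult_right_mono)
qed

end

lemma killed_heat_flow_holder:
  assumes "killed_heat_flow c N u" "0 < t" "x \<le> y"
  shows "(u t y - u t x)\<^sup>2 \<le> u t 0 / t * (isum (\<lambda>x. 1 / c x) y - isum (\<lambda>x. 1 / c x) x)"
proof -
  interpret killed_heat_flow c N u by fact
  have "energy (u t) \<le> u t 0 / t" using energy_le[of t] assms by (simp add: field_simps)
  then show ?thesis
    using increment_square_le[OF \<open>x \<le> y\<close>, of t] isum_mono[of resistance x y] resistance_nonneg \<open>x \<le> y\<close>
    by (meson diff_ge_0_iff_ge mult_right_mono order_trans)
qed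

text \<open>For a Brownian motion of variance 2t this is its k-th moment divided by k!, that is, the
  mean of the caloric polynomial with leading term x^k / k!.\<close>

definition brownian_moment :: "nat \<Rightarrow> real \<Rightarrow> real" where
  "brownian_moment k t = (if even k then t ^ (k div 2) / fact (k div 2) else 0)"

lemma brownian_moment_Suc_Suc_deriv:
  "(brownian_moment (Suc (Suc k)) has_real_derivative brownian_moment k t) (at t within S)"
proof -
  have "((\<lambda>t. t ^ Suc j / fact (Suc j)) has_real_derivative (of_nat (Suc j) * t ^ j) / fact (Suc j)) (at t within S)" for j
    using DERIV_pow[of "Suc j" t S] by (intro DERIV_cdivide) simp
  from this[of "k div 2"] show ?thesis
    by (auto simp: brownian_moment_def[abs_def] simp del: of_nat_Suc power_Suc fact_Suc)
       (simp add: divide_simps)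
qed

section \<open>Means of caloric polynomials as the box grows\<close>

locale killed_heat_flows =
  fixes c :: "int \<Rightarrow> real" and u :: "nat \<Rightarrow> real \<Rightarrow> int \<Rightarrow> real" and A :: real
  assumes flow: "\<And>N. killed_heat_flow c N (u N)"
    and A_pos: "0 < A" and resistance_growth: "growth (isum (\<lambda>x. 1 / c x)) 1 A"
begin

abbreviation poly :: "nat \<Rightarrow> int \<Rightarrow> real" where "poly k \<equiv> heat_poly (\<lambda>x. 1 / c x) k"
abbreviation exit_r where "exit_r N t \<equiv> killed_heat_flow.exit_right c N (u N) t"
abbreviation exit_l where "exit_l N t \<equiv> killed_heat_flow.exit_left c N (u N) t"

lemma c_pos: "0 < c x"
  using flow[of 0] by (rule killed_heat_flow.c_pos)

lemma poly_growth: "growth (poly k) k (A ^ (Suc k div 2) / fact k)"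
  by (rule growth_heat_poly) (use c_pos A_pos resistance_growth in auto)

lemma poly_even_pos: "\<forall>\<^sub>F n in sequentially. 0 < poly (2 * j) (int n) \<and> 0 < poly (2 * j) (- int n)"
proof -
  have "0 < A ^ (Suc (2 * j) div 2) / fact (2 * j)" using A_pos by simp
  with poly_growth[of "2 * j"]
  have "\<forall>\<^sub>F n in sequentially. 0 < poly (2 * j) (int n) / real n ^ (2 * j) \<and>
      0 < poly (2 * j) (- int n) / (- real n) ^ (2 * j)"
    unfolding growth_def by (intro eventually_conj order_tendstoD(1)[where F=sequentially]) auto
  then show ?thesis using eventually_gt_at_top[of 0]
    by eventually_elim (simp add: zero_less_divide_iff)
qed

text \<open>By \<open>exit_le\<close> an exit probability is at most a constant divided by the
  polynomial of degree 2j at the exit point; with j = k + 1 this beats degree k. Uniformity in t is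
  needed because the bound is integrated in time afterwards.\<close>

lemma boundary_term_small:
  assumes b: "0 \<le> b" and e: "0 < e"
  shows "\<forall>\<^sub>F N in sequentially. \<forall>t\<in>{0..b}.
    \<bar>poly k (int N + 1) * exit_r N t + poly k (- int N - 1) * exit_l N t\<bar> \<le> e"
proof -
  define j where "j = Suc k"
  define B where "B = b ^ j / fact j"
  let ?ratio = "\<lambda>n. \<bar>poly k (int n) / poly (2 * j) (int n)\<bar> * B + \<bar>poly k (- int n) / poly (2 * j) (- int n)\<bar> * B"
  let ?pos = "\<lambda>n. 0 < poly (2 * j) (int n) \<and> 0 < poly (2 * j) (- int n)"
  have B: "0 \<le> B" using b by (simp add: B_def)
  have gt: "A ^ (Suc (2 * j) div 2) / fact (2 * j) \<noteq> 0" "k < 2 * j" using A_pos by (auto simp: j_def)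
  note lim = growth_ratio[OF poly_growth[of k] poly_growth[of "2 * j"] gt]
  have "(\<lambda>n. ?ratio n) \<longlonglongrightarrow> 0"
    using tendsto_add[OF tendsto_mult_right[OF tendsto_rabs[OF lim(1)], of B] tendsto_mult_right[OF tendsto_rabs[OF lim(2)], of B]]
    by simp
  then have "\<forall>\<^sub>F n in sequentially. ?ratio n < e"
    using e by (rule order_tendstoD)
  with poly_even_pos[of j]
  have "\<forall>\<^sub>F n in sequentially. ?pos n \<and>
      ?ratio n < e"
    by (rule eventually_conj)
  \<comment> \<open>The exit points lie at distance N + 1 from the origin.\<close>
  then have "\<forall>\<^sub>F N in sequentially. ?pos (Suc N) \<and>
      ?ratio (Suc N) < e"
    by (subst (asm) eventually_sequentially_Suc[symmetric])
  then show ?thesis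
  proof eventually_elim
    case (elim N)
    interpret killed_heat_flow c N "u N" by (rule flow)
    have s: "int (Suc N) = int N + 1" "- (int N + 1) = - int N - 1" by auto
    note elim = elim[unfolded s]
    show ?case
    proof
      fix t assume t: "t \<in> {0..b}"
      then have tB: "t ^ j / fact j \<le> B" unfolding B_def by (intro divide_right_mono power_mono) auto
      have bound: "\<bar>a * x\<bar> \<le> \<bar>a / p\<bar> * B" if "0 < p" "0 \<le> x" "p * x \<le> t ^ j / fact j" for a p x :: real
      proof -
        have "\<bar>a * x\<bar> = \<bar>a / p\<bar> * (p * x)" using that by (simp add: abs_mult)
        also have "\<dots> \<le> \<bar>a / p\<bar> * B" using that tB by (intro mult_left_mono) auto
        finally show ?thesis .
      qed
      have "\<bar>poly k (int N + 1) * exit_right t\<bar> \<le> \<bar>poly k (int N + 1) / poly (2 * j) (int N + 1)\<bar> * B"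
        using elim t by (intro bound exit_nonneg exit_le) auto
      moreover have "\<bar>poly k (- int N - 1) * exit_left t\<bar> \<le> \<bar>poly k (- int N - 1) / poly (2 * j) (- int N - 1)\<bar> * B"
        using elim t by (intro bound exit_nonneg exit_le) auto
      ultimately show "\<bar>poly k (int N + 1) * exit_right t + poly k (- int N - 1) * exit_left t\<bar> \<le> e"
        using elim by linarith
    qed
  qed
qed

text \<open>Induction in steps of two: from degree 2 on, the stopped mean and its limit both start
  at 0, and the derivative of their difference is the error in degree k - 2 minus the boundary term
  of that degree.\<close>

lemma stopped_moment_limit:
  assumes b: "0 \<le> b" and e: "0 < e"
  shows "\<forall>\<^sub>F N in sequentially. \<forall>t\<in>{0..b}.
    \<bar>killed_heat_flow.stopped_mean c N (u N) (poly k) t - brownian_moment k t\<bar> \<le> e"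
  using e
proof (induction k arbitrary: e rule: less_induct)
  case (less k)
  consider "k = 0" | "k = 1" | j where "k = Suc (Suc j)"
    by (metis One_nat_def not0_implies_Suc)
  then show ?case
  proof cases
    case 1
    then show ?thesis
      using less.prems killed_heat_flow.stopped_mean_heat_poly_0[OF flow]
      by (intro always_eventually) (simp add: brownian_moment_def del: heat_poly.simps)
  next
    case 2
    then show ?thesis
      using less.prems killed_heat_flow.stopped_mean_heat_poly_1[OF flow]
      by (intro always_eventually) (simp add: brownian_moment_def del: heat_poly.simps)
  next
    case 3
    \<comment> \<open>Two errors of size d, integrated over a time at most b, must stay below e; b +
      1 covers b = 0.\<close>
    define d where "d = e / 2 / (b + 1)"
    have d: "0 < d" using less.prems b by (simp add: d_def)
    have "2 * d * b \<le> 2 * d * (b + 1)" using d by simp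
    also have "\<dots> = e"
    proof -
      have "b + 1 \<noteq> 0" using b by simp
      then have "d * (b + 1) = e / 2" unfolding d_def by (rule nonzero_eq_divide_eq[THEN iffD1, OF _ refl])
      then show ?thesis by (simp only: mult.assoc)
    qed
    finally have db: "2 * d * b \<le> e" .
    have "\<forall>\<^sub>F N in sequentially. \<forall>t\<in>{0..b}.
        \<bar>killed_heat_flow.stopped_mean c N (u N) (poly j) t - brownian_moment j t\<bar> \<le> d"
      using less.IH[of j d] d 3 by simp
    then show ?thesis using boundary_term_small[OF b d, of j]
    proof eventually_elim
      case (elim N)
      interpret killed_heat_flow c N "u N" by (rule flow)
      have gen: "gen c (poly k) x = poly j x" for x
        unfolding 3 by (rule gen_heat_poly) (rule c_pos)
      show ?case
      proof
        fix t assume t: "t \<in> {0..b}"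
        have "\<bar>(stopped_mean (poly k) t - brownian_moment k t) - (stopped_mean (poly k) 0 - brownian_moment k 0)\<bar>
            \<le> 2 * d * (t - 0)"
        proof (rule increment_abs_bound)
          fix s assume s: "s \<in> {0..t}"
          show "((\<lambda>t. stopped_mean (poly k) t - brownian_moment k t) has_real_derivative
              (\<Sum>x\<in>box. u N s x * gen c (poly k) x) - brownian_moment j s) (at s within {0..t})"
            using brownian_moment_Suc_Suc_deriv[of j s] unfolding 3
            by (intro DERIV_diff stopped_mean_deriv s) auto
          have "s \<in> {0..b}" using s t by auto
          with elim have "\<bar>stopped_mean (poly j) s - brownian_moment j s\<bar> \<le> d"
            "\<bar>poly j (int N + 1) * exit_right s + poly j (- int N - 1) * exit_left s\<bar> \<le> d" by auto
          then show "\<bar>(\<Sum>x\<in>box. u N s x * gen c (poly k) x) - brownian_moment j s\<bar> \<le> 2 * d"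
            unfolding gen stopped_mean_def by linarith
        qed (use t in auto)
        moreover have "stopped_mean (poly k) 0 = 0" "brownian_moment k 0 = 0"
          unfolding 3 stopped_mean_0 by (auto simp: brownian_moment_def)
        ultimately have "\<bar>stopped_mean (poly k) t - brownian_moment k t\<bar> \<le> 2 * d * t" by simp
        also have "\<dots> \<le> 2 * d * b" using d t by simp
        finally show "\<bar>stopped_mean (poly k) t - brownian_moment k t\<bar> \<le> e" using db by linarith
      qed
    qed
  qed
qed

lemma moment_limit:
  assumes t: "0 \<le> t"
  shows "(\<lambda>N. \<Sum>x\<in>{- int N..int N}. u N t x * poly k x) \<longlonglongrightarrow> brownian_moment k t"
proof (rule LIMSEQ_I)
  fix e :: real assume "0 < e"
  then have e: "0 < e / 3" by simp
  have "\<forall>\<^sub>F N in sequentially. norm ((\<Sum>x\<in>{- int N..int N}. u N t x * poly k x) - brownian_moment k t) < e"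
    using stopped_moment_limit[OF t e, of k] boundary_term_small[OF t e, of k]
  proof eventually_elim
    case (elim N)
    have "t \<in> {0..t}" using t by simp
    with elim have "\<bar>killed_heat_flow.stopped_mean c N (u N) (poly k) t - brownian_moment k t\<bar> \<le> e / 3"
      "\<bar>poly k (int N + 1) * exit_r N t + poly k (- int N - 1) * exit_l N t\<bar> \<le> e / 3" by blast+
    then show ?case using e unfolding killed_heat_flow.stopped_mean_def[OF flow] real_norm_def by linarith
  qed
  then show "\<exists>n0. \<forall>N\<ge>n0. norm ((\<Sum>x\<in>{- int N..int N}. u N t x * poly k x) - brownian_moment k t) < e"
    by (simp add: eventually_sequentially)
qed

end

section \<open>Independent exponential clocks\<close>

lemma space_exponential_law [simp]: "space (exponential_law l) = UNIV"
  by (simp add: exponential_law_def)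

lemma sets_exponential_law [simp, measurable_cong]: "sets (exponential_law l) = sets borel"
  by (simp add: exponential_law_def)

lemma prob_space_exponential_law: "0 < l \<Longrightarrow> prob_space (exponential_law l)"
  unfolding exponential_law_def by (rule prob_space_exponential_density)

lemma distributed_exponential_law: "distributed (exponential_law l) lborel (\<lambda>v. v) (exponential_density l)"
proof -
  have "distr (exponential_law l) lborel (\<lambda>v. v) = exponential_law l"
    by (rule distr_id2) simp
  then show ?thesis unfolding distributed_def by (simp add: exponential_law_def)
qed

lemma exponential_law_le:
  assumes "0 < l" "0 \<le> a" shows "emeasure (exponential_law l) {v. v \<le> a} = ennreal (1 - exp (- a * l))"
proof -
  interpret prob_space "exponential_law l" by (rule prob_space_exponential_law) fact
  show ?thesis using exponential_distributedD_le[OF distributed_exponential_law assms(2,1)]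
    by (simp add: emeasure_eq_measure)
qed

lemma exponential_law_gt:
  assumes "0 < l" "0 \<le> a" shows "emeasure (exponential_law l) {v. a < v} = ennreal (exp (- a * l))"
proof -
  interpret prob_space "exponential_law l" by (rule prob_space_exponential_law) fact
  show ?thesis using exponential_distributedD_gt[OF distributed_exponential_law assms(2,1)]
    by (simp add: emeasure_eq_measure)
qed

lemma exponential_law_pos: "0 < l \<Longrightarrow> measure (exponential_law l) {0<..} = 1"
  using exponential_law_gt[of l 0] by (simp add: measure_def greaterThan_def)

lemma exponential_law_neg: "0 < l \<Longrightarrow> a < 0 \<Longrightarrow> emeasure (exponential_law l) {v. v \<le> a} = 0"
proof -
  assume l: "0 < l" "a < 0"
  have "emeasure (exponential_law l) {v. v \<le> a} \<le> emeasure (exponential_law l) {v. v \<le> 0}"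
    using l by (intro emeasure_mono) auto
  with exponential_law_le[of l 0] l show ?thesis by simp
qed

locale exponential_clocks =
  fixes l :: "nat \<Rightarrow> real"
  assumes l_pos: "\<And>i. 0 < l i"
begin

abbreviation clocks :: "nat set \<Rightarrow> (nat \<Rightarrow> real) measure" where
  "clocks I \<equiv> Pi\<^sub>M I (\<lambda>i. exponential_law (l i))"

sublocale product_prob_space "\<lambda>i. exponential_law (l i)" UNIV
  using prob_space_exponential_law[OF l_pos]
  by (simp add: product_prob_space_def product_prob_space_axioms_def product_sigma_finite_def prob_space_imp_sigma_finite)

lemma prob_space_clocks: "prob_space (clocks I)"
  by (intro prob_space_PiM prob_space_exponential_law l_pos)

lemma emeasure_clocks_Suc:
  assumes R: "R \<in> sets (clocks {1..Suc n})"
  shows "emeasure (clocks {1..Suc n}) R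
    = (\<integral>\<^sup>+x. emeasure (exponential_law (l (Suc n))) {v. x(Suc n := v) \<in> R} \<partial>clocks {1..n})"
proof -
  have ins: "{1..Suc n} = insert (Suc n) {1..n}" by auto
  have R': "R \<in> sets (clocks (insert (Suc n) {1..n}))" using R unfolding ins .
  have "emeasure (clocks {1..Suc n}) R = (\<integral>\<^sup>+x. indicator R x \<partial>clocks {1..Suc n})" using R by simp
  also have "\<dots> = (\<integral>\<^sup>+x. \<integral>\<^sup>+v. indicator R (x(Suc n := v)) \<partial>exponential_law (l (Suc n)) \<partial>clocks {1..n})"
    unfolding ins by (rule product_nn_integral_insert) (use R' in auto)
  also have "\<dots> = (\<integral>\<^sup>+x. emeasure (exponential_law (l (Suc n))) {v. x(Suc n := v) \<in> R} \<partial>clocks {1..n})"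
  proof (rule nn_integral_cong)
    fix x assume x: "x \<in> space (clocks {1..n})"
    have "(\<lambda>v. x(Suc n := v)) \<in> measurable (exponential_law (l (Suc n))) (clocks (insert (Suc n) {1..n}))"
      using x by (intro measurable_fun_upd[where J="{1..n}"]) auto
    from measurable_sets[OF this R']
    have "{v. x(Suc n := v) \<in> R} \<in> sets (exponential_law (l (Suc n)))"
      by (simp add: vimage_def)
    moreover have "indicator R (x(Suc n := v)) = (indicator {v. x(Suc n := v) \<in> R} v :: ennreal)" for v
      by (auto split: split_indicator)
    ultimately show "(\<integral>\<^sup>+v. indicator R (x(Suc n := v)) \<partial>exponential_law (l (Suc n)))
        = emeasure (exponential_law (l (Suc n))) {v. x(Suc n := v) \<in> R}" by simp
  qed
  finally show ?thesis .
qed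

text \<open>The time integral below starts at 0 and captures all of [J_n, t] only when the jump time
  J_n is nonnegative.\<close>

lemma sum_clocks_nonneg: "AE x in clocks {1..n}. 0 \<le> (\<Sum>i\<in>{1..n}. x i)"
proof -
  have "AE x in clocks {1..n}. 0 < x i" if "i \<in> {1..n}" for i
  proof (rule AE_PiM_component[where P="\<lambda>v. 0 < v"])
    have "AE v in exponential_law (l i). v \<in> {0<..}"
      by (rule prob_space.AE_prob_1[OF prob_space_exponential_law[OF l_pos]]) (rule exponential_law_pos[OF l_pos])
    then show "AE v in exponential_law (l i). 0 < v" by simp
  qed (use that prob_space_exponential_law[OF l_pos] in auto)
  then have "AE x in clocks {1..n}. \<forall>i\<in>{1..n}. 0 < x i" by (intro AE_finite_allI) auto
  then show ?thesis by eventually_elim (rule sum_nonneg, auto intro: less_imp_le)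
qed

text \<open>Given J_n = j, the left side integrates exp (- l (s - j)) over [j, t], which is 1 / l
  times the probability that the last clock rings by time t; Fubini then averages over j. Through
  this identity the exponential law enters the forward equation.\<close>

lemma clocks_jump_integral:
  assumes t: "0 \<le> t"
  shows "((\<lambda>s. measure (clocks {1..Suc n}) {x \<in> space (clocks {1..Suc n}). (\<Sum>i\<in>{1..n}. x i) \<le> s \<and> s < (\<Sum>i\<in>{1..Suc n}. x i)})
     has_integral measure (clocks {1..Suc n}) {x \<in> space (clocks {1..Suc n}). (\<Sum>i\<in>{1..Suc n}. x i) \<le> t} / l (Suc n)) {0..t}"
proof -
  let ?l = "l (Suc n)" and ?M = "clocks {1..Suc n}" and ?M' = "clocks {1..n}"
  let ?J = "\<lambda>x::nat\<Rightarrow>real. \<Sum>i\<in>{1..n}. x i"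
  let ?A = "\<lambda>s. {x \<in> space ?M. ?J x \<le> s \<and> s < (\<Sum>i\<in>{1..Suc n}. x i)}"
  let ?B = "{x \<in> space ?M. (\<Sum>i\<in>{1..Suc n}. x i) \<le> t}"
  let ?k = "\<lambda>s x. indicator {0..t} s * ((if ?J x \<le> s then 1 else 0) * exp (- (s - ?J x) * ?l))"
  let ?g = "\<lambda>x. (if ?J x \<le> t then 1 else 0) * (1 - exp (- (t - ?J x) * ?l))"
  interpret full: prob_space ?M by (rule prob_space_clocks)
  interpret short: prob_space ?M' by (rule prob_space_clocks)
  have l: "0 < ?l" by (rule l_pos)
  have cong: "?J (x(Suc n := v)) = ?J x" for x v by (intro sum.cong) auto
  have sumS: "(\<Sum>i\<in>{1..Suc n}. (x(Suc n := v)) i) = ?J x + v" for x v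
    using cong[of x v] by simp
  have mem: "x(Suc n := v) \<in> space ?M" if "x \<in> space ?M'" for x v
    using that by (auto simp: space_PiM PiE_iff extensional_def)
  have [measurable]: "?J \<in> borel_measurable ?M'" by measurable
  have mB: "?B \<in> sets ?M" by measurable
  have mA: "?A s \<in> sets ?M" for s by measurable
  have B: "emeasure ?M ?B = (\<integral>\<^sup>+x. ennreal (?g x) \<partial>?M')"
    unfolding emeasure_clocks_Suc[OF mB]
  proof (rule nn_integral_cong)
    fix x assume x: "x \<in> space ?M'"
    have "{v. x(Suc n := v) \<in> ?B} = {v. v \<le> t - ?J x}"
      using mem[OF x] by (auto simp only: sumS mem_Collect_eq)
    then show "emeasure (exponential_law ?l) {v. x(Suc n := v) \<in> ?B} = ennreal (?g x)"
      using l exponential_law_le[OF l, of "t - ?J x"] exponential_law_neg[OF l, of "t - ?J x"]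
      by (cases "?J x \<le> t") (auto simp: indicator_def)
  qed
  have A: "emeasure ?M (?A s) = (\<integral>\<^sup>+x. ennreal ((if ?J x \<le> s then 1 else 0) * exp (- (s - ?J x) * ?l)) \<partial>?M')" for s
    unfolding emeasure_clocks_Suc[OF mA]
  proof (rule nn_integral_cong)
    fix x assume x: "x \<in> space ?M'"
    have "{v. x(Suc n := v) \<in> ?A s} = (if ?J x \<le> s then {v. s - ?J x < v} else {})"
      using mem[OF x] by (auto simp only: sumS cong mem_Collect_eq split: if_splits)
    then show "emeasure (exponential_law ?l) {v. x(Suc n := v) \<in> ?A s} = ennreal ((if ?J x \<le> s then 1 else 0) * exp (- (s - ?J x) * ?l))"
      using l exponential_law_gt[OF l, of "s - ?J x"]
      by (cases "?J x \<le> s") (auto simp: indicator_def)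
  qed
  define g where "g s = indicator {0..t} s * measure ?M (?A s)" for s
  have [measurable]: "(\<lambda>s. measure ?M (?A s)) \<in> borel_measurable borel"
  proof -
    have "(\<lambda>s. emeasure ?M (?A s)) \<in> borel_measurable borel" unfolding A
      by (rule short.borel_measurable_nn_integral) measurable
    then show ?thesis unfolding measure_def by measurable
  qed
  then have g_meas: "g \<in> borel_measurable borel" unfolding g_def by (intro borel_measurable_times) auto
  have inner: "(\<integral>\<^sup>+s. ennreal (indicator {0..t} s * ((if j \<le> s then 1 else 0) * exp (- (s - j) * ?l))) \<partial>lborel)
      = ennreal ((if j \<le> t then 1 else 0) * (1 - exp (- (t - j) * ?l)) / ?l)" if j: "0 \<le> j" for j
  proof (cases "j \<le> t")
    case True
    have "(\<integral>\<^sup>+s. ennreal (indicator {0..t} s * ((if j \<le> s then 1 else 0) * exp (- (s - j) * ?l))) \<partial>lborel)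
        = (\<integral>\<^sup>+s. ennreal (exp (- (s - j) * ?l)) * indicator {j..t} s \<partial>lborel)"
      using j by (intro nn_integral_cong) (auto simp: indicator_def)
    also have "\<dots> = ennreal (- exp (- (t - j) * ?l) / ?l - - exp (- (j - j) * ?l) / ?l)"
      using True l by (intro nn_integral_FTC_Icc) (auto intro!: derivative_eq_intros simp: divide_simps)
    finally show ?thesis using True by (simp add: diff_divide_distrib)
  next
    case False
    then have "(\<lambda>s. ennreal (indicator {0..t} s * ((if j \<le> s then 1 else 0) * exp (- (s - j) * ?l)))) = (\<lambda>s. 0)"
      by (auto simp: indicator_def)
    then show ?thesis using False by simp
  qed
  have "(\<integral>\<^sup>+s. ennreal (g s) \<partial>lborel)
      = (\<integral>\<^sup>+s. \<integral>\<^sup>+x. ennreal (?k s x) \<partial>?M' \<partial>lborel)"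
  proof (rule nn_integral_cong)
    fix s :: real
    have "ennreal (g s) = ennreal (indicator {0..t} s) * emeasure ?M (?A s)"
      unfolding g_def full.emeasure_eq_measure by (rule ennreal_mult') simp
    also have "\<dots> = (\<integral>\<^sup>+x. ennreal (indicator {0..t} s) * ennreal ((if ?J x \<le> s then 1 else 0) * exp (- (s - ?J x) * ?l)) \<partial>?M')"
      unfolding A by (rule nn_integral_cmult[symmetric]) measurable
    finally show "ennreal (g s) = (\<integral>\<^sup>+x. ennreal (?k s x) \<partial>?M')"
      by (simp add: ennreal_mult')
  qed
  also have "\<dots> = (\<integral>\<^sup>+x. \<integral>\<^sup>+s. ennreal (?k s x) \<partial>lborel \<partial>?M')"
  proof -
    interpret pair_sigma_finite ?M' lborel by unfold_locales
    show ?thesis by (rule Fubini') measurable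
  qed
  also have "\<dots> = (\<integral>\<^sup>+x. ennreal (1 / ?l) * ennreal (?g x) \<partial>?M')"
  proof (rule nn_integral_cong_AE)
    show "AE x in ?M'. (\<integral>\<^sup>+s. ennreal (?k s x) \<partial>lborel)
        = ennreal (1 / ?l) * ennreal (?g x)"
      using sum_clocks_nonneg
    proof eventually_elim
      case (elim x)
      show ?case unfolding inner[OF elim] using l by (simp flip: ennreal_mult')
    qed
  qed
  also have "\<dots> = ennreal (1 / ?l) * emeasure ?M ?B"
    unfolding B by (rule nn_integral_cmult) measurable
  also have "\<dots> = ennreal (measure ?M ?B / ?l)"
    unfolding full.emeasure_eq_measure using l by (simp flip: ennreal_mult')
  finally have "(g has_integral measure ?M ?B / ?l) UNIV"
    using l by (intro nn_integral_has_integral[OF g_meas]) (auto simp: g_def)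
  moreover have "g = (\<lambda>s. if s \<in> {0..t} then measure ?M (?A s) else 0)"
    by (auto simp: g_def)
  ultimately show ?thesis using has_integral_restrict_UNIV[of "{0..t}" "\<lambda>s. measure ?M (?A s)"] by simp
qed

end

section \<open>The walk killed outside a box\<close>

lemma emeasure_exponential_law:
  "0 < l \<Longrightarrow> emeasure (exponential_law l) A = ennreal (measure (exponential_law l) A)"
  using prob_space_exponential_law[of l]
  by (simp add: finite_measure.emeasure_eq_measure prob_space.finite_measure)

text \<open>Conductances are indexed here by the left endpoint of the edge, the form in which
  \<open>gen\<close> is written.\<close>

locale conductance_walk = variable_speed_walk P k 0 S \<tau>
  for P :: "'s measure" and k S \<tau> +
  fixes c :: "int \<Rightarrow> real"
  assumes edge_pos: "\<And>x. 0 < c x" and k_right: "\<And>x. k x (x + 1) = c x" and k_left: "\<And>x. k x (x - 1) = c (x - 1)"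
begin

declare S_measurable [measurable] \<tau>_measurable [measurable]

abbreviation J :: "nat \<Rightarrow> 's \<Rightarrow> real" where "J \<equiv> jump_time \<tau>"

definition rate :: "int \<Rightarrow> real" where "rate x = c (x - 1) + c x"

lemma rate_pos: "0 < rate x"
  unfolding rate_def by (intro add_pos_pos edge_pos)

lemma total_conductance_eq: "total_conductance k x = rate x"
  using k_right[of "x - 1"] k_right[of x] by (simp add: total_conductance_def rate_def)

lemma measurable_J [measurable]: "J n \<in> borel_measurable P"
  unfolding jump_time_def[abs_def] by measurable

section \<open>Joint law of the trajectory and the holding times\<close>

definition path_event :: "nat \<Rightarrow> (nat \<Rightarrow> int) \<Rightarrow> 's set" where
  "path_event n h = {y \<in> space P. \<forall>i\<le>n. S i y = h i}"

lemma path_event_sets [measurable]: "path_event n h \<in> events"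
  unfolding path_event_def by measurable

lemma subalgebra_chain: "subalgebra P (chain_sigma_algebra P S)"
  unfolding subalgebra_def chain_sigma_algebra_def
proof
  show "sets (vimage_algebra (space P) (\<lambda>y n. S n y) (\<Pi>\<^sub>M n\<in>UNIV. count_space UNIV)) \<subseteq> events"
    by (rule sets_image_in_sets) (auto intro!: measurable_PiM_single')
qed simp

lemma path_event_chain: "path_event n h \<in> sets (chain_sigma_algebra P S)"
proof -
  have "{f \<in> space (\<Pi>\<^sub>M n\<in>(UNIV::nat set). count_space (UNIV::int set)). \<forall>i\<le>n. f i = h i}
      \<in> sets (\<Pi>\<^sub>M n\<in>UNIV. count_space UNIV)" by measurable
  from in_vimage_algebra[OF this, of "\<lambda>y n. S n y" "space P"]
  have "(\<lambda>y n. S n y) -` {f \<in> space (\<Pi>\<^sub>M n\<in>(UNIV::nat set). count_space (UNIV::int set)). \<forall>i\<le>n. f i = h i} \<inter> space P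
      \<in> sets (chain_sigma_algebra P S)" unfolding chain_sigma_algebra_def .
  moreover have "path_event n h
      = (\<lambda>y n. S n y) -` {f \<in> space (\<Pi>\<^sub>M n\<in>(UNIV::nat set). count_space (UNIV::int set)). \<forall>i\<le>n. f i = h i} \<inter> space P"
    by (auto simp: path_event_def space_PiM)
  ultimately show ?thesis by simp
qed

lemma holding_times_on:
  assumes E: "E \<in> sets (chain_sigma_algebra P S)" and B: "\<And>i. i \<in> {1..n} \<Longrightarrow> B i \<in> sets borel"
  shows "prob {y \<in> E. \<forall>i\<in>{1..n}. \<tau> i y \<in> B i}
    = (\<integral>y\<in>E. (\<Prod>i\<in>{1..n}. measure (exponential_law (rate (S (i - 1) y))) (B i)) \<partial>P)"
proof -
  let ?q = "\<lambda>y. \<Prod>i\<in>{1..n}. measure (exponential_law (rate (S (i - 1) y))) (B i)"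
  interpret sub: finite_measure_subalgebra P "chain_sigma_algebra P S"
    by unfold_locales (rule subalgebra_chain)
  have EP: "E \<in> events" using E subalgebra_chain by (auto simp: subalgebra_def)
  let ?A = "{z \<in> space P. \<forall>i\<in>{1..n}. \<tau> i z \<in> B i}"
  have A: "?A \<in> events"
  proof (rule sets.sets_Collect_finite_All)
    fix i assume "i \<in> {1..n}"
    then show "{z \<in> space P. \<tau> i z \<in> B i} \<in> events"
      using measurable_sets[OF \<tau>_measurable B, of i] by (simp add: vimage_def Int_def conj_commute)
  qed simp
  have "prob {y \<in> E. \<forall>i\<in>{1..n}. \<tau> i y \<in> B i} = prob (?A \<inter> E)"
    using EP sets.sets_into_space by (intro arg_cong[where f=prob]) blast
  also have "\<dots> = (\<integral>y\<in>E. indicator ?A y \<partial>P)"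
    using A EP by (simp add: set_lebesgue_integral_def flip: indicator_inter_arith) (simp add: Int_commute)
  also have "\<dots> = (\<integral>y\<in>E. real_cond_exp P (chain_sigma_algebra P S) (indicator ?A) y \<partial>P)"
    by (intro sub.real_cond_exp_intA[OF _ E] integrable_real_indicator[OF A]) (simp add: emeasure_eq_measure)
  also have "\<dots> = (\<integral>y\<in>E. ?q y \<partial>P)"
  proof -
    have m: "(\<lambda>y. measure (exponential_law (rate (S j y))) D) \<in> borel_measurable P" for j D
      by (rule measurable_compose[OF S_measurable]) simp
    show ?thesis
      unfolding set_lebesgue_integral_def
    proof (rule integral_cong_AE)
      show "(\<lambda>y. indicat_real E y *\<^sub>R real_cond_exp P (chain_sigma_algebra P S) (indicator ?A) y) \<in> borel_measurable P"
        using EP by simp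
      show "(\<lambda>y. indicat_real E y *\<^sub>R ?q y) \<in> borel_measurable P"
        using EP m by (intro borel_measurable_scaleR borel_measurable_indicator borel_measurable_prod)
      show "AE y in P. indicat_real E y *\<^sub>R real_cond_exp P (chain_sigma_algebra P S) (indicator ?A) y
          = indicat_real E y *\<^sub>R ?q y"
      proof -
        have "AE y in P. real_cond_exp P (chain_sigma_algebra P S) (indicator ?A) y
            = (\<Prod>i\<in>{1..n}. measure (exponential_law (total_conductance k (S (i - 1) y))) (B i))"
          by (rule holding_times[OF B])
        then show ?thesis by eventually_elim (simp add: total_conductance_eq)
      qed
    qed
  qed
  finally show ?thesis .
qed

lemma holding_times_pos: "AE y in P. \<forall>i\<ge>1. 0 < \<tau> i y"
proof -
  have "AE y in P. \<forall>i\<in>{1..n}. \<tau> i y \<in> {0<..}" for n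
  proof (rule AE_prob_1[of "{y \<in> space P. \<forall>i\<in>{1..n}. \<tau> i y \<in> {0<..}}", THEN AE_mp])
    have sp: "space P \<in> sets (chain_sigma_algebra P S)"
      using subalgebra_chain by (metis sets.top subalgebra_def)
    have "prob {y \<in> space P. \<forall>i\<in>{1..n}. \<tau> i y \<in> {0<..}}
      = (\<integral>y\<in>space P. (\<Prod>i\<in>{1..n}. measure (exponential_law (rate (S (i - 1) y))) {0<..}) \<partial>P)"
      by (rule holding_times_on[OF sp]) simp
    also have "\<dots> = 1" by (simp add: exponential_law_pos rate_pos set_lebesgue_integral_def prob_space)
    finally show "prob {y \<in> space P. \<forall>i\<in>{1..n}. \<tau> i y \<in> {0<..}} = 1" .
  qed auto
  then have "AE y in P. \<forall>n. \<forall>i\<in>{1..n}. \<tau> i y \<in> {0<..}" by (simp add: AE_all_countable)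
  then show ?thesis by eventually_elim (metis atLeastAtMost_iff greaterThan_iff order_refl)
qed

lemma J_increasing: "AE y in P. \<forall>n. J n y < J (Suc n) y"
  using holding_times_pos by eventually_elim (simp add: jump_time_def)

abbreviation path_clocks :: "(nat \<Rightarrow> int) \<Rightarrow> nat set \<Rightarrow> (nat \<Rightarrow> real) measure" where
  "path_clocks h \<equiv> exponential_clocks.clocks (\<lambda>i. rate (h (i - 1)))"

text \<open>Given a cylinder of the trajectory the holding times are independent exponential clocks:
  a product law is determined by its values on rectangles, where \<open>holding_times_on\<close>
  gives them. Clock i has the rate of position i - 1, so fixing positions 0 to n determines n + 1
  clocks.\<close>

lemma path_law:
  assumes m: "m \<le> Suc n" and R: "R \<in> sets (path_clocks h {1..m})"
  shows "prob {y \<in> path_event n h. (\<lambda>i\<in>{1..m}. \<tau> i y) \<in> R}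
    = prob (path_event n h) * measure (path_clocks h {1..m}) R"
proof -
  interpret cl: exponential_clocks "\<lambda>i. rate (h (i - 1))" by unfold_locales (rule rate_pos)
  let ?E = "path_event n h" and ?M = "cl.clocks {1..m}"
  let ?f = "\<lambda>y. \<lambda>i\<in>{1..m}. \<tau> i y"
  have f [measurable]: "?f \<in> measurable P ?M"
    by (rule measurable_restrict) simp
  have sub: "{y \<in> ?E. ?f y \<in> R} = ?E \<inter> (?f -` R \<inter> space P)" by (auto simp: path_event_def)
  show ?thesis
  proof (cases "prob ?E = 0")
    case True
    have "prob {y \<in> ?E. ?f y \<in> R} \<le> prob ?E" by (rule finite_measure_mono) auto
    with True show ?thesis by (simp add: measure_le_0_iff)
  next
    case False
    define Q where "Q = uniform_measure P ?E"
    have Qs [simp, measurable_cong]: "sets Q = sets P" "space Q = space P" by (auto simp: Q_def)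
    have Qe: "emeasure Q A = ennreal (prob (?E \<inter> A) / prob ?E)" if "A \<in> events" for A
      using that False by (simp add: Q_def emeasure_eq_measure divide_ennreal zero_less_measure_iff)
    have "distr Q ?M ?f = ?M"
    proof (rule cl.PiM_eqI)
      fix A assume A: "\<And>i. i \<in> {1..m} \<Longrightarrow> A i \<in> sets (exponential_law (rate (h (i - 1))))"
      let ?q = "\<Prod>i\<in>{1..m}. measure (exponential_law (rate (h (i - 1)))) (A i)"
      have PA: "Pi\<^sub>E {1..m} A \<in> sets ?M" using A by (intro sets_PiM_I_finite) auto
      have pre: "?E \<inter> (?f -` Pi\<^sub>E {1..m} A \<inter> space P) = {y \<in> ?E. \<forall>i\<in>{1..m}. \<tau> i y \<in> A i}"
        by (auto simp: path_event_def Pi_iff)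
      have "prob {y \<in> ?E. \<forall>i\<in>{1..m}. \<tau> i y \<in> A i}
          = (\<integral>y\<in>?E. (\<Prod>i\<in>{1..m}. measure (exponential_law (rate (S (i - 1) y))) (A i)) \<partial>P)"
        using A by (intro holding_times_on path_event_chain) auto
      also have "\<dots> = (\<integral>y\<in>?E. ?q \<partial>P)"
      proof (rule set_lebesgue_integral_cong)
        show "\<forall>y. y \<in> ?E \<longrightarrow> (\<Prod>i\<in>{1..m}. measure (exponential_law (rate (S (i - 1) y))) (A i))
            = ?q"
          using m by (auto simp: path_event_def intro!: prod.cong)
      qed simp
      also have "\<dots> = prob ?E * ?q"
        by (simp add: set_lebesgue_integral_def)
      finally have eq: "prob {y \<in> ?E. \<forall>i\<in>{1..m}. \<tau> i y \<in> A i} = \<dots>" .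
      have "emeasure (distr Q ?M ?f) (Pi\<^sub>E {1..m} A) = emeasure Q (?f -` Pi\<^sub>E {1..m} A \<inter> space P)"
        using PA by (subst emeasure_distr) auto
      also have "\<dots> = ennreal ?q"
        using False measurable_sets[OF f PA] by (subst Qe) (auto simp only: pre eq, simp)
      also have "\<dots> = (\<Prod>i\<in>{1..m}. emeasure (exponential_law (rate (h (i - 1)))) (A i))"
        by (simp add: prod_ennreal emeasure_exponential_law rate_pos)
      finally show "emeasure (distr Q ?M ?f) (Pi\<^sub>E {1..m} A) = \<dots>" .
    qed auto
    then have "emeasure ?M R = emeasure (distr Q ?M ?f) R" by simp
    also have "\<dots> = ennreal (prob {y \<in> ?E. ?f y \<in> R} / prob ?E)"
    proof -
      have "emeasure (distr Q ?M ?f) R = emeasure Q (?f -` R \<inter> space P)"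
        using R by (subst emeasure_distr) auto
      then show ?thesis unfolding sub Qe[OF measurable_sets[OF f R]] .
    qed
    finally have "measure ?M R = prob {y \<in> ?E. ?f y \<in> R} / prob ?E"
      by (simp add: measure_def)
    then show ?thesis by (simp only: times_divide_eq_right nonzero_mult_div_cancel_left[OF False])
  qed
qed

lemma path_step:
  "prob {y \<in> path_event n h. S (Suc n) y = h n + 1} = c (h n) / rate (h n) * prob (path_event n h)"
  "prob {y \<in> path_event n h. S (Suc n) y = h n - 1} = c (h n - 1) / rate (h n) * prob (path_event n h)"
proof -
  have eq: "{y \<in> path_event n h. S (Suc n) y = z} = {y \<in> space P. S (Suc n) y = z \<and> (\<forall>i\<le>n. S i y = h i)}" for z
    by (auto simp: path_event_def)
  \<comment> \<open>Transition probabilities are prescribed on cylinders of positive probability; on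
    null cylinders both sides vanish.\<close>
  have zero: "prob {y \<in> path_event n h. S (Suc n) y = z} = 0" if "prob (path_event n h) = 0" for z
  proof -
    have "prob {y \<in> path_event n h. S (Suc n) y = z} \<le> prob (path_event n h)"
      by (rule finite_measure_mono) auto
    with that show ?thesis by (simp add: measure_le_0_iff)
  qed
  have cond: "prob {y \<in> path_event n h. S (Suc n) y = z} = p * prob (path_event n h)"
    if "prob (path_event n h) \<noteq> 0 \<Longrightarrow> cond_prob P (\<lambda>y. S (Suc n) y = z) (\<lambda>y. \<forall>i\<le>n. S i y = h i) = p" for z p
  proof (cases "prob (path_event n h) = 0")
    case True then show ?thesis using zero[of z] by simp
  next
    case False
    have "cond_prob P (\<lambda>y. S (Suc n) y = z) (\<lambda>y. \<forall>i\<le>n. S i y = h i)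
        = prob {y \<in> path_event n h. S (Suc n) y = z} / prob (path_event n h)"
      unfolding cond_prob_def eq by (simp add: path_event_def)
    then have "p = prob {y \<in> path_event n h. S (Suc n) y = z} / prob (path_event n h)"
      using that[OF False] by (rule trans[OF sym, rotated])
    then show ?thesis using False by simp
  qed
  show "prob {y \<in> path_event n h. S (Suc n) y = h n + 1} = c (h n) / rate (h n) * prob (path_event n h)"
    using S_step_right[of n h, unfolded k_right total_conductance_eq] by (intro cond) (simp add: path_event_def)
  show "prob {y \<in> path_event n h. S (Suc n) y = h n - 1} = c (h n - 1) / rate (h n) * prob (path_event n h)"
    using S_step_left[of n h, unfolded k_left total_conductance_eq] by (intro cond) (simp add: path_event_def)
qed

definition step_prob :: "int \<Rightarrow> int \<Rightarrow> real" where
  "step_prob w z = (if z = w + 1 then c w else if z = w - 1 then c z else 0) / rate w"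

lemma path_step_prob: "prob {y \<in> path_event n h. S (Suc n) y = z} = step_prob (h n) z * prob (path_event n h)"
proof -
  consider "z = h n + 1" | "z = h n - 1" | "z \<noteq> h n + 1" "z \<noteq> h n - 1" by blast
  then show ?thesis
  proof cases
    case 3
    let ?E = "path_event n h"
    let ?A = "\<lambda>z. {y \<in> ?E. S (Suc n) y = z}"
    have Am: "?A z \<in> events" for z by measurable
    \<comment> \<open>The two neighbours already exhaust the cylinder, so nothing is left for any
      other position.\<close>
    have "prob (?A (h n + 1) \<union> ?A (h n - 1)) = prob (?A (h n + 1)) + prob (?A (h n - 1))"
      by (rule finite_measure_Union) (use Am in auto)
    also have "\<dots> = prob ?E"
    proof -
      have "c (h n) / rate (h n) + c (h n - 1) / rate (h n) = 1"
        using rate_pos[of "h n"] by (simp add: rate_def add.commute flip: add_divide_distrib)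
      then show ?thesis unfolding path_step by (metis distrib_right mult_1)
    qed
    finally have "prob (?A (h n + 1) \<union> ?A (h n - 1)) + prob (?A z) = prob ?E + prob (?A z)" by simp
    moreover have "prob ((?A (h n + 1) \<union> ?A (h n - 1)) \<union> ?A z) = prob (?A (h n + 1) \<union> ?A (h n - 1)) + prob (?A z)"
      by (rule finite_measure_Union) (use Am 3 in auto)
    moreover have "prob ((?A (h n + 1) \<union> ?A (h n - 1)) \<union> ?A z) \<le> prob ?E"
      by (rule finite_measure_mono) auto
    ultimately have "prob (?A z) = 0" using measure_nonneg[of P "?A z"] by linarith
    with 3 show ?thesis by (simp add: step_prob_def)
  qed (auto simp: path_step step_prob_def)
qed

text \<open>Position n + 1 does not influence the first n + 1 clocks: \<open>path_law\<close>,
  applied to the cylinder with and without that position, uses the same clock law.\<close>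

lemma path_step_jump:
  "prob {y \<in> path_event n h. S (Suc n) y = z \<and> J (Suc n) y \<le> t}
    = step_prob (h n) z * prob {y \<in> path_event n h. J (Suc n) y \<le> t}"
proof -
  define h' where "h' = h(Suc n := z)"
  let ?cl = "\<lambda>h. path_clocks h {1..Suc n}"
  let ?R = "{x \<in> space (?cl h). (\<Sum>i\<in>{1..Suc n}. x i) \<le> t}"
  have R: "?R \<in> sets (?cl h)" by measurable
  have clocks_eq: "?cl h' = ?cl h" by (intro PiM_cong) (auto simp: h'_def)
  have in_space: "(\<lambda>i\<in>{1..Suc n}. \<tau> i y) \<in> space (?cl h)" for y by (simp add: space_PiM)
  have sum_eq: "(\<Sum>j\<in>{1..Suc n}. (\<lambda>i\<in>{1..Suc n}. \<tau> i y) j) = J (Suc n) y" for y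
    unfolding jump_time_def by (intro sum.cong) auto
  have memR: "(\<lambda>i\<in>{1..Suc n}. \<tau> i y) \<in> ?R \<longleftrightarrow> J (Suc n) y \<le> t" for y
    unfolding mem_Collect_eq sum_eq using in_space[of y] by blast
  have E': "path_event (Suc n) h' = {y \<in> path_event n h. S (Suc n) y = z}"
    by (auto simp: path_event_def h'_def le_Suc_eq)
  have 1: "prob {y \<in> path_event (Suc n) h'. (\<lambda>i\<in>{1..Suc n}. \<tau> i y) \<in> ?R} = prob (path_event (Suc n) h') * measure (?cl h) ?R"
    using path_law[of "Suc n" "Suc n" ?R h', unfolded clocks_eq, OF _ R] by (simp only: le_SucI order_refl)
  have 2: "prob {y \<in> path_event n h. (\<lambda>i\<in>{1..Suc n}. \<tau> i y) \<in> ?R} = prob (path_event n h) * measure (?cl h) ?R"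
    by (rule path_law[OF order_refl R])
  have 3: "{y \<in> path_event n h. S (Suc n) y = z \<and> J (Suc n) y \<le> t}
      = {y \<in> {y \<in> path_event n h. S (Suc n) y = z}. J (Suc n) y \<le> t}" by blast
  show ?thesis
    using 1 2 unfolding memR E' path_step_prob 3 by (simp only: mult.assoc)
qed

lemma path_jump_integral:
  assumes t: "0 \<le> t"
  shows "((\<lambda>s. prob {y \<in> path_event n h. J n y \<le> s \<and> s < J (Suc n) y})
    has_integral prob {y \<in> path_event n h. J (Suc n) y \<le> t} / rate (h n)) {0..t}"
proof -
  interpret cl: exponential_clocks "\<lambda>i. rate (h (i - 1))" by unfold_locales (rule rate_pos)
  let ?M = "cl.clocks {1..Suc n}"
  let ?R = "{x \<in> space ?M. (\<Sum>i\<in>{1..Suc n}. x i) \<le> t}"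
  let ?A = "\<lambda>s. {x \<in> space ?M. (\<Sum>i\<in>{1..n}. x i) \<le> s \<and> s < (\<Sum>i\<in>{1..Suc n}. x i)}"
  have R: "?R \<in> sets ?M" by measurable
  have A: "?A s \<in> sets ?M" for s by measurable
  have in_space: "(\<lambda>i\<in>{1..Suc n}. \<tau> i y) \<in> space ?M" for y by (simp add: space_PiM)
  have sum_eq: "(\<Sum>j\<in>{1..Suc n}. (\<lambda>i\<in>{1..Suc n}. \<tau> i y) j) = J (Suc n) y"
    "(\<Sum>j\<in>{1..n}. (\<lambda>i\<in>{1..Suc n}. \<tau> i y) j) = J n y" for y
    unfolding jump_time_def by (intro sum.cong; simp)+
  have memR: "(\<lambda>i\<in>{1..Suc n}. \<tau> i y) \<in> ?R \<longleftrightarrow> J (Suc n) y \<le> t" for y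
    unfolding mem_Collect_eq sum_eq using in_space[of y] by blast
  have memA: "(\<lambda>i\<in>{1..Suc n}. \<tau> i y) \<in> ?A s \<longleftrightarrow> J n y \<le> s \<and> s < J (Suc n) y" for y s
    unfolding mem_Collect_eq sum_eq using in_space[of y] by blast
  have 1: "prob {y \<in> path_event n h. J (Suc n) y \<le> t} = prob (path_event n h) * measure ?M ?R"
    using path_law[OF order_refl R] unfolding memR .
  have 2: "prob {y \<in> path_event n h. J n y \<le> s \<and> s < J (Suc n) y} = prob (path_event n h) * measure ?M (?A s)" for s
    using path_law[OF order_refl A] unfolding memA .
  have H: "((\<lambda>s. prob (path_event n h) * measure ?M (?A s)) has_integral
      prob (path_event n h) * (measure ?M ?R / rate (h (Suc n - 1)))) {0..t}"
    by (rule has_integral_mult_right) (rule cl.clocks_jump_integral[OF t])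
  have "prob (path_event n h) * (measure ?M ?R / rate (h (Suc n - 1)))
      = prob {y \<in> path_event n h. J (Suc n) y \<le> t} / rate (h n)"
    unfolding 1 diff_Suc_1 by (rule times_divide_eq_right)
  moreover have "((\<lambda>s. prob {y \<in> path_event n h. J n y \<le> s \<and> s < J (Suc n) y}) has_integral
      prob (path_event n h) * (measure ?M ?R / rate (h (Suc n - 1)))) {0..t}"
    by (rule has_integral_eq[OF _ H]) (rule 2[symmetric])
  ultimately show ?thesis by (rule subst)
qed


section \<open>Forward equation of the killed walk\<close>

abbreviation box :: "nat \<Rightarrow> int set" where "box N \<equiv> {- int N..int N}"

definition box_path :: "nat \<Rightarrow> nat \<Rightarrow> int \<Rightarrow> 's \<Rightarrow> bool" where
  "box_path N n z y \<longleftrightarrow> (\<forall>i\<le>n. S i y \<in> box N) \<and> S n y = z"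

lemma box_path_pred [measurable]: "Measurable.pred P (box_path N n z)"
proof -
  have "{y \<in> space P. box_path N n z y}
      = (\<Inter>i\<in>{..n}. S i -` box N \<inter> space P) \<inter> (S n -` {z} \<inter> space P)"
    by (auto simp: box_path_def)
  also have "\<dots> \<in> events"
    by (intro sets.Int sets.finite_INT measurable_sets[OF S_measurable]) auto
  finally show ?thesis by (simp add: pred_def)
qed

text \<open>The number n of jumps is kept in \<open>occupied\<close>, \<open>arrived\<close> and
  \<open>departed\<close>, because the time integral is computed for fixed n; summing over n yields
  \<open>killed\<close>.\<close>

definition occupied :: "nat \<Rightarrow> nat \<Rightarrow> real \<Rightarrow> int \<Rightarrow> real" where
  "occupied N n t z = prob {y \<in> space P. box_path N n z y \<and> J n y \<le> t \<and> t < J (Suc n) y}"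

definition arrived :: "nat \<Rightarrow> nat \<Rightarrow> real \<Rightarrow> int \<Rightarrow> real" where
  "arrived N n t z = prob {y \<in> space P. box_path N n z y \<and> J n y \<le> t}"

definition departed :: "nat \<Rightarrow> nat \<Rightarrow> real \<Rightarrow> int \<Rightarrow> real" where
  "departed N n t z = prob {y \<in> space P. box_path N n z y \<and> J (Suc n) y \<le> t}"

definition killed :: "nat \<Rightarrow> real \<Rightarrow> int \<Rightarrow> real" where
  "killed N t z = prob {y \<in> space P. \<exists>n. box_path N n z y \<and> J n y \<le> t \<and> t < J (Suc n) y}"

text \<open>Extensional functions, so that distinct paths differ at some time up to n and have
  disjoint cylinders. Finiteness turns events on box paths into finite sums.\<close>

definition box_paths :: "nat \<Rightarrow> nat \<Rightarrow> int \<Rightarrow> (nat \<Rightarrow> int) set" where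
  "box_paths N n z = {h \<in> {..n} \<rightarrow>\<^sub>E box N. h n = z}"

lemma finite_box_paths: "finite (box_paths N n z)"
  unfolding box_paths_def by (rule finite_subset[OF _ finite_PiE[of "{..n}" "\<lambda>_. box N"]]) auto

lemma prob_box_path:
  assumes [measurable]: "Measurable.pred P X"
  shows "prob {y \<in> space P. box_path N n z y \<and> X y} = (\<Sum>h\<in>box_paths N n z. prob {y \<in> path_event n h. X y})"
proof -
  have "{y \<in> space P. box_path N n z y \<and> X y} = (\<Union>h\<in>box_paths N n z. {y \<in> path_event n h. X y})"
  proof (intro equalityI subsetI)
    fix y assume y: "y \<in> {y \<in> space P. box_path N n z y \<and> X y}"
    then have "restrict (\<lambda>i. S i y) {..n} \<in> box_paths N n z"
      by (auto simp: box_paths_def box_path_def)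
    moreover have "y \<in> {y \<in> path_event n (restrict (\<lambda>i. S i y) {..n}). X y}"
      using y by (auto simp: path_event_def)
    ultimately show "y \<in> (\<Union>h\<in>box_paths N n z. {y \<in> path_event n h. X y})" by blast
  next
    fix y assume "y \<in> (\<Union>h\<in>box_paths N n z. {y \<in> path_event n h. X y})"
    then obtain h where "h \<in> box_paths N n z" "y \<in> path_event n h" "X y" by blast
    then show "y \<in> {y \<in> space P. box_path N n z y \<and> X y}"
      by (auto simp: box_paths_def box_path_def path_event_def PiE_iff)
  qed
  moreover have "prob (\<Union>h\<in>box_paths N n z. {y \<in> path_event n h. X y})
      = (\<Sum>h\<in>box_paths N n z. prob {y \<in> path_event n h. X y})"
  proof (rule finite_measure_finite_Union[OF finite_box_paths])
    show "disjoint_family_on (\<lambda>h. {y \<in> path_event n h. X y}) (box_paths N n z)"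
      unfolding disjoint_family_on_def
    proof (intro ballI impI)
      fix h g assume hg: "h \<in> box_paths N n z" "g \<in> box_paths N n z" "h \<noteq> g"
      then obtain i where "i \<le> n" "h i \<noteq> g i"
        using PiE_ext[of h "{..n}" "\<lambda>_. box N" g]
        by (auto simp: box_paths_def)
      then show "{y \<in> path_event n h. X y} \<inter> {y \<in> path_event n g. X y} = {}"
        by (auto simp: path_event_def)
    qed
    have "{y \<in> path_event n h. X y} \<in> events" for h
    proof -
      have "{y \<in> path_event n h. X y} = path_event n h \<inter> {y \<in> space P. X y}"
        by (auto simp: path_event_def)
      then show ?thesis by simp
    qed
    then show "(\<lambda>h. {y \<in> path_event n h. X y}) ` box_paths N n z \<subseteq> events" by blast
  qed
  ultimately show ?thesis by simp
qed

lemma occupied_has_integral: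
  assumes "0 \<le> t"
  shows "((\<lambda>s. occupied N n s z) has_integral departed N n t z / rate z) {0..t}"
proof -
  have "((\<lambda>s. \<Sum>h\<in>box_paths N n z. prob {y \<in> path_event n h. J n y \<le> s \<and> s < J (Suc n) y})
     has_integral (\<Sum>h\<in>box_paths N n z. prob {y \<in> path_event n h. J (Suc n) y \<le> t} / rate (h n))) {0..t}"
    by (intro has_integral_sum finite_box_paths path_jump_integral assms)
  moreover have "(\<Sum>h\<in>box_paths N n z. prob {y \<in> path_event n h. J (Suc n) y \<le> t} / rate (h n))
     = (\<Sum>h\<in>box_paths N n z. prob {y \<in> path_event n h. J (Suc n) y \<le> t}) / rate z"
    unfolding sum_divide_distrib by (intro sum.cong) (auto simp: box_paths_def)
  ultimately show ?thesis unfolding occupied_def departed_def by (simp add: prob_box_path)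
qed

lemma arrived_Suc:
  assumes z: "z \<in> box N"
  shows "arrived N (Suc n) t z = (\<Sum>w\<in>box N. step_prob w z * departed N n t w)"
proof -
  let ?A = "\<lambda>w. {y \<in> space P. box_path N n w y \<and> (S (Suc n) y = z \<and> J (Suc n) y \<le> t)}"
  have "{y \<in> space P. box_path N (Suc n) z y \<and> J (Suc n) y \<le> t} = (\<Union>w\<in>box N. ?A w)"
    using z by (auto simp: box_path_def le_Suc_eq)
  then have "arrived N (Suc n) t z = prob (\<Union>w\<in>box N. ?A w)"
    by (simp add: arrived_def)
  also have "\<dots> = (\<Sum>w\<in>box N. prob (?A w))"
    by (rule finite_measure_finite_Union) (auto simp: disjoint_family_on_def box_path_def)
  also have "\<dots> = (\<Sum>w\<in>box N. step_prob w z * departed N n t w)"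
  proof (rule sum.cong[OF refl])
    fix w
    have "prob (?A w) = (\<Sum>h\<in>box_paths N n w. prob {y \<in> path_event n h. S (Suc n) y = z \<and> J (Suc n) y \<le> t})"
      by (rule prob_box_path) measurable
    also have "\<dots> = (\<Sum>h\<in>box_paths N n w. step_prob w z * prob {y \<in> path_event n h. J (Suc n) y \<le> t})"
      by (intro sum.cong refl) (simp add: path_step_jump box_paths_def)
    also have "\<dots> = step_prob w z * departed N n t w"
      unfolding departed_def by (subst prob_box_path) (measurable, simp add: sum_distrib_left)
    finally show "prob (?A w) = step_prob w z * departed N n t w" .
  qed
  finally show ?thesis .
qed

lemma occupied_eq: "occupied N n t z = arrived N n t z - departed N n t z"
proof -
  let ?O = "{y \<in> space P. box_path N n z y \<and> J n y \<le> t \<and> t < J (Suc n) y}"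
  let ?D = "{y \<in> space P. box_path N n z y \<and> J (Suc n) y \<le> t}"
  have "prob {y \<in> space P. box_path N n z y \<and> J n y \<le> t} = prob (?O \<union> ?D)"
  proof (rule finite_measure_eq_AE)
    show "AE y in P. y \<in> {y \<in> space P. box_path N n z y \<and> J n y \<le> t} \<longleftrightarrow> y \<in> ?O \<union> ?D"
      using J_increasing
    proof eventually_elim
      case (elim y)
      from elim[rule_format, of n] show ?case by auto
    qed
  qed measurable
  also have "\<dots> = prob ?O + prob ?D" by (rule finite_measure_Union) auto
  finally show ?thesis by (simp add: occupied_def arrived_def departed_def)
qed

lemma arrived_0: "0 \<le> t \<Longrightarrow> arrived N 0 t z = (if z = 0 then 1 else 0)"
proof -
  assume t: "0 \<le> t"
  have "arrived N 0 t z = prob (if z = 0 then space P else {})"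
    unfolding arrived_def
  proof (rule finite_measure_eq_AE)
    show "AE y in P. y \<in> {y \<in> space P. box_path N 0 z y \<and> J 0 y \<le> t} \<longleftrightarrow> y \<in> (if z = 0 then space P else {})"
      using S_start by eventually_elim (use t in \<open>auto simp: box_path_def jump_time_def\<close>)
  qed auto
  then show ?thesis by (simp add: prob_space)
qed

lemma jump_interval_unique:
  assumes inc: "\<forall>n. J n y < J (Suc n) y" and "J n y \<le> t" "t < J (Suc n) y" "J m y \<le> t" "t < J (Suc m) y"
  shows "m = n"
proof -
  have mono: "J i y \<le> J j y" if "i \<le> j" for i j
    using lift_Suc_mono_le[of "\<lambda>n. J n y"] inc that less_imp_le by blast
  from mono[of "Suc n" m] mono[of "Suc m" n] assms show ?thesis by linarith
qed

lemma occupied_sums: "(\<lambda>n. occupied N n t z) sums killed N t z"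
  unfolding occupied_def killed_def
proof (rule prob_sums)
  show "AE y in P. (\<forall>n. box_path N n z y \<and> J n y \<le> t \<and> t < J (Suc n) y \<longrightarrow>
        (\<exists>n. box_path N n z y \<and> J n y \<le> t \<and> t < J (Suc n) y)) \<and>
      ((\<exists>n. box_path N n z y \<and> J n y \<le> t \<and> t < J (Suc n) y) \<longrightarrow>
        (\<exists>!n. box_path N n z y \<and> J n y \<le> t \<and> t < J (Suc n) y))"
    using J_increasing by eventually_elim (use jump_interval_unique in blast)
qed measurable

abbreviation killed_mass :: "nat \<Rightarrow> real \<Rightarrow> real" where
  "killed_mass N t \<equiv> (\<Sum>z\<in>box N. killed N t z)"

lemma killed_outside: "z \<notin> box N \<Longrightarrow> killed N t z = 0"
proof -
  assume "z \<notin> box N"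
  then have "{y \<in> space P. \<exists>n. box_path N n z y \<and> J n y \<le> t \<and> t < J (Suc n) y} = {}"
    by (auto simp: box_path_def)
  then show ?thesis unfolding killed_def by (simp only: measure_empty)
qed

text \<open>Sum over n of \<open>occupied_has_integral\<close>. Monotone convergence interchanges
  sum and integral, the partial sums being at most 1.\<close>

lemma killed_integral:
  assumes t: "0 \<le> t"
  shows "(\<lambda>s. killed N s z) integrable_on {0..t}"
    "(\<lambda>n. departed N n t z) sums (rate z * integral {0..t} (\<lambda>s. killed N s z))"
proof -
  define f where "f m s = (\<Sum>n<m. occupied N n s z)" for m s
  have f: "(f m has_integral (\<Sum>n<m. departed N n t z / rate z)) {0..t}" for m
    unfolding f_def[abs_def] by (intro has_integral_sum occupied_has_integral t) auto
  have occ: "0 \<le> occupied N n s z" for n s by (simp add: occupied_def)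
  have f_le: "f m s \<le> 1" for m s
  proof -
    have "f m s \<le> killed N s z" unfolding f_def
      using occupied_sums[of N s z] occ by (metis sums_iff sum_le_suminf finite_lessThan)
    also have "\<dots> \<le> 1" by (simp add: killed_def)
    finally show ?thesis .
  qed
  have f_nonneg: "0 \<le> f m s" for m s unfolding f_def by (intro sum_nonneg occ)
  have "(\<lambda>s. killed N s z) integrable_on {0..t} \<and>
    ((\<lambda>m. integral {0..t} (f m)) \<longlongrightarrow> integral {0..t} (\<lambda>s. killed N s z)) sequentially"
  proof (rule monotone_convergence_increasing)
    show "f m integrable_on {0..t}" for m using f by blast
    show "f m s \<le> f (Suc m) s" for m s using occ by (simp add: f_def)
    show "(\<lambda>m. f m s) \<longlonglongrightarrow> killed N s z" for s
      using occupied_sums[of N s z] by (simp add: sums_def f_def)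
    show "bounded (range (\<lambda>m. integral {0..t} (f m)))"
    proof (rule boundedI)
      fix x assume "x \<in> range (\<lambda>m. integral {0..t} (f m))"
      then obtain m where x: "x = integral {0..t} (f m)" by auto
      have int: "f m integrable_on {0..t}" using f by blast
      have "integral {0..t} (f m) \<le> integral {0..t} (\<lambda>_. 1)"
        by (intro integral_le int f_le) auto
      moreover have "0 \<le> integral {0..t} (f m)" by (intro integral_nonneg int f_nonneg)
      ultimately show "norm x \<le> t" using t x by simp
    qed
  qed
  then show "(\<lambda>s. killed N s z) integrable_on {0..t}" ..
  from \<open>_ \<and> _\<close> have "(\<lambda>m. \<Sum>n<m. departed N n t z / rate z) \<longlonglongrightarrow> integral {0..t} (\<lambda>s. killed N s z)"
    by (simp add: integral_unique[OF f])
  then have "(\<lambda>n. departed N n t z / rate z) sums integral {0..t} (\<lambda>s. killed N s z)"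
    by (simp add: sums_def)
  from sums_mult[OF this, of "rate z"]
  show "(\<lambda>n. departed N n t z) sums (rate z * integral {0..t} (\<lambda>s. killed N s z))"
    using rate_pos[of z] by simp
qed

abbreviation killed_inflow :: "nat \<Rightarrow> real \<Rightarrow> int \<Rightarrow> real" where
  "killed_inflow N t z \<equiv> \<Sum>w\<in>box N. step_prob w z * (rate w * integral {0..t} (\<lambda>s. killed N s w))"

text \<open>Sum over n of occupied = arrived - departed, where arrivals at step n + 1 come from
  departures at step n. The integrated form comes first, since regularity in t is not yet
  known.\<close>

lemma killed_forward_equation:
  assumes t: "0 \<le> t" and z: "z \<in> box N"
  shows "killed N t z = killed_inflow N t z
     + (if z = 0 then 1 else 0) - rate z * integral {0..t} (\<lambda>s. killed N s z)"
proof -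
  have "(\<lambda>n. arrived N (Suc n) t z) sums killed_inflow N t z"
    unfolding arrived_Suc[OF z] by (intro sums_sum sums_mult killed_integral t)
  from sums_Suc[OF this]
  have "(\<lambda>n. arrived N n t z) sums (killed_inflow N t z
     + (if z = 0 then 1 else 0))" by (simp add: arrived_0[OF t])
  from sums_diff[OF this killed_integral(2)[OF t, of N z]] show ?thesis
    using sums_unique2[OF occupied_sums[of N t z]] by (simp add: occupied_eq)
qed

text \<open>Bootstrap: on the right side of the forward equation, time occurs only as the upper
  limit of integrals.\<close>

lemma killed_continuous: "continuous_on {0..b} (\<lambda>t. killed N t z)"
proof (cases "z \<in> box N \<and> 0 \<le> b")
  case True
  then have z: "z \<in> box N" and b: "0 \<le> b" by auto
  have "continuous_on {0..b} (\<lambda>t. killed_inflow N t z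
     + (if z = 0 then 1 else 0) - rate z * integral {0..t} (\<lambda>s. killed N s z))"
    by (intro continuous_intros indefinite_integral_continuous_1 killed_integral b)
  then show ?thesis
    by (rule continuous_on_cong[THEN iffD1, OF refl, rotated]) (rule killed_forward_equation[OF _ z, symmetric], simp)
qed (auto simp: killed_outside)

text \<open>The rate cancels the normalisation of \<open>step_prob\<close> and leaves the
  conductance of the edge, equal in both directions. This is the source of the symmetry of the
  system.\<close>

lemma sum_step_prob:
  assumes z: "z \<in> box N" and v: "\<And>w. w \<notin> box N \<Longrightarrow> v w = 0"
  shows "(\<Sum>w\<in>box N. step_prob w z * (rate w * v w)) = c (z - 1) * v (z - 1) + c z * v (z + 1)"
proof -
  have "step_prob w z * (rate w * v w) = (if w = z - 1 then c (z - 1) * v (z - 1) else 0) + (if w = z + 1 then c z * v (z + 1) else 0)" for w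
    using rate_pos[of w] by (auto simp: step_prob_def)
  then have "(\<Sum>w\<in>box N. step_prob w z * (rate w * v w))
     = (\<Sum>w\<in>box N. (if w = z - 1 then c (z - 1) * v (z - 1) else 0)) + (\<Sum>w\<in>box N. (if w = z + 1 then c z * v (z + 1) else 0))"
    by (simp add: sum.distrib)
  also have "\<dots> = c (z - 1) * v (z - 1) + c z * v (z + 1)"
    using v[of "z - 1"] v[of "z + 1"] by (simp add: sum.delta)
  finally show ?thesis .
qed

text \<open>With continuity known, the integrated equation can be differentiated; the derivative
  within {0..t+1} is the one within the half-line, because only a neighbourhood of t
  matters.\<close>

lemma killed_deriv:
  assumes t: "0 \<le> t" and z: "z \<in> box N"
  shows "((\<lambda>t. killed N t z) has_real_derivative gen c (killed N t) z) (at t within {0..})"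
proof -
  have tb: "t \<in> {0..t+1}" using t by simp
  let ?I = "\<lambda>w t. integral {0..t} (\<lambda>s. killed N s w)"
  have I: "(?I w has_real_derivative killed N t w) (at t within {0..t+1})" for w
    by (rule integral_has_real_derivative[OF killed_continuous tb])
  have "((\<lambda>t. (\<Sum>w\<in>box N. step_prob w z * (rate w * ?I w t)) + (if z = 0 then 1 else 0) - rate z * ?I z t)
     has_real_derivative (\<Sum>w\<in>box N. step_prob w z * (rate w * killed N t w)) + 0 - rate z * killed N t z) (at t within {0..t+1})"
    by (intro DERIV_diff DERIV_add DERIV_sum DERIV_cmult I DERIV_const)
  moreover have "(\<Sum>w\<in>box N. step_prob w z * (rate w * killed N t w)) + 0 - rate z * killed N t z = gen c (killed N t) z"
    by (subst sum_step_prob[OF z killed_outside]) (auto simp: gen_def rate_def algebra_simps)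
  ultimately have "((\<lambda>t. killed N t z) has_real_derivative gen c (killed N t) z) (at t within {0..t+1})"
    by (simp only:) (erule has_field_derivative_transform_within[OF _ zero_less_one tb],
        rule killed_forward_equation[OF _ z, symmetric], simp)
  moreover have "at t within {0..t+1} = at t within {0..}"
    by (rule at_within_nhd[of t "{..<t+1}"]) auto
  ultimately show ?thesis by simp
qed

lemma killed_heat_flow_killed: "killed_heat_flow c N (killed N)"
proof
  show "killed N 0 x = (if x = 0 then 1 else 0)" for x
    by (cases "x \<in> box N") (auto simp: killed_forward_equation killed_outside)
  show "0 \<le> killed N t x" for t x by (simp add: killed_def)
qed (fact edge_pos killed_outside killed_deriv)+

section \<open>The law of the walk compared with the killed laws\<close>

abbreviation walk :: "real \<Rightarrow> 's \<Rightarrow> int" where "walk \<equiv> walk_position S \<tau>"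

lemma walk_position_measurable [measurable]: "walk t \<in> measurable P (count_space UNIV)"
  unfolding walk_position_def[abs_def]
  by (rule measurable_compose_countable[where f=S]) measurable

definition heat_kernel :: "real \<Rightarrow> int \<Rightarrow> real" where
  "heat_kernel t x = prob {y \<in> space P. walk t y = x}"

lemma killed_le_heat_kernel: "killed N t x \<le> heat_kernel t x"
  unfolding killed_def heat_kernel_def
proof (rule finite_measure_mono_AE)
  show "AE y in P. y \<in> {y \<in> space P. \<exists>n. box_path N n x y \<and> J n y \<le> t \<and> t < J (Suc n) y} \<longrightarrow>
      y \<in> {y \<in> space P. walk t y = x}"
    using J_increasing
  proof eventually_elim
    case (elim y)
    have "(LEAST n. J n y \<le> t \<and> t < J (Suc n) y) = n" if "J n y \<le> t" "t < J (Suc n) y" for n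
      using that jump_interval_unique[OF elim] by (intro Least_equality) auto
    then show ?case by (auto simp: walk_position_def box_path_def)
  qed
qed measurable

lemma heat_kernel_sum: "finite F \<Longrightarrow> (\<Sum>x\<in>F. heat_kernel t x) = prob {y \<in> space P. walk t y \<in> F}"
proof -
  assume F: "finite F"
  have "(\<Sum>x\<in>F. heat_kernel t x) = prob (\<Union>x\<in>F. {y \<in> space P. walk t y = x})"
    unfolding heat_kernel_def
    by (rule finite_measure_finite_Union[symmetric, OF F]) (auto simp: disjoint_family_on_def)
  also have "(\<Union>x\<in>F. {y \<in> space P. walk t y = x}) = {y \<in> space P. walk t y \<in> F}" by auto
  finally show ?thesis .
qed

text \<open>The heat kernel dominates the killed law at every point and has total mass at most 1, so
  its excess at a single point is at most the mass lost by killing. Explosion is thereby controlled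
  through the killed mass.\<close>

lemma heat_kernel_le_killed: "heat_kernel t x \<le> killed N t x + (1 - killed_mass N t)"
proof -
  let ?B = "box N"
  have "heat_kernel t x + (\<Sum>z\<in>?B - {x}. killed N t z) \<le> heat_kernel t x + (\<Sum>z\<in>?B - {x}. heat_kernel t z)"
    by (intro add_left_mono sum_mono killed_le_heat_kernel)
  also have "\<dots> = (\<Sum>z\<in>insert x (?B - {x}). heat_kernel t z)"
    by (rule sum.insert[symmetric]) auto
  also have "\<dots> \<le> 1" by (subst heat_kernel_sum) auto
  finally have "heat_kernel t x \<le> 1 - (\<Sum>z\<in>?B - {x}. killed N t z)" by simp
  also have "(\<Sum>z\<in>?B - {x}. killed N t z) = (\<Sum>z\<in>?B. killed N t z) - killed N t x"
    by (cases "x \<in> ?B") (auto simp: sum_diff1 killed_outside)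
  finally show ?thesis by simp
qed

section \<open>Heat kernel bounds\<close>


abbreviation resistance :: "int \<Rightarrow> real" where "resistance \<equiv> \<lambda>x. 1 / c x"
abbreviation potential :: "int \<Rightarrow> real" where "potential \<equiv> isum resistance"

lemma heat_kernel_nonneg: "0 \<le> heat_kernel t x"
  by (simp add: heat_kernel_def)

lemma heat_kernel_le_1: "heat_kernel t x \<le> 1"
  by (simp add: heat_kernel_def)

lemma killed_mass_le_1: "killed_mass N t \<le> 1"
proof -
  have "killed_mass N t \<le> (\<Sum>z\<in>box N. heat_kernel t z)"
    by (intro sum_mono killed_le_heat_kernel)
  also have "\<dots> \<le> 1" by (subst heat_kernel_sum) auto
  finally show ?thesis .
qed

text \<open>On each side the exit has probability at most t / m, by \<open>exit_le\<close> with j =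
  1.\<close>

lemma killed_mass_ge:
  assumes t: "0 \<le> t" and "0 < m" and m: "m \<le> heat_poly resistance 2 (int N + 1)" "m \<le> heat_poly resistance 2 (- int N - 1)"
  shows "1 - 2 * t / m \<le> killed_mass N t"
proof -
  interpret flow: killed_heat_flow c N "killed N" by (rule killed_heat_flow_killed)
  have "m * flow.exit_right t \<le> heat_poly resistance 2 (int N + 1) * flow.exit_right t"
    using m flow.exit_nonneg[OF t] by (intro mult_right_mono) auto
  also have "\<dots> \<le> t" using flow.exit_le(1)[OF t, of 1] by simp
  finally have 1: "flow.exit_right t \<le> t / m" using \<open>0 < m\<close> by (simp add: field_simps)
  have "m * flow.exit_left t \<le> heat_poly resistance 2 (- int N - 1) * flow.exit_left t"
    using m flow.exit_nonneg[OF t] by (intro mult_right_mono) auto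
  also have "\<dots> \<le> t" using flow.exit_le(2)[OF t, of 1] by simp
  finally have 2: "flow.exit_left t \<le> t / m" using \<open>0 < m\<close> by (simp add: field_simps)
  from 1 2 flow.total_mass[OF t] show ?thesis by simp
qed

lemma on_diagonal_lower_bound:
  assumes t: "0 \<le> t"
  shows "(killed_mass N t)\<^sup>2 \<le> (2 * real N + 1) * heat_kernel (2 * t) 0"
proof -
  interpret flow: killed_heat_flow c N "killed N" by (rule killed_heat_flow_killed)
  have "(killed_mass N t)\<^sup>2 \<le> (\<Sum>z\<in>box N. (1::real)\<^sup>2) * (\<Sum>z\<in>box N. (killed N t z)\<^sup>2)"
    using Cauchy_Schwarz_ineq_sum[of "\<lambda>_. 1" "killed N t" "box N"] by simp
  also have "\<dots> = (2 * real N + 1) * killed N (2 * t) 0"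
    using flow.u_symmetry[OF t] by simp
  also have "\<dots> \<le> (2 * real N + 1) * heat_kernel (2 * t) 0"
    by (intro mult_left_mono killed_le_heat_kernel) simp
  finally show ?thesis .
qed

section \<open>Growth in degree two, non-explosion and slow decay\<close>

abbreviation poly2_above :: "real \<Rightarrow> nat \<Rightarrow> bool" where
  "poly2_above M n \<equiv> M * real n ^ 2 \<le> heat_poly resistance 2 (int n) \<and> M * real n ^ 2 \<le> heat_poly resistance 2 (- int n)"

definition superquadratic :: bool where
  "superquadratic \<longleftrightarrow> (\<forall>M. \<forall>\<^sub>F n in sequentially. poly2_above M n)"

text \<open>The property shared by both cases of the theorem: it forces the killed mass to tend to
  1.\<close>

definition quadratic :: bool where
  "quadratic \<longleftrightarrow> (\<exists>M>0. \<forall>\<^sub>F n in sequentially. poly2_above M n)"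

lemma superquadratic_imp_quadratic: "superquadratic \<Longrightarrow> quadratic"
  unfolding superquadratic_def quadratic_def by (auto intro: exI[of _ 1])

lemma killed_mass_limit:
  assumes quadratic and t: "0 \<le> t"
  shows "(\<lambda>N. \<Sum>z\<in>box N. killed N t z) \<longlonglongrightarrow> 1"
proof -
  obtain M where M: "M > 0" "\<forall>\<^sub>F n in sequentially. poly2_above M n"
    using assms(1) unfolding quadratic_def by blast
  have lower: "\<forall>\<^sub>F n in sequentially. poly2_above M (Suc n)"
    using M(2) by (subst (asm) eventually_sequentially_Suc[symmetric])
  show ?thesis
  proof (rule real_tendsto_sandwich)
    show "\<forall>\<^sub>F N in sequentially. 1 - 2 * t / (M * real (Suc N) ^ 2) \<le> killed_mass N t"
      using lower
    proof eventually_elim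
      case (elim N)
      have s: "int (Suc N) = int N + 1" "- (int N + 1) = - int N - 1" by auto
      show ?case by (rule killed_mass_ge[OF t]) (use elim M(1) in \<open>auto simp only: s, simp\<close>)
    qed
    show "\<forall>\<^sub>F N in sequentially. killed_mass N t \<le> 1"
      by (simp add: killed_mass_le_1)
    have "(\<lambda>N. 1 - 2 * t / (M * real (Suc N) ^ 2)) \<longlonglongrightarrow> 1 - 0" using M(1) by real_asymp
    then show "(\<lambda>N. 1 - 2 * t / (M * real (Suc N) ^ 2)) \<longlonglongrightarrow> 1" by simp
  qed simp
qed

lemma killed_limit:
  assumes quadratic "0 \<le> t"
  shows "(\<lambda>N. killed N t x) \<longlonglongrightarrow> heat_kernel t x"
proof (rule real_tendsto_sandwich[where h="\<lambda>_. heat_kernel t x"])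
  show "\<forall>\<^sub>F N in sequentially. heat_kernel t x - (1 - killed_mass N t) \<le> killed N t x"
    using heat_kernel_le_killed[of t x] by (simp add: algebra_simps)
  have "(\<lambda>N. heat_kernel t x - (1 - killed_mass N t)) \<longlonglongrightarrow> heat_kernel t x - (1 - 1)"
    by (intro tendsto_intros killed_mass_limit assms)
  then show "(\<lambda>N. heat_kernel t x - (1 - killed_mass N t)) \<longlonglongrightarrow> heat_kernel t x" by simp
qed (auto simp: killed_le_heat_kernel)

lemma heat_kernel_holder:
  assumes quadratic "0 < t" "x \<le> y"
  shows "(heat_kernel t y - heat_kernel t x)\<^sup>2 \<le> heat_kernel t 0 / t * (potential y - potential x)"
proof (rule LIMSEQ_le)
  have lim: "(\<lambda>N. killed N t z) \<longlonglongrightarrow> heat_kernel t z" for z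
    by (rule killed_limit) (use assms in auto)
  show "(\<lambda>N. (killed N t y - killed N t x)\<^sup>2) \<longlonglongrightarrow> (heat_kernel t y - heat_kernel t x)\<^sup>2"
    by (intro tendsto_intros lim)
  show "(\<lambda>N. killed N t 0 / t * (potential y - potential x)) \<longlonglongrightarrow> heat_kernel t 0 / t * (potential y - potential x)"
    using assms by (intro tendsto_intros lim) auto
  show "\<exists>n. \<forall>N\<ge>n. (killed N t y - killed N t x)\<^sup>2 \<le> killed N t 0 / t * (potential y - potential x)"
    using killed_heat_flow_holder[OF killed_heat_flow_killed] assms by blast
qed

text \<open>Here the crude bound p_t(0) <= 1 is enough: for fixed x the difference multiplied by
  sqrt t stays bounded, which is harmless against a quantity tending to infinity.\<close>

lemma heat_kernel_diff_0:
  assumes quadratic "0 < t"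
  shows "\<bar>heat_kernel t x - heat_kernel t 0\<bar> \<le> sqrt (\<bar>potential x\<bar> / t)"
proof -
  have "(heat_kernel t x - heat_kernel t 0)\<^sup>2 \<le> heat_kernel t 0 / t * \<bar>potential x\<bar>"
    using heat_kernel_holder[OF assms, of 0 x] heat_kernel_holder[OF assms, of x 0] isum_mono[of resistance 0 x] isum_mono[of resistance x 0] edge_pos
    by (cases "0 \<le> x") (auto simp: less_imp_le power2_commute[of "heat_kernel t 0"])
  also have "\<dots> \<le> 1 / t * \<bar>potential x\<bar>"
    using assms heat_kernel_le_1 by (intro mult_right_mono divide_right_mono) auto
  finally show ?thesis by (intro real_le_rsqrt) (simp add: power2_abs)
qed

theorem superquadratic_imp_slow_decay:
  assumes superquadratic
  shows "filterlim (\<lambda>t. sqrt t * heat_kernel t x) at_top at_top"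
proof -
  have quad: quadratic using assms by (rule superquadratic_imp_quadratic)
  have diag: "\<forall>\<^sub>F t in at_top. K \<le> sqrt (2 * t) * heat_kernel (2 * t) 0" if K: "0 < K" for K
  proof -
    \<comment> \<open>The box has radius about d * sqrt t. Since 3 * d = 1 / (4 * K), the bound 1 /
      4 <= 3 * d * sqrt t * p becomes K <= sqrt t * p.\<close>
    define d where "d = 1 / (12 * K)"
    have d: "0 < d" using K by (simp add: d_def)
    \<comment> \<open>Makes the polynomial of degree 2 at least 4 * t at the exit points; each exit
      then has probability at most 1 / 4.\<close>
    define M where "M = 4 / d\<^sup>2"
    have M: "0 < M" using d by (simp add: M_def)
    have "\<forall>\<^sub>F n in sequentially. poly2_above M n"
      using assms unfolding superquadratic_def by blast
    then obtain n0 where n0: "\<And>n. n \<ge> n0 \<Longrightarrow> poly2_above M n"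
      unfolding eventually_sequentially by blast
    have "filterlim (\<lambda>t. d * sqrt t) at_top at_top"
      by (rule filterlim_tendsto_pos_mult_at_top[OF tendsto_const d sqrt_at_top])
    then have "\<forall>\<^sub>F t in at_top. d * sqrt t \<ge> max 1 (real n0)" unfolding filterlim_at_top by blast
    then show ?thesis using eventually_gt_at_top[of 0]
    proof eventually_elim
      case (elim t)
      define R where "R = nat \<lfloor>d * sqrt t\<rfloor>"
      have dt: "0 \<le> d * sqrt t" using d elim by simp
      have R1: "real R \<le> d * sqrt t" using dt unfolding R_def by linarith
      have R2: "d * sqrt t \<le> real (Suc R)" using dt unfolding R_def by linarith
      have n: "Suc R \<ge> n0" using R2 elim by linarith
      have s: "int (Suc R) = int R + 1" "- (int R + 1) = - int R - 1" by auto
      note h = n0[OF n, unfolded s]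
      have "d\<^sup>2 * t \<le> (real (Suc R))\<^sup>2"
        using power_mono[OF R2 dt, of 2] elim by (simp add: power_mult_distrib)
      then have "M * (d\<^sup>2 * t) \<le> M * real (Suc R) ^ 2" using M by simp
      moreover have "M * (d\<^sup>2 * t) = 4 * t" using d by (simp add: M_def)
      ultimately have m: "4 * t \<le> M * real (Suc R) ^ 2" by simp
      have "1 - 2 * t / (4 * t) \<le> killed_mass R t"
        by (rule killed_mass_ge) (use elim m h in linarith)+
      then have half: "1 / 2 \<le> killed_mass R t" using elim by simp
      have "1 / 4 \<le> (killed_mass R t)\<^sup>2"
        using power_mono[OF half, of 2] by (simp add: power2_eq_square)
      also have "\<dots> \<le> (2 * real R + 1) * heat_kernel (2 * t) 0"
        by (rule on_diagonal_lower_bound) (use elim in simp)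
      \<comment> \<open>2 * R + 1 <= 3 * (d * sqrt t), as R <= d * sqrt t and 1 <= d * sqrt
        t.\<close>
      also have "\<dots> \<le> (3 * (d * sqrt t)) * heat_kernel (2 * t) 0"
        using R1 elim by (intro mult_right_mono heat_kernel_nonneg) auto
      finally have "K \<le> sqrt t * heat_kernel (2 * t) 0"
        using K by (simp add: d_def field_simps)
      also have "\<dots> \<le> sqrt (2 * t) * heat_kernel (2 * t) 0"
        using elim by (intro mult_right_mono heat_kernel_nonneg) auto
      finally show ?case .
    qed
  qed
  have diag': "\<forall>\<^sub>F t in at_top. K \<le> sqrt t * heat_kernel t 0" if K: "0 < K" for K
  proof -
    have half: "filterlim (\<lambda>t::real. t / 2) at_top at_top" by real_asymp
    have "\<forall>\<^sub>F t in at_top. K \<le> sqrt (2 * (t / 2)) * heat_kernel (2 * (t / 2)) 0"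
      using diag[OF K] half by (rule eventually_compose_filterlim)
    then show ?thesis by simp
  qed
  show ?thesis
    unfolding filterlim_at_top
  proof
    fix Z :: real
    define K where "K = max 1 (Z + sqrt \<bar>potential x\<bar>)"
    have "0 < K" by (simp add: K_def)
    from diag'[OF this] show "\<forall>\<^sub>F t in at_top. Z \<le> sqrt t * heat_kernel t x"
      using eventually_gt_at_top[of 0]
    proof eventually_elim
      case (elim t)
      have "sqrt t * \<bar>heat_kernel t x - heat_kernel t 0\<bar> \<le> sqrt t * sqrt (\<bar>potential x\<bar> / t)"
        using heat_kernel_diff_0[OF quad elim(2)] elim by (intro mult_left_mono) auto
      also have "\<dots> = sqrt \<bar>potential x\<bar>" using elim by (simp flip: real_sqrt_mult)
      finally have "sqrt t * heat_kernel t 0 - sqrt t * heat_kernel t x \<le> sqrt \<bar>potential x\<bar>"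
        using elim abs_le_D2[of "heat_kernel t x - heat_kernel t 0"]
        by (smt (verit) mult_left_mono right_diff_distrib real_sqrt_ge_zero)
      then show ?case using elim by (simp add: K_def)
    qed
  qed
qed

end

section \<open>Moments and the central limit theorem\<close>

text \<open>Moments of the standard normal law, entering through their exponential series.\<close>

definition gauss_moment :: "nat \<Rightarrow> real" where
  "gauss_moment k = (if even k then fact k / (2 ^ (k div 2) * fact (k div 2)) else 0)"

lemma gauss_moment_term:
  "(\<i> * complex_of_real \<theta>) ^ (2 * K) * of_real (gauss_moment (2 * K)) / fact (2 * K) = of_real ((- (\<theta>\<^sup>2 / 2)) ^ K / fact K)"
proof -
  have "(\<i> * complex_of_real \<theta>) ^ (2 * K) = of_real ((- \<theta>\<^sup>2) ^ K)"
    by (simp add: power_mult power_mult_distrib)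
  moreover have "(- \<theta>\<^sup>2) ^ K = (- (\<theta>\<^sup>2 / 2)) ^ K * 2 ^ K"
    by (simp flip: power_mult_distrib)
  ultimately show ?thesis by (simp add: gauss_moment_def)
qed

lemma gauss_moment_series:
  "(\<Sum>k<2 * K. (\<i> * complex_of_real \<theta>) ^ k * of_real (gauss_moment k) / fact k)
    = of_real (\<Sum>j<K. (- (\<theta>\<^sup>2 / 2)) ^ j / fact j)"
proof (induction K)
  case (Suc K)
  have "gauss_moment (Suc (2 * K)) = 0" by (simp add: gauss_moment_def)
  then show ?case using Suc gauss_moment_term[of \<theta> K] by simp
qed simp

lemma gauss_moment_even_term: "\<bar>\<theta>\<bar> ^ (2 * K) / fact (2 * K) * gauss_moment (2 * K) = (\<theta>\<^sup>2 / 2) ^ K / fact K"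
  by (simp add: gauss_moment_def power_mult power_divide)

context conductance_walk begin

text \<open>\<open>A\<close> is the mean resistance per edge; on large scales the walk then
  resembles a Brownian motion of variance 2 t / A.\<close>

definition homogenizes :: "real \<Rightarrow> bool" where
  "homogenizes A \<longleftrightarrow> 0 < A \<and> growth potential 1 A"

lemma homogenization_flows: "homogenizes A \<Longrightarrow> killed_heat_flows c killed A"
  unfolding homogenizes_def
  by (intro killed_heat_flows.intro killed_heat_flow_killed) auto

lemma homogenization_imp_quadratic:
  assumes "homogenizes A" shows quadratic
proof -
  interpret fl: killed_heat_flows c killed A using assms by (rule homogenization_flows)
  have A: "0 < A" by (rule fl.A_pos)
  have "growth (heat_poly resistance 2) 2 (A / 2)"
    using fl.poly_growth[of 2] by (simp add: fact_numeral)
  then have "\<forall>\<^sub>F n in sequentially. A / 4 < heat_poly resistance 2 (int n) / real n ^ 2 \<and> A / 4 < heat_poly resistance 2 (- int n) / (- real n) ^ 2"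
    unfolding growth_def using A by (intro eventually_conj order_tendstoD(1)[where F=sequentially]) auto
  then have "\<forall>\<^sub>F n in sequentially. A / 4 * real n ^ 2 \<le> heat_poly resistance 2 (int n) \<and> A / 4 * real n ^ 2 \<le> heat_poly resistance 2 (- int n)"
    using eventually_gt_at_top[of 0] by eventually_elim (simp add: field_simps)
  then show ?thesis unfolding quadratic_def using A by (intro exI[of _ "A / 4"]) auto
qed

definition box_moment :: "nat \<Rightarrow> nat \<Rightarrow> real \<Rightarrow> real" where
  "box_moment m N t = (\<Sum>x\<in>box N. killed N t x * of_int x ^ m)"

abbreviation abs_moment :: "nat \<Rightarrow> nat \<Rightarrow> real \<Rightarrow> real" where
  "abs_moment m N t \<equiv> \<Sum>x\<in>box N. killed N t x * \<bar>of_int x\<bar> ^ m"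

text \<open>Normalises the variance 2 t / A to 1.\<close>

abbreviation scale :: "real \<Rightarrow> real \<Rightarrow> real" where "scale A t \<equiv> sqrt (A / (2 * t))"

lemma scale_power_tendsto: "0 < A \<Longrightarrow> 0 < m \<Longrightarrow> ((\<lambda>t. scale A t ^ m) \<longlongrightarrow> 0) at_top"
proof -
  assume A: "0 < A" "0 < m"
  have "((\<lambda>t. scale A t) \<longlongrightarrow> 0) at_top" using A by real_asymp
  then have "((\<lambda>t. scale A t ^ m) \<longlongrightarrow> 0 ^ m) at_top" by (rule tendsto_power)
  with A show ?thesis by (simp add: power_0_left)
qed

text \<open>Bookkeeping of constants: the polynomial of degree m has leading coefficient A^(Suc m
  div 2) / m!, and its rescaled mean divided by that coefficient is the normal moment.\<close>

lemma scale_moment: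
  assumes "0 < A" "0 < t"
  shows "scale A t ^ m * brownian_moment m t = A ^ (Suc m div 2) / fact m * gauss_moment m"
proof (cases "even m")
  case True
  then obtain j where m: "m = 2 * j" by blast
  have "scale A t ^ m = (A / (2 * t)) ^ j" using assms by (simp add: m power_mult)
  then show ?thesis using assms by (simp add: m brownian_moment_def gauss_moment_def power_divide power_mult_distrib)
qed (simp add: brownian_moment_def gauss_moment_def)

lemma killed_nonneg: "0 \<le> killed N t x"
  by (simp add: killed_def)

text \<open>The polynomials whose mean is exactly the Brownian moment have the leading behaviour of
  monomials, so the moments of the walk differ from Brownian moments by lower order terms.\<close>

lemma box_moment_approx:
  assumes "homogenizes A" and e: "0 < e"
  shows "\<exists>C\<ge>0. \<forall>t\<ge>0. \<forall>\<^sub>F N in sequentially.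
    \<bar>A ^ (Suc m div 2) / fact m * box_moment m N t - brownian_moment m t\<bar>
      \<le> e * abs_moment m N t + C"
proof -
  interpret fl: killed_heat_flows c killed A using assms(1) by (rule homogenization_flows)
  let ?a = "A ^ (Suc m div 2) / fact m"
  obtain C where C: "0 \<le> C" "\<And>x. \<bar>fl.poly m x - ?a * of_int x ^ m\<bar> \<le> e * \<bar>of_int x\<bar> ^ m + C"
    using growth_approx[OF fl.poly_growth[of m] e] by blast
  have "\<forall>\<^sub>F N in sequentially. \<bar>?a * box_moment m N t - brownian_moment m t\<bar>
      \<le> e * abs_moment m N t + (C + 1)" if t: "0 \<le> t" for t
  proof -
    have "\<forall>\<^sub>F N in sequentially. \<bar>(\<Sum>x\<in>box N. killed N t x * fl.poly m x) - brownian_moment m t\<bar> < 1"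
      using fl.moment_limit[OF t, of m] unfolding tendsto_iff dist_real_def by auto
    then show ?thesis
    proof eventually_elim
      case (elim N)
      let ?B = "box N"
      have "\<bar>?a * box_moment m N t - (\<Sum>x\<in>?B. killed N t x * fl.poly m x)\<bar>
          = \<bar>\<Sum>x\<in>?B. killed N t x * (?a * of_int x ^ m - fl.poly m x)\<bar>"
        by (simp add: box_moment_def sum_distrib_left algebra_simps sum_subtractf)
      also have "\<dots> \<le> (\<Sum>x\<in>?B. \<bar>killed N t x * (?a * of_int x ^ m - fl.poly m x)\<bar>)" by (rule sum_abs)
      also have "\<dots> \<le> (\<Sum>x\<in>?B. killed N t x * (e * \<bar>of_int x\<bar> ^ m + C))"
      proof (rule sum_mono)
        fix x
        show "\<bar>killed N t x * (?a * of_int x ^ m - fl.poly m x)\<bar> \<le> killed N t x * (e * \<bar>of_int x\<bar> ^ m + C)"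
          using C(2)[of x] killed_nonneg[of N t x]
          by (simp add: abs_mult abs_minus_commute mult_left_mono)
      qed
      also have "\<dots> = e * abs_moment m N t + C * (\<Sum>x\<in>?B. killed N t x)"
        by (simp add: algebra_simps sum.distrib sum_distrib_left)
      also have "\<dots> \<le> e * abs_moment m N t + C"
        using mult_left_mono[OF killed_mass_le_1[of N t] C(1)] by simp
      finally show ?case using elim by linarith
    qed
  qed
  then show ?thesis using C(1) by (intro exI[of _ "C + 1"]) auto
qed

text \<open>In even order the absolute moment is the moment itself; a relative error of half the
  leading coefficient can therefore be absorbed on the left.\<close>

lemma even_moment_bounded:
  assumes hom: "homogenizes A"
  shows "\<exists>B\<ge>0. \<forall>\<^sub>F t in at_top. \<forall>\<^sub>F N in sequentially. scale A t ^ (2 * m) * box_moment (2 * m) N t \<le> B"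
proof -
  have A: "0 < A" using hom by (simp add: homogenizes_def)
  define a where "a = A ^ (Suc (2 * m) div 2) / fact (2 * m)"
  have a: "0 < a" using A by (simp add: a_def)
  obtain C where C: "0 \<le> C" "\<And>t. 0 \<le> t \<Longrightarrow> \<forall>\<^sub>F N in sequentially. \<bar>a * box_moment (2 * m) N t - brownian_moment (2 * m) t\<bar>
      \<le> a / 2 * abs_moment (2 * m) N t + C"
    using box_moment_approx[OF hom, of "a / 2" "2 * m"] a unfolding a_def by auto
  have abs: "abs_moment (2 * m) N t = box_moment (2 * m) N t" for N t
    unfolding box_moment_def by (intro sum.cong) (auto simp: power_even_abs)
  define B where "B = 2 / a * (a * gauss_moment (2 * m) + C)"
  have "0 \<le> gauss_moment (2 * m)" by (simp add: gauss_moment_def)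
  then have B: "0 \<le> B" using a C(1) by (simp add: B_def)
  have "\<forall>\<^sub>F t in at_top. A / (2 * t) < 1" using A by real_asymp
  then have "\<forall>\<^sub>F t in at_top. \<forall>\<^sub>F N in sequentially. scale A t ^ (2 * m) * box_moment (2 * m) N t \<le> B"
    using eventually_gt_at_top[of 0]
  proof eventually_elim
    case (elim t)
    define s where "s = scale A t ^ (2 * m)"
    have s: "0 \<le> s" "s \<le> 1" using elim A by (auto simp: s_def power_le_one)
    have sm: "s * brownian_moment (2 * m) t = a * gauss_moment (2 * m)"
      unfolding s_def a_def by (rule scale_moment) (use A elim in auto)
    from C(2)[of t] elim have "\<forall>\<^sub>F N in sequentially. \<bar>a * box_moment (2 * m) N t - brownian_moment (2 * m) t\<bar>
      \<le> a / 2 * box_moment (2 * m) N t + C" by (simp add: abs)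
    then show ?case
    proof eventually_elim
      case (elim N)
      then have "a / 2 * box_moment (2 * m) N t \<le> brownian_moment (2 * m) t + C" by linarith
      then have "s * (a / 2 * box_moment (2 * m) N t) \<le> s * (brownian_moment (2 * m) t + C)"
        using s by (intro mult_left_mono)
      also have "\<dots> \<le> a * gauss_moment (2 * m) + C"
        unfolding distrib_left sm using mult_right_mono[OF s(2) C(1)] by simp
      finally show ?case using a by (simp add: B_def s_def field_simps)
    qed
  qed
  with B show ?thesis by blast
qed

text \<open>The error in \<open>box_moment_approx\<close> involves absolute moments, which are
  bounded by even moments of twice the order through |y| <= 1 + y^2. Order 0 is treated apart, since
  there no power of the scale damps the additive constant.\<close>

lemma moment_convergence:
  assumes hom: "homogenizes A" and e: "0 < e"
  shows "\<forall>\<^sub>F t in at_top. \<forall>\<^sub>F N in sequentially. \<bar>scale A t ^ m * box_moment m N t - gauss_moment m\<bar> \<le> e"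
proof (cases "m = 0")
  case True
  have quad: quadratic using hom by (rule homogenization_imp_quadratic)
  show ?thesis using eventually_ge_at_top[of 0]
  proof eventually_elim
    case (elim t)
    have "\<forall>\<^sub>F N in sequentially. \<bar>killed_mass N t - 1\<bar> < e"
      using killed_mass_limit[OF quad elim] e unfolding tendsto_iff dist_real_def by auto
    then show ?case by eventually_elim (simp add: True box_moment_def gauss_moment_def)
  qed
next
  case False
  have A: "0 < A" using hom by (simp add: homogenizes_def)
  define a where "a = A ^ (Suc m div 2) / fact m"
  have a: "0 < a" using A by (simp add: a_def)
  obtain B where B: "0 \<le> B" "\<forall>\<^sub>F t in at_top. \<forall>\<^sub>F N in sequentially. scale A t ^ (2 * m) * box_moment (2 * m) N t \<le> B"
    using even_moment_bounded[OF hom, of m] by blast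
  define d where "d = a * e / 2 / (1 + B)"
  have d: "0 < d" using a e B(1) by (simp add: d_def)
  have "1 + B \<noteq> 0" using B(1) by simp
  then have dB: "d * (1 + B) = a * e / 2"
    unfolding d_def by (rule nonzero_eq_divide_eq[THEN iffD1, OF _ refl])
  obtain C where C: "0 \<le> C" "\<And>t. 0 \<le> t \<Longrightarrow> \<forall>\<^sub>F N in sequentially. \<bar>a * box_moment m N t - brownian_moment m t\<bar>
      \<le> d * abs_moment m N t + C"
    using box_moment_approx[OF hom d, of m] unfolding a_def by auto
  have "((\<lambda>t. scale A t ^ m * C) \<longlongrightarrow> 0 * C) at_top"
    by (intro tendsto_mult scale_power_tendsto A tendsto_const) (use False in simp)
  then have "\<forall>\<^sub>F t in at_top. scale A t ^ m * C < a * e / 2" using a e by (intro order_tendstoD(2)) auto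
  with B(2) eventually_gt_at_top[of 0] show ?thesis
  proof eventually_elim
    case (elim t)
    define s where "s = scale A t"
    have s: "0 \<le> s" using A elim by (simp add: s_def)
    have sm: "s ^ m * brownian_moment m t = a * gauss_moment m"
      unfolding s_def a_def by (rule scale_moment) (use A elim in auto)
    have "\<forall>\<^sub>F N in sequentially. \<bar>a * box_moment m N t - brownian_moment m t\<bar>
      \<le> d * abs_moment m N t + C" using C(2)[of t] elim by simp
    with elim(1) show ?case
    proof eventually_elim
      case (elim N)
      let ?B = "box N"
      have "s ^ m * abs_moment m N t = (\<Sum>x\<in>?B. killed N t x * \<bar>s * of_int x\<bar> ^ m)"
        using s by (simp add: sum_distrib_left abs_mult power_mult_distrib mult_ac)
      also have "\<dots> \<le> (\<Sum>x\<in>?B. killed N t x * (1 + (s * of_int x) ^ (2 * m)))"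
      proof (rule sum_mono, rule mult_left_mono[OF _ killed_nonneg])
        fix x
        have "\<bar>y\<bar> \<le> 1 + y\<^sup>2" for y :: real
          using sum_power2_ge_zero[of "\<bar>y\<bar> - 1/2" 0] by (simp add: power2_eq_square algebra_simps)
        from this[of "(s * of_int x) ^ m"]
        show "\<bar>s * of_int x\<bar> ^ m \<le> 1 + (s * of_int x) ^ (2 * m)"
          by (simp add: power_abs mult.commute[of 2] power_mult)
      qed
      also have "\<dots> = (\<Sum>x\<in>?B. killed N t x) + s ^ (2 * m) * box_moment (2 * m) N t"
        by (simp add: box_moment_def sum_distrib_left distrib_left sum.distrib power_mult_distrib mult_ac)
      also have "\<dots> \<le> 1 + B" using killed_mass_le_1 elim(1) by (intro add_mono) (auto simp: s_def)
      finally have abs_le: "s ^ m * abs_moment m N t \<le> 1 + B" .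
      have "a * \<bar>s ^ m * box_moment m N t - gauss_moment m\<bar> = \<bar>s ^ m * (a * box_moment m N t - brownian_moment m t)\<bar>"
        using a sm by (simp add: abs_mult_pos' flip: abs_mult) (simp add: algebra_simps)
      also have "\<dots> = s ^ m * \<bar>a * box_moment m N t - brownian_moment m t\<bar>" using s by (simp add: abs_mult)
      also have "\<dots> \<le> s ^ m * (d * abs_moment m N t + C)"
        using elim s by (intro mult_left_mono) auto
      also have "\<dots> = d * (s ^ m * abs_moment m N t) + s ^ m * C" by (simp add: algebra_simps)
      also have "\<dots> \<le> d * (1 + B) + s ^ m * C" using d abs_le by simp
      also have "\<dots> \<le> a * e" using dB \<open>scale A t ^ m * C < a * e / 2\<close> by (simp add: s_def)
      finally show ?case using a by (simp add: s_def)
    qed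
  qed
qed


text \<open>The excess weights inside the box and the weight outside it together make up the mass
  lost by killing.\<close>

lemma expectation_killed_approx:
  fixes f :: "int \<Rightarrow> complex"
  assumes f: "\<And>x. norm (f x) \<le> 1"
  shows "norm ((CLINT y|P. f (walk t y)) - (\<Sum>x\<in>box N. of_real (killed N t x) * f x))
    \<le> 2 * (1 - killed_mass N t)"
proof -
  let ?B = "box N" and ?W = "walk t"
  let ?K = "\<lambda>x. {y \<in> space P. ?W y = x}" and ?O = "{y \<in> space P. ?W y \<notin> ?B}"
  let ?h = "\<Sum>x\<in>?B. of_real (heat_kernel t x) * f x"
  let ?k = "\<Sum>x\<in>?B. of_real (killed N t x) * f x"
  let ?r = "CLINT y|P. indicator ?O y *\<^sub>R f (?W y)"
  let ?e = "CLINT y|P. f (?W y)"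
  have K [measurable]: "?K x \<in> events" for x
    using measurable_sets[OF walk_position_measurable, of "{x}" t] by (simp add: vimage_def Int_def conj_commute)
  have O [measurable]: "?O \<in> events"
    using measurable_sets[OF walk_position_measurable, of "- ?B" t] by (simp add: vimage_def Int_def conj_commute)
  have fW [measurable]: "(\<lambda>y. f (?W y)) \<in> borel_measurable P"
    by (rule measurable_compose[OF walk_position_measurable]) simp
  have int: "integrable P (\<lambda>y. f (?W y))"
    by (rule integrable_const_bound[of _ 1]) (use f fW in auto)
  have decomp: "f (?W y) = (\<Sum>x\<in>?B. indicator (?K x) y *\<^sub>R f x) + indicator ?O y *\<^sub>R f (?W y)" if "y \<in> space P" for y
  proof (cases "?W y \<in> ?B")
    case True
    then have "(\<Sum>x\<in>?B. indicator (?K x) y *\<^sub>R f x) = (\<Sum>x\<in>?B. if x = ?W y then f x else 0)"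
      using that by (intro sum.cong) (auto simp: indicator_def)
    then show ?thesis using True that by (simp add: sum.delta indicator_def)
  next
    case False
    then have "(\<Sum>x\<in>?B. indicator (?K x) y *\<^sub>R f x) = 0"
      by (intro sum.neutral) (auto simp: indicator_def)
    then show ?thesis using False that by (simp add: indicator_def)
  qed
  have "?e = (CLINT y|P. (\<Sum>x\<in>?B. indicator (?K x) y *\<^sub>R f x) + indicator ?O y *\<^sub>R f (?W y))"
    by (rule Bochner_Integration.integral_cong[OF refl decomp])
  also have "\<dots> = (CLINT y|P. (\<Sum>x\<in>?B. indicator (?K x) y *\<^sub>R f x)) + ?r"
    by (intro Bochner_Integration.integral_add Bochner_Integration.integrable_sum integrable_mult_indicator int) auto
  also have "(CLINT y|P. (\<Sum>x\<in>?B. indicator (?K x) y *\<^sub>R f x)) = (\<Sum>x\<in>?B. CLINT y|P. indicator (?K x) y *\<^sub>R f x)"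
    by (intro Bochner_Integration.integral_sum integrable_mult_indicator) auto
  also have "\<dots> = ?h"
    by (intro sum.cong refl) (simp add: heat_kernel_def scaleR_conv_of_real)
  finally have E: "?e = ?h + ?r" .
  have "norm ?r \<le> (\<integral>y. indicator ?O y \<partial>P)"
  proof (rule order_trans[OF integral_norm_bound integral_mono])
    show "integrable P (\<lambda>y. norm (indicator ?O y *\<^sub>R f (?W y)))"
      by (intro integrable_norm integrable_mult_indicator int O)
    show "integrable P (indicat_real ?O)"
      by (rule integrable_real_indicator[OF O]) (simp add: emeasure_eq_measure)
    show "norm (indicator ?O y *\<^sub>R f (?W y)) \<le> indicat_real ?O y" for y
      using f by (auto simp: indicator_def)
  qed
  also have "\<dots> = prob ?O" using O by simp
  also have "\<dots> = 1 - prob {y \<in> space P. ?W y \<in> ?B}"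
  proof -
    have "?O = space P - {y \<in> space P. ?W y \<in> ?B}" by auto
    moreover have "{y \<in> space P. ?W y \<in> ?B} \<in> events"
      using measurable_sets[OF walk_position_measurable, of "?B" t] by (simp add: vimage_def Int_def conj_commute)
    ultimately show ?thesis by (simp only: prob_compl)
  qed
  also have "\<dots> = 1 - (\<Sum>x\<in>?B. heat_kernel t x)" by (simp add: heat_kernel_sum)
  finally have 1: "norm ?r \<le> 1 - (\<Sum>x\<in>?B. heat_kernel t x)" .
  have "norm (\<Sum>x\<in>?B. of_real (heat_kernel t x - killed N t x) * f x) \<le> (\<Sum>x\<in>?B. heat_kernel t x - killed N t x)"
  proof (rule sum_norm_le)
    fix x
    have "norm (complex_of_real (heat_kernel t x - killed N t x) * f x) \<le> \<bar>heat_kernel t x - killed N t x\<bar> * 1"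
      unfolding norm_mult norm_of_real using f by (intro mult_left_mono) auto
    then show "norm (complex_of_real (heat_kernel t x - killed N t x) * f x) \<le> heat_kernel t x - killed N t x"
      using killed_le_heat_kernel[of N t x] by simp
  qed
  then have 2: "norm (?h - ?k)
      \<le> (\<Sum>x\<in>?B. heat_kernel t x) - (\<Sum>x\<in>?B. killed N t x)"
    by (simp add: sum_subtractf algebra_simps)
  have 3: "(\<Sum>x\<in>?B. killed N t x) \<le> (\<Sum>x\<in>?B. heat_kernel t x)"
    by (intro sum_mono killed_le_heat_kernel)
  have D: "?e - ?k
     = (?h - ?k) + ?r"
    unfolding E by (simp only: add_diff_eq diff_add_eq)
  have "norm (?e - ?k)
      \<le> norm (?h - ?k)
        + norm ?r"
    unfolding D by (rule norm_triangle_ineq)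
  also have "\<dots> \<le> 1 - (\<Sum>x\<in>?B. killed N t x)" using 1 2 by linarith
  also have "\<dots> \<le> 2 * (1 - (\<Sum>x\<in>?B. killed N t x))" using killed_mass_le_1[of N t] by simp
  finally show ?thesis .
qed

section \<open>Characteristic functions of the rescaled walk\<close>

definition scaled_law :: "real \<Rightarrow> real \<Rightarrow> real measure" where
  "scaled_law A t = distr P borel (\<lambda>y. scale A t * of_int (walk t y))"

lemma scaled_walk_measurable [measurable]: "(\<lambda>y. scale A t * of_int (walk t y)) \<in> borel_measurable P"
  by (rule measurable_compose[OF walk_position_measurable]) simp

lemma real_distribution_scaled_law: "real_distribution (scaled_law A t)"
  unfolding scaled_law_def by (rule real_distribution_distr) simp

lemma char_scaled_law: "char (scaled_law A t) \<theta> = (CLINT y|P. iexp (\<theta> * (scale A t * of_int (walk t y))))"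
  unfolding char_def scaled_law_def by (subst integral_distr) auto

text \<open>Taylor expansion of the exponential; the even order makes the remainder a moment instead
  of an absolute moment.\<close>

lemma char_polynomial_approx:
  "norm ((\<Sum>x\<in>box N. of_real (killed N t x) * iexp (\<theta> * (s * of_int x)))
      - (\<Sum>j<2 * K. (\<i> * of_real \<theta>) ^ j * of_real (s ^ j * box_moment j N t) / fact j))
    \<le> \<bar>\<theta>\<bar> ^ (2 * K) / fact (2 * K) * (s ^ (2 * K) * box_moment (2 * K) N t)"
proof (cases K)
  case 0
  have "norm (\<Sum>x\<in>box N. of_real (killed N t x) * iexp (\<theta> * (s * of_int x))) \<le> killed_mass N t"
    by (intro sum_norm_le) (simp add: norm_mult killed_nonneg)
  then show ?thesis using 0 by (simp add: box_moment_def)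
next
  case (Suc L)
  let ?B = "box N"
  let ?T = "\<lambda>x. \<Sum>j<2 * K. (\<i> * of_real (\<theta> * (s * of_int x))) ^ j / fact j"
  have eq: "(\<Sum>j<2 * K. (\<i> * of_real \<theta>) ^ j * of_real (s ^ j * box_moment j N t) / fact j)
      = (\<Sum>x\<in>?B. of_real (killed N t x) * ?T x)"
    by (simp add: box_moment_def sum_distrib_left sum_divide_distrib power_mult_distrib mult_ac, subst sum.swap, simp)
  have K2: "2 * K = Suc (Suc (2 * L))" using Suc by simp
  have "norm (\<Sum>x\<in>?B. of_real (killed N t x) * (iexp (\<theta> * (s * of_int x)) - ?T x))
      \<le> (\<Sum>x\<in>?B. killed N t x * (\<bar>\<theta> * (s * of_int x)\<bar> ^ (2 * K) / fact (2 * K)))"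
  proof (rule sum_norm_le)
    fix x
    have "norm (iexp (\<theta> * (s * of_int x)) - ?T x)
        \<le> \<bar>\<theta> * (s * of_int x)\<bar> ^ (2 * K) / fact (2 * K)"
      using iexp_approx1[of "\<theta> * (s * of_int x)" "Suc (2 * L)"] unfolding K2 lessThan_Suc_atMost .
    then show "norm (of_real (killed N t x) * (iexp (\<theta> * (s * of_int x)) - ?T x))
        \<le> killed N t x * (\<bar>\<theta> * (s * of_int x)\<bar> ^ (2 * K) / fact (2 * K))"
      unfolding norm_mult norm_of_real abs_of_nonneg[OF killed_nonneg]
      by (rule mult_left_mono[OF _ killed_nonneg])
  qed
  also have "\<dots> = \<bar>\<theta>\<bar> ^ (2 * K) / fact (2 * K) * (s ^ (2 * K) * box_moment (2 * K) N t)"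
    by (simp add: box_moment_def sum_distrib_left abs_mult power_mult_distrib power_even_abs mult_ac)
  finally show ?thesis unfolding eq by (simp add: right_diff_distrib sum_subtractf)
qed

text \<open>The moments determine the Taylor polynomial, and the remainder is governed by an even
  moment whose limiting contribution (\<theta>^2 / 2)^K / K! is small for large K. The choices are
  made in the order K, then t, then N.\<close>

theorem scaled_char_convergence:
  assumes hom: "homogenizes A"
  shows "((\<lambda>t. char (scaled_law A t) \<theta>) \<longlongrightarrow> char std_normal_distribution \<theta>) at_top"
proof (rule tendstoI)
  fix e :: real assume e: "0 < e"
  let ?series = "\<lambda>K. \<bar>(\<Sum>j<K. (- (\<theta>\<^sup>2 / 2)) ^ j / fact j) - exp (- (\<theta>\<^sup>2 / 2))\<bar> < e / 4" and ?term = "\<lambda>K. (\<theta>\<^sup>2 / 2) ^ K / fact K < e / 4"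
  have quad: quadratic using hom by (rule homogenization_imp_quadratic)
  have "(\<lambda>K. (\<theta>\<^sup>2 / 2) ^ K / fact K) \<longlonglongrightarrow> 0"
    using summable_LIMSEQ_zero[OF summable_exp[of "\<theta>\<^sup>2 / 2"]] by (simp only: divide_inverse mult.commute)
  then have "\<forall>\<^sub>F K in sequentially. ?term K" using e by (intro order_tendstoD(2)) auto
  moreover have "(\<lambda>K. \<Sum>j<K. (- (\<theta>\<^sup>2 / 2)) ^ j / fact j) \<longlonglongrightarrow> exp (- (\<theta>\<^sup>2 / 2))"
    using exp_converges[of "- (\<theta>\<^sup>2 / 2)"] by (simp only: sums_def divide_inverse mult.commute real_scaleR_def)
  then have "\<forall>\<^sub>F K in sequentially. ?series K"
    using e unfolding tendsto_iff dist_real_def by (meson zero_less_divide_iff zero_less_numeral)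
  ultimately have "\<forall>\<^sub>F K in sequentially. ?term K \<and>
      ?series K" by (rule eventually_conj)
  then obtain K where K: "?term K"
    "?series K"
    using eventually_happens'[OF sequentially_bot] by blast
  \<comment> \<open>Total coefficient of the moment errors; the index 2 * K is included for the
    remainder term.\<close>
  define Q where "Q = (\<Sum>j<Suc (2 * K). \<bar>\<theta>\<bar> ^ j / fact j)"
  have Q: "0 \<le> Q" unfolding Q_def by (intro sum_nonneg) auto
  define d where "d = e / 4 / (1 + Q)"
  have d: "0 < d" using e Q by (simp add: d_def)
  have "1 + Q \<noteq> 0" using Q by simp
  then have "d * (1 + Q) = e / 4" unfolding d_def by (rule nonzero_eq_divide_eq[THEN iffD1, OF _ refl])
  then have dQ: "Q * d < e / 4" using d by (simp add: algebra_simps)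
  have "\<forall>\<^sub>F t in at_top. \<forall>j\<in>{..<Suc (2 * K)}. \<forall>\<^sub>F N in sequentially. \<bar>scale A t ^ j * box_moment j N t - gauss_moment j\<bar> \<le> d"
    by (intro eventually_ball_finite ballI moment_convergence hom d) simp
  then show "\<forall>\<^sub>F t in at_top. dist (char (scaled_law A t) \<theta>) (char std_normal_distribution \<theta>) < e"
    using eventually_ge_at_top[of 0]
  proof eventually_elim
    case (elim t)
    let ?s = "scale A t"
    let ?u = "\<lambda>N. \<Sum>x\<in>box N. of_real (killed N t x) * iexp (\<theta> * (?s * of_int x))"
    let ?p = "\<lambda>N. \<Sum>j<2 * K. (\<i> * complex_of_real \<theta>) ^ j * of_real (?s ^ j * box_moment j N t) / fact j"
    let ?g = "\<Sum>j<2 * K. (\<i> * complex_of_real \<theta>) ^ j * of_real (gauss_moment j) / fact j"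
    let ?close = "\<lambda>j N. \<bar>?s ^ j * box_moment j N t - gauss_moment j\<bar> \<le> d"
    have "\<forall>\<^sub>F N in sequentially. \<forall>j\<in>{..<Suc (2 * K)}. ?close j N"
      using elim(1) by (intro eventually_ball_finite) auto
    moreover have "\<forall>\<^sub>F N in sequentially. killed_mass N t > 1 - e / 8"
      using killed_mass_limit[OF quad elim(2)] e by (intro order_tendstoD(1)) auto
    ultimately have "\<forall>\<^sub>F N in sequentially. (\<forall>j\<in>{..<Suc (2 * K)}. ?close j N) \<and>
        killed_mass N t > 1 - e / 8" by (rule eventually_conj)
    from eventually_happens'[OF sequentially_bot this]
    obtain N where N': "\<forall>j\<in>{..<Suc (2 * K)}. ?close j N"
      "killed_mass N t > 1 - e / 8" by (elim exE conjE)
    have N: "?close j N" if "j < Suc (2 * K)" for j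
      using N'(1) that by (simp only: lessThan_iff Ball_def)
    have 1: "norm (char (scaled_law A t) \<theta> - ?u N) < e / 4"
      using expectation_killed_approx[of "\<lambda>x. iexp (\<theta> * (?s * of_int x))" t N] N'(2)
      unfolding char_scaled_law by simp
    have 2: "norm (?u N - ?p N) \<le> \<bar>\<theta>\<bar> ^ (2 * K) / fact (2 * K) * (gauss_moment (2 * K) + d)"
    proof (rule order_trans[OF char_polynomial_approx])
      show "\<bar>\<theta>\<bar> ^ (2 * K) / fact (2 * K) * (?s ^ (2 * K) * box_moment (2 * K) N t)
          \<le> \<bar>\<theta>\<bar> ^ (2 * K) / fact (2 * K) * (gauss_moment (2 * K) + d)"
        using N[of "2 * K"] by (intro mult_left_mono) auto
    qed
    let ?a = "\<lambda>j. (\<i> * complex_of_real \<theta>) ^ j * of_real (?s ^ j * box_moment j N t) / fact j"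
    let ?b = "\<lambda>j. (\<i> * complex_of_real \<theta>) ^ j * of_real (gauss_moment j) / fact j"
    have 3: "norm (?p N - ?g) \<le> (\<Sum>j<2 * K. \<bar>\<theta>\<bar> ^ j / fact j * d)"
      unfolding sum_subtractf[symmetric]
    proof (rule sum_norm_le)
      fix j assume j: "j \<in> {..<2 * K}"
      have "?a j - ?b j
          = (\<i> * complex_of_real \<theta>) ^ j / fact j * of_real (?s ^ j * box_moment j N t - gauss_moment j)"
        by (simp add: diff_divide_distrib right_diff_distrib)
      also have "norm \<dots> = \<bar>\<theta>\<bar> ^ j / fact j * \<bar>?s ^ j * box_moment j N t - gauss_moment j\<bar>"
        by (simp only: norm_mult norm_divide norm_power norm_of_real norm_fact norm_ii mult_1)
      also have "\<dots> \<le> \<bar>\<theta>\<bar> ^ j / fact j * d" using N[of j] j by (intro mult_left_mono) auto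
      finally show "norm (?a j - ?b j)
          \<le> \<bar>\<theta>\<bar> ^ j / fact j * d" .
    qed
    have 4: "norm (?g - exp (- (\<theta>\<^sup>2 / 2))) < e / 4"
      unfolding gauss_moment_series using K(2)
      by (metis norm_of_real of_real_diff exp_of_real of_real_minus)
    have "(\<Sum>j<2 * K. \<bar>\<theta>\<bar> ^ j / fact j * d) + \<bar>\<theta>\<bar> ^ (2 * K) / fact (2 * K) * (gauss_moment (2 * K) + d)
        = Q * d + (\<theta>\<^sup>2 / 2) ^ K / fact K"
      unfolding Q_def sum.lessThan_Suc distrib_left distrib_right sum_distrib_right[symmetric] gauss_moment_even_term
      by (simp only: ac_simps)
    then have 5: "norm (?u N - ?p N) + norm (?p N - ?g) < e / 2" using 2 3 dQ K(1) by linarith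
    have tri: "norm (a - z) \<le> norm (a - b) + (norm (b - p) + (norm (p - g) + norm (g - z)))" for a b p g z :: complex
      using norm_triangle_ineq[of "a - b" "b - z"] norm_triangle_ineq[of "b - p" "p - z"] norm_triangle_ineq[of "p - g" "g - z"]
      by simp
    have "norm (char (scaled_law A t) \<theta> - exp (- (\<theta>\<^sup>2 / 2)))
        \<le> norm (char (scaled_law A t) \<theta> - ?u N) + (norm (?u N - ?p N) + (norm (?p N - ?g) + norm (?g - exp (- (\<theta>\<^sup>2 / 2)))))"
      by (rule tri)
    also have "\<dots> < e" using 1 4 5 by linarith
    finally show ?case by (simp add: char_std_normal_distribution dist_norm)
  qed
qed

end

section \<open>The local limit theorem\<close>

lemma std_normal_singleton: "measure std_normal_distribution {x} = 0"
proof -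
  have "{x} \<in> null_sets lborel" by (rule null_setsI) auto
  moreover have "absolutely_continuous lborel std_normal_distribution"
    by (rule absolutely_continuousI_density) simp
  ultimately have "{x} \<in> null_sets std_normal_distribution" unfolding absolutely_continuous_def by blast
  then show ?thesis by (rule measure_eq_0_null_sets)
qed

lemma std_normal_interval:
  assumes e: "0 < e"
  shows "\<exists>d>0. \<forall>h. 0 < h \<and> h < d \<longrightarrow>
    \<bar>measure std_normal_distribution {a<..a + h} / h - std_normal_density a\<bar> \<le> e"
proof -
  have "isCont std_normal_density a"
    unfolding normal_density_def by (intro continuous_intros) auto
  then obtain d where d: "0 < d" "\<And>x. dist x a < d \<Longrightarrow> dist (std_normal_density x) (std_normal_density a) < e"
    using e unfolding continuous_at_eps_delta by blast
  have "\<bar>measure std_normal_distribution {a<..a + h} / h - std_normal_density a\<bar> \<le> e" if h: "0 < h" "h < d" for h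
  proof -
    let ?I = "{a<..a + h}" and ?f = std_normal_density and ?m = "measure std_normal_distribution {a<..a + h}"
    interpret real_distribution std_normal_distribution by (rule real_dist_normal_dist)
    have close: "\<bar>?f x - ?f a\<bar> \<le> e" if "x \<in> ?I" for x
      using d(2)[of x] that h by (auto simp: dist_real_def)
    have E: "ennreal ?m = (\<integral>\<^sup>+x. ennreal (?f x) * indicator ?I x \<partial>lborel)"
      by (simp add: emeasure_density flip: emeasure_eq_measure)
    have const: "(\<integral>\<^sup>+x. ennreal b * indicator ?I x \<partial>lborel) = ennreal (b * h)" if "0 \<le> b" for b
      using h that by (simp add: nn_integral_cmult_indicator flip: ennreal_mult)
    have "ennreal ?m \<le> ennreal ((?f a + e) * h)"
      unfolding E const[symmetric, OF add_nonneg_nonneg[OF normal_density_nonneg less_imp_le[OF e]]]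
    proof (rule nn_integral_mono)
      fix x show "ennreal (?f x) * indicator ?I x \<le> ennreal (?f a + e) * indicator ?I x"
        using close[of x] by (cases "x \<in> ?I") (auto intro!: ennreal_leI simp del: ennreal_plus)
    qed
    then have up: "?m \<le> (?f a + e) * h"
      using e h by (subst (asm) ennreal_le_iff) (auto intro!: mult_nonneg_nonneg add_nonneg_nonneg)
    have "ennreal (max 0 (?f a - e) * h) \<le> ennreal ?m"
      unfolding E const[symmetric, OF max.cobounded1]
    proof (rule nn_integral_mono)
      fix x show "ennreal (max 0 (?f a - e)) * indicator ?I x \<le> ennreal (?f x) * indicator ?I x"
        using close[of x] by (cases "x \<in> ?I") (auto intro!: ennreal_leI)
    qed
    then have "max 0 (?f a - e) * h \<le> ?m" by (subst (asm) ennreal_le_iff) auto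
    moreover have "(?f a - e) * h \<le> max 0 (?f a - e) * h" using h by (intro mult_right_mono) auto
    ultimately have low: "(?f a - e) * h \<le> ?m" by linarith
    have "?m / h \<le> ?f a + e" "?f a - e \<le> ?m / h"
      using up low h by (simp_all add: pos_divide_le_eq pos_le_divide_eq)
    then show ?thesis by linarith
  qed
  then show ?thesis using d(1) by blast
qed

context conductance_walk begin

text \<open>Levy's continuity theorem along every sequence of times tending to infinity; all
  endpoints are continuity points, as the normal law has no atoms.\<close>

lemma scaled_interval_convergence:
  assumes hom: "homogenizes A" and ab: "a < b"
  shows "((\<lambda>t. measure (scaled_law A t) {a<..b}) \<longlongrightarrow> measure std_normal_distribution {a<..b}) at_top"
proof (rule tendsto_at_topI_sequentially)
  fix X :: "nat \<Rightarrow> real" assume X: "filterlim X at_top sequentially"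
  interpret SN: real_distribution std_normal_distribution by (rule real_dist_normal_dist)
  have "weak_conv_m (\<lambda>n. scaled_law A (X n)) std_normal_distribution"
  proof (rule levy_continuity)
    show "(\<lambda>n. char (scaled_law A (X n)) \<theta>) \<longlonglongrightarrow> char std_normal_distribution \<theta>" for \<theta>
      by (rule filterlim_compose[OF scaled_char_convergence[OF hom] X])
  qed (rule real_distribution_scaled_law real_dist_normal_dist)+
  then have cdf: "(\<lambda>n. cdf (scaled_law A (X n)) x) \<longlonglongrightarrow> cdf std_normal_distribution x" for x
    using SN.isCont_cdf[of x] std_normal_singleton[of x] by (auto simp: weak_conv_m_def weak_conv_def)
  have "cdf (scaled_law A (X n)) b - cdf (scaled_law A (X n)) a = measure (scaled_law A (X n)) {a<..b}" for n
  proof -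
    interpret law: real_distribution "scaled_law A (X n)" by (rule real_distribution_scaled_law)
    show ?thesis by (rule law.cdf_diff_eq[OF ab])
  qed
  with tendsto_diff[OF cdf[of b] cdf[of a]] SN.cdf_diff_eq[OF ab]
  show "(\<lambda>n. measure (scaled_law A (X n)) {a<..b}) \<longlonglongrightarrow> measure std_normal_distribution {a<..b}" by simp
qed

text \<open>The scale is sqrt (A / 2) / sqrt t, so the event reads a sqrt t < x <= b sqrt t; for an
  interval closed on the right, both ends turn into floors.\<close>

lemma scaled_interval:
  assumes A: "0 < A" and t: "0 < t"
  shows "measure (scaled_law A t) {sqrt (A / 2) * a<..sqrt (A / 2) * b}
    = (\<Sum>x\<in>{\<lfloor>a * sqrt t\<rfloor> <.. \<lfloor>b * sqrt t\<rfloor>}. heat_kernel t x)"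
proof -
  let ?I = "{sqrt (A / 2) * a<..sqrt (A / 2) * b}" and ?F = "{\<lfloor>a * sqrt t\<rfloor> <.. \<lfloor>b * sqrt t\<rfloor>}"
  let ?W = "\<lambda>y. scale A t * of_int (walk t y)"
  have s: "0 < sqrt (A / 2)" "0 < sqrt t" using A t by auto
  have scale: "scale A t = sqrt (A / 2) / sqrt t" by (simp flip: real_sqrt_divide)
  have cancel: "(\<sigma> * v < \<sigma> / q * w \<longleftrightarrow> v * q < w) \<and> (\<sigma> / q * w \<le> \<sigma> * v \<longleftrightarrow> w \<le> v * q)"
    if "0 < \<sigma>" "0 < q" for \<sigma> q v w :: real
  proof -
    have "\<sigma> / q * w = \<sigma> * (w / q)" by simp
    then show ?thesis
      using that by (simp only: mult_less_cancel_left_pos mult_le_cancel_left_pos pos_less_divide_eq pos_divide_le_eq)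
  qed
  have iff: "scale A t * of_int x \<in> ?I \<longleftrightarrow> x \<in> ?F" for x
    unfolding scale greaterThanAtMost_iff using cancel[OF s, of a "of_int x"] cancel[OF s, of b "of_int x"]
    by (simp only: floor_less_iff le_floor_iff)
  have "measure (scaled_law A t) ?I
      = prob (?W -` ?I \<inter> space P)"
    unfolding scaled_law_def by (rule measure_distr) auto
  also have "?W -` ?I \<inter> space P
      = {y \<in> space P. walk t y \<in> ?F}"
    by (auto simp only: vimage_eq iff Int_iff mem_Collect_eq)
  finally show ?thesis by (simp only: heat_kernel_sum[OF finite_greaterThanAtMost_int])
qed

text \<open>Over a window of length about sqrt t, whose mass is at most 1, the drop of sqrt t * p_t
  below its value at 0 is at most the square root of 4 A * sqrt t * p_t(0). The arithmetic-geometric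
  inequality absorbs it into sqrt t * p_t(0).\<close>

lemma on_diagonal_upper_bound:
  assumes hom: "homogenizes A"
  shows "\<forall>\<^sub>F t in at_top. sqrt t * heat_kernel t 0 \<le> 2 + 4 * A"
proof -
  have A: "0 < A" and gr: "(\<lambda>n. potential (int n) / real n) \<longlonglongrightarrow> A"
    using hom by (auto simp: homogenizes_def growth_def)
  have quad: quadratic using hom by (rule homogenization_imp_quadratic)
  have "\<forall>\<^sub>F n in sequentially. potential (int n) / real n < 2 * A"
    using gr A by (intro order_tendstoD(2)) auto
  then obtain n0 where n0: "\<And>n. n \<ge> n0 \<Longrightarrow> potential (int n) / real n < 2 * A"
    unfolding eventually_sequentially by blast
  have "\<forall>\<^sub>F t in at_top. max 1 (real n0) \<le> sqrt t" using sqrt_at_top unfolding filterlim_at_top by blast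
  then show ?thesis
  proof eventually_elim
    case (elim t)
    then have st: "1 \<le> sqrt t" and t: "0 < t" by (auto simp: order.strict_trans2[OF zero_less_one])
    define R where "R = nat \<lceil>sqrt t\<rceil>"
    have R1: "sqrt t \<le> real R" unfolding R_def by linarith
    have R2: "real R \<le> 2 * sqrt t" using st unfolding R_def by linarith
    have R: "0 < real R" "n0 \<le> R" using R1 st elim by linarith+
    have pot: "potential (int R) \<le> 2 * A * real R" using n0[OF R(2)] R(1) by (simp add: field_simps)
    let ?p = "heat_kernel t 0"
    define x where "x = sqrt (?p * potential (int R))"
    have pot_nonneg: "0 \<le> potential (int R)"
      using isum_mono[of resistance 0 "int R"] edge_pos by (simp add: less_imp_le)
    have diff: "sqrt t * (?p - heat_kernel t y) \<le> x" if y: "y \<in> {0..<int R}" for y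
    proof -
      have "(heat_kernel t y - ?p)\<^sup>2 \<le> ?p / t * potential y"
        using heat_kernel_holder[OF quad t, of 0 y] y by simp
      also have "\<dots> \<le> ?p / t * potential (int R)"
        using isum_mono[of resistance y "int R"] edge_pos y t
        by (intro mult_left_mono) (auto simp: less_imp_le heat_kernel_nonneg)
      finally have "t * (heat_kernel t y - ?p)\<^sup>2 \<le> ?p * potential (int R)" using t by (simp add: field_simps)
      then have "(sqrt t * (?p - heat_kernel t y))\<^sup>2 \<le> ?p * potential (int R)"
        using t by (simp add: power_mult_distrib power2_commute)
      then show ?thesis unfolding x_def by (rule real_le_rsqrt)
    qed
    have "(\<Sum>y\<in>{0..<int R}. sqrt t * (?p - heat_kernel t y)) \<le> (\<Sum>y\<in>{0..<int R}. x)"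
      by (intro sum_mono diff)
    then have "real R * (sqrt t * ?p) - sqrt t * (\<Sum>y\<in>{0..<int R}. heat_kernel t y) \<le> real R * x"
      by (simp add: sum_distrib_left[symmetric] sum_subtractf right_diff_distrib)
    moreover have "(\<Sum>y\<in>{0..<int R}. heat_kernel t y) \<le> 1" by (subst heat_kernel_sum) auto
    then have "sqrt t * (\<Sum>y\<in>{0..<int R}. heat_kernel t y) \<le> real R * 1"
      using R1 st by (intro mult_mono) (auto intro!: sum_nonneg heat_kernel_nonneg)
    ultimately have "real R * (sqrt t * ?p) \<le> real R * (1 + x)" by (simp add: algebra_simps)
    then have a: "sqrt t * ?p \<le> 1 + x" using R by simp
    have "?p * potential (int R) \<le> ?p * (2 * A * (2 * sqrt t))"
      using pot R2 A by (intro mult_left_mono heat_kernel_nonneg order_trans[OF pot] mult_left_mono) auto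
    also have "\<dots> = 4 * A * (sqrt t * ?p)" by simp
    also have "\<dots> \<le> ((4 * A + sqrt t * ?p) / 2)\<^sup>2"
      using zero_le_power2[of "4 * A - sqrt t * ?p"] by (simp add: power2_eq_square field_simps)
    finally have "x \<le> (4 * A + sqrt t * ?p) / 2"
      unfolding x_def using A t heat_kernel_nonneg[of t 0] by (intro real_le_lsqrt) (auto simp: pot_nonneg)
    \<comment> \<open>For v = sqrt t * p_t(0) the bounds combine to v <= 1 + (4 A + v) / 2.\<close>
    with a show ?case by simp
  qed
qed

end

lemma growth_floor:
  assumes f: "growth f 1 A"
  shows "((\<lambda>t. f \<lfloor>b * sqrt t\<rfloor> / sqrt t) \<longlongrightarrow> A * b) at_top"
proof (rule tendstoI)
  fix e :: real assume e: "0 < e"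
  define d where "d = e / 2 / (\<bar>b\<bar> + 1)"
  have d: "0 < d" using e by (simp add: d_def)
  have "\<bar>b\<bar> + 1 \<noteq> 0" by linarith
  then have db: "d * (\<bar>b\<bar> + 1) = e / 2" unfolding d_def by (rule nonzero_eq_divide_eq[THEN iffD1, OF _ refl])
  obtain C where C: "0 \<le> C" "\<And>x. \<bar>f x - A * of_int x ^ 1\<bar> \<le> d * \<bar>of_int x\<bar> ^ 1 + C"
    using growth_approx[OF f d] by blast
  have "((\<lambda>t. (C + \<bar>A\<bar>) / sqrt t) \<longlongrightarrow> 0) at_top"
    by (rule real_tendsto_divide_at_top[OF tendsto_const sqrt_at_top])
  then have "\<forall>\<^sub>F t in at_top. (C + \<bar>A\<bar>) / sqrt t < e / 2" using e by (intro order_tendstoD(2)) auto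
  then show "\<forall>\<^sub>F t in at_top. dist (f \<lfloor>b * sqrt t\<rfloor> / sqrt t) (A * b) < e"
    using eventually_ge_at_top[of 1]
  proof eventually_elim
    case (elim t)
    define x where "x = \<lfloor>b * sqrt t\<rfloor>"
    have st: "1 \<le> sqrt t" using elim by simp
    have x1: "\<bar>of_int x - b * sqrt t\<bar> \<le> 1" unfolding x_def by linarith
    have "\<bar>of_int x\<bar> \<le> \<bar>b * sqrt t\<bar> + 1" using x1 by linarith
    also have "\<dots> \<le> (\<bar>b\<bar> + 1) * sqrt t" using st by (simp add: abs_mult distrib_right)
    finally have "d * \<bar>of_int x\<bar> \<le> d * ((\<bar>b\<bar> + 1) * sqrt t)" using d by (intro mult_left_mono) auto
    also have "\<dots> = e / 2 * sqrt t" using db by (simp only: mult.assoc[symmetric])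
    finally have 1: "\<bar>f x - A * of_int x\<bar> \<le> e / 2 * sqrt t + C" using C(2)[of x] by simp
    have 2: "\<bar>A * of_int x - A * (b * sqrt t)\<bar> \<le> \<bar>A\<bar>"
      using mult_left_mono[OF x1, of "\<bar>A\<bar>"] by (simp flip: abs_mult right_diff_distrib)
    have "C + \<bar>A\<bar> < e / 2 * sqrt t" using elim(1) st by (simp add: pos_divide_less_eq)
    with 1 2 have "\<bar>f x - A * b * sqrt t\<bar> < e * sqrt t" by (simp add: mult.assoc)
    moreover have "\<bar>f x / sqrt t - A * b\<bar> * sqrt t = \<bar>f x - A * b * sqrt t\<bar>"
      using st by (simp add: abs_mult_pos left_diff_distrib)
    ultimately have "\<bar>f x / sqrt t - A * b\<bar> * sqrt t < e * sqrt t" by simp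
    then show ?case using st by (simp add: dist_real_def x_def)
  qed
qed

context conductance_walk begin

text \<open>The mass of the window from a sqrt t to (a + \<delta>) sqrt t converges by the central
  limit theorem, and equicontinuity compares its average with the value at the left end. \<delta> is
  fixed while t grows; three errors of e / 4 add up to less than e.\<close>

theorem local_limit:
  assumes hom: "homogenizes A"
  shows "((\<lambda>t. sqrt t * heat_kernel t \<lfloor>a * sqrt t\<rfloor>) \<longlongrightarrow> sqrt A / (2 * sqrt pi) * exp (- (A / 4) * a\<^sup>2)) at_top"
proof (rule tendstoI)
  fix e :: real assume e: "0 < e"
  have A: "0 < A" and gr: "growth potential 1 A" using hom by (auto simp: homogenizes_def)
  have quad: quadratic using hom by (rule homogenization_imp_quadratic)
  define \<sigma> where "\<sigma> = sqrt (A / 2)"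
  have \<sigma>: "0 < \<sigma>" using A by (simp add: \<sigma>_def)
  define \<rho> where "\<rho> = \<sigma> * std_normal_density (\<sigma> * a)"
  have \<rho>: "\<rho> = sqrt A / (2 * sqrt pi) * exp (- (A / 4) * a\<^sup>2)"
  proof -
    have "\<sigma> / sqrt (2 * pi) = sqrt A / (2 * sqrt pi)"
      unfolding \<sigma>_def by (simp add: real_sqrt_divide real_sqrt_mult)
    moreover have "- ((\<sigma> * a)\<^sup>2 / 2) = - (A / 4) * a\<^sup>2" using A by (simp add: \<sigma>_def power_mult_distrib)
    moreover have "\<rho> = \<sigma> / sqrt (2 * pi) * exp (- ((\<sigma> * a)\<^sup>2 / 2))"
      by (simp add: \<rho>_def std_normal_density_def)
    ultimately show ?thesis by (simp only:)
  qed
  define C where "C = 2 + 4 * A"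
  have C: "0 < C" using A by (simp add: C_def)
  obtain d0 where d0: "0 < d0" "\<And>h. 0 < h \<and> h < d0 \<Longrightarrow>
      \<bar>measure std_normal_distribution {\<sigma> * a<..\<sigma> * a + h} / h - std_normal_density (\<sigma> * a)\<bar> \<le> e / (4 * \<sigma>)"
    using std_normal_interval[of "e / (4 * \<sigma>)" "\<sigma> * a"] e \<sigma> by auto
  \<comment> \<open>The first bound makes the normal density nearly constant on the rescaled window;
    the second makes C * (2 * A * \<delta>), a bound for the squared rescaled increments, at most (e
    / 4)^2.\<close>
  define \<delta> where "\<delta> = min (d0 / (2 * \<sigma>)) ((e / 4)\<^sup>2 / (2 * C * A))"
  have \<delta>: "0 < \<delta>" using d0 \<sigma> e C A by (simp add: \<delta>_def)
  have \<delta>1: "\<sigma> * \<delta> < d0"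
  proof -
    have "\<sigma> * \<delta> \<le> \<sigma> * (d0 / (2 * \<sigma>))" using \<sigma> by (intro mult_left_mono) (auto simp: \<delta>_def)
    also have "\<dots> < d0" using \<sigma> d0 by simp
    finally show ?thesis .
  qed
  have \<delta>2: "2 * C * A * \<delta> \<le> (e / 4)\<^sup>2"
  proof -
    have "2 * C * A * \<delta> \<le> 2 * C * A * ((e / 4)\<^sup>2 / (2 * C * A))" using C A by (intro mult_left_mono) (auto simp: \<delta>_def)
    then show ?thesis using C A by simp
  qed
  define b where "b = a + \<delta>"
  define G where "G = measure std_normal_distribution {\<sigma> * a<..\<sigma> * b}"
  have "\<bar>G / (\<sigma> * \<delta>) - std_normal_density (\<sigma> * a)\<bar> \<le> e / (4 * \<sigma>)"
    using d0(2)[of "\<sigma> * \<delta>"] \<delta> \<delta>1 \<sigma> by (simp add: G_def b_def distrib_left)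
  then have "\<sigma> * \<bar>G / (\<sigma> * \<delta>) - std_normal_density (\<sigma> * a)\<bar> \<le> \<sigma> * (e / (4 * \<sigma>))"
    using \<sigma> by (intro mult_left_mono) auto
  then have G: "\<bar>G / \<delta> - \<rho>\<bar> \<le> e / 4"
  proof -
    have "\<sigma> * \<bar>G / (\<sigma> * \<delta>) - std_normal_density (\<sigma> * a)\<bar> = \<bar>\<sigma> * (G / (\<sigma> * \<delta>) - std_normal_density (\<sigma> * a))\<bar>"
      using \<sigma> by (simp add: abs_mult)
    also have "\<sigma> * (G / (\<sigma> * \<delta>) - std_normal_density (\<sigma> * a)) = G / \<delta> - \<rho>"
      using \<sigma> by (simp add: \<rho>_def right_diff_distrib)
    finally show ?thesis using \<open>\<sigma> * _ \<le> \<sigma> * _\<close> \<sigma> by simp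
  qed
  let ?x = "\<lambda>t. \<lfloor>a * sqrt t\<rfloor>" and ?y = "\<lambda>t. \<lfloor>b * sqrt t\<rfloor>"
  define mass where "mass t = (\<Sum>z\<in>{?x t<..?y t}. heat_kernel t z)" for t
  define len where "len t = (of_int (?y t) - of_int (?x t) :: real)" for t
  have "((\<lambda>t. measure (scaled_law A t) {\<sigma> * a<..\<sigma> * b}) \<longlongrightarrow> G) at_top"
    unfolding G_def by (rule scaled_interval_convergence[OF hom]) (use \<sigma> \<delta> in \<open>simp add: b_def\<close>)
  then have mass_lim: "(mass \<longlongrightarrow> G) at_top"
  proof (rule Lim_transform_eventually)
    show "\<forall>\<^sub>F t in at_top. measure (scaled_law A t) {\<sigma> * a<..\<sigma> * b} = mass t"
      using eventually_gt_at_top[of 0] unfolding \<sigma>_def mass_def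
      by eventually_elim (rule scaled_interval[OF A])
  qed
  have floor_lim: "((\<lambda>t. of_int \<lfloor>v * sqrt t\<rfloor> / sqrt t) \<longlongrightarrow> v) at_top" for v :: real
    using growth_floor[OF growth_isum_one, of v] by (simp add: isum_one)
  have "((\<lambda>t. of_int (?y t) / sqrt t - of_int (?x t) / sqrt t) \<longlongrightarrow> b - a) at_top"
    by (intro tendsto_diff floor_lim)
  then have len_lim: "((\<lambda>t. len t / sqrt t) \<longlongrightarrow> \<delta>) at_top"
    by (simp add: len_def b_def diff_divide_distrib)
  have "((\<lambda>t. mass t / (len t / sqrt t)) \<longlongrightarrow> G / \<delta>) at_top"
    using \<delta> by (intro tendsto_divide mass_lim len_lim) auto
  then have ev1: "\<forall>\<^sub>F t in at_top. \<bar>mass t / (len t / sqrt t) - G / \<delta>\<bar> < e / 4"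
    using e unfolding tendsto_iff dist_real_def by (meson zero_less_divide_iff zero_less_numeral)
  have ev2: "\<forall>\<^sub>F t in at_top. 0 < len t / sqrt t" using len_lim \<delta> by (rule order_tendstoD(1))
  have "((\<lambda>t. potential (?y t) / sqrt t - potential (?x t) / sqrt t) \<longlongrightarrow> A * b - A * a) at_top"
    by (intro tendsto_diff growth_floor gr)
  then have "((\<lambda>t. potential (?y t) / sqrt t - potential (?x t) / sqrt t) \<longlongrightarrow> A * \<delta>) at_top"
    by (simp add: b_def distrib_left)
  then have ev3: "\<forall>\<^sub>F t in at_top. potential (?y t) / sqrt t - potential (?x t) / sqrt t < 2 * A * \<delta>"
    using A \<delta> by (intro order_tendstoD(2)) auto
  have ev4: "\<forall>\<^sub>F t in at_top. sqrt t * heat_kernel t 0 \<le> C"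
    unfolding C_def by (rule on_diagonal_upper_bound[OF hom])
  show "\<forall>\<^sub>F t in at_top. dist (sqrt t * heat_kernel t \<lfloor>a * sqrt t\<rfloor>) (sqrt A / (2 * sqrt pi) * exp (- (A / 4) * a\<^sup>2)) < e"
    using ev1 ev2 ev3 ev4 eventually_gt_at_top[of 0]
  proof eventually_elim
    case (elim t)
    have st: "0 < sqrt t" using elim by simp
    have len: "0 < len t" using elim(2) st by (simp add: zero_less_divide_iff)
    have card: "real (card {?x t<..?y t}) = len t" using len by (simp add: len_def)
    let ?p = "\<lambda>z. heat_kernel t z"
    have close: "\<bar>sqrt t * ?p z - sqrt t * ?p (?x t)\<bar> \<le> e / 4" if z: "z \<in> {?x t<..?y t}" for z
    proof -
      have "(?p z - ?p (?x t))\<^sup>2 \<le> ?p 0 / t * (potential z - potential (?x t))"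
        by (rule heat_kernel_holder[OF quad elim(5)]) (use z in simp)
      also have "\<dots> \<le> ?p 0 / t * (potential (?y t) - potential (?x t))"
        using z isum_mono[of resistance z "?y t"] edge_pos elim(5)
        by (intro mult_left_mono) (auto simp: less_imp_le heat_kernel_nonneg)
      finally have "t * (?p z - ?p (?x t))\<^sup>2 \<le> ?p 0 * (potential (?y t) - potential (?x t))"
        using elim(5) by (simp add: field_simps)
      also have "\<dots> = (sqrt t * ?p 0) * (potential (?y t) / sqrt t - potential (?x t) / sqrt t)"
        using st by (simp add: field_simps)
      also have "\<dots> \<le> C * (2 * A * \<delta>)"
      proof (rule mult_mono)
        show "0 \<le> potential (?y t) / sqrt t - potential (?x t) / sqrt t"
          using isum_mono[of resistance "?x t" "?y t"] edge_pos len st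
          by (simp add: less_imp_le len_def divide_right_mono)
      qed (use elim C in auto)
      also have "\<dots> \<le> (e / 4)\<^sup>2" using \<delta>2 by (simp add: mult_ac)
      finally have "(sqrt t * (?p z - ?p (?x t)))\<^sup>2 \<le> (e / 4)\<^sup>2"
        using elim(5) by (simp add: power_mult_distrib)
      then have "\<bar>sqrt t * (?p z - ?p (?x t))\<bar> \<le> \<bar>e / 4\<bar>" by (simp only: abs_le_square_iff)
      then have "\<bar>sqrt t * (?p z - ?p (?x t))\<bar> \<le> e / 4" using e by (simp only: abs_of_pos divide_pos_pos zero_less_numeral)
      then show ?thesis by (simp add: right_diff_distrib)
    qed
    have "\<bar>sqrt t * mass t - len t * (sqrt t * ?p (?x t))\<bar>
        = \<bar>\<Sum>z\<in>{?x t<..?y t}. sqrt t * ?p z - sqrt t * ?p (?x t)\<bar>"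
      by (simp only: sum_subtractf sum_constant card mass_def sum_distrib_left)
    also have "\<dots> \<le> (\<Sum>z\<in>{?x t<..?y t}. \<bar>sqrt t * ?p z - sqrt t * ?p (?x t)\<bar>)" by (rule sum_abs)
    also have "\<dots> \<le> (\<Sum>z\<in>{?x t<..?y t}. e / 4)" by (intro sum_mono close)
    also have "\<dots> = len t * (e / 4)" by (simp only: sum_constant card)
    finally have "\<bar>sqrt t * mass t - len t * (sqrt t * ?p (?x t))\<bar> \<le> len t * (e / 4)" .
    moreover have "\<bar>sqrt t * mass t - len t * (sqrt t * ?p (?x t))\<bar> = len t * \<bar>mass t / (len t / sqrt t) - sqrt t * ?p (?x t)\<bar>"
    proof -
      have "sqrt t * mass t - len t * (sqrt t * ?p (?x t)) = len t * (mass t / (len t / sqrt t) - sqrt t * ?p (?x t))"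
        using len by (simp add: right_diff_distrib)
      then show ?thesis using len by (simp add: abs_mult)
    qed
    ultimately have "\<bar>mass t / (len t / sqrt t) - sqrt t * ?p (?x t)\<bar> \<le> e / 4" using len by simp
    then have "\<bar>sqrt t * ?p (?x t) - \<rho>\<bar> < e" using elim(1) G e by linarith
    then show ?case by (simp add: dist_real_def \<rho>)
  qed
qed

end

section \<open>Almost every environment\<close>

lemma growth_isum_1I:
  assumes "(\<lambda>n. (\<Sum>i<n. r (int i)) / real n) \<longlonglongrightarrow> A" "(\<lambda>n. (\<Sum>i<n. r (- int i - 1)) / real n) \<longlonglongrightarrow> A"
  shows "growth (isum r) 1 A"
  using assms by (simp add: growth_def isum_of_nat isum_minus_of_nat)

lemma growth_square_lower:
  assumes "growth f 2 a" "b < a"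
  shows "\<forall>\<^sub>F n in sequentially. b * real n ^ 2 \<le> f (int n) \<and> b * real n ^ 2 \<le> f (- int n)"
proof -
  have "\<forall>\<^sub>F n in sequentially. b < f (int n) / real n ^ 2 \<and> b < f (- int n) / (- real n) ^ 2"
    using assms unfolding growth_def by (intro eventually_conj order_tendstoD(1)[where F=sequentially]) auto
  then show ?thesis
    using eventually_gt_at_top[of 0] by eventually_elim (simp add: field_simps)
qed

context invertible_ergodic_system
begin

text \<open>Otherwise monotone convergence would give \<open>f\<close> a finite integral.\<close>

lemma integral_truncation_unbounded:
  fixes f :: "'w \<Rightarrow> real"
  assumes [measurable]: "f \<in> borel_measurable \<mu>" and pos: "\<And>\<omega>. \<omega> \<in> space \<mu> \<Longrightarrow> 0 < f \<omega>"
    and nonint: "\<not> integrable \<mu> f"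
  shows "\<exists>m::nat. B < (\<integral>\<omega>. min (f \<omega>) (real m) \<partial>\<mu>)"
proof (rule ccontr)
  assume "\<not> ?thesis"
  then have le: "(\<integral>\<omega>. min (f \<omega>) (real m) \<partial>\<mu>) \<le> B" for m :: nat by (auto simp: not_less)
  have int: "integrable \<mu> (\<lambda>\<omega>. min (f \<omega>) (real m))" for m :: nat
    by (rule integrable_const_bound[of _ "real m"]) (use pos in \<open>auto intro!: AE_I2 simp: abs_le_iff less_imp_le min_def dest: less_imp_le intro: order_trans\<close>)
  have "(\<integral>\<^sup>+\<omega>. ennreal (f \<omega>) \<partial>\<mu>) = (\<integral>\<^sup>+\<omega>. (SUP m. ennreal (min (f \<omega>) (real m))) \<partial>\<mu>)"
  proof (rule nn_integral_cong)
    fix \<omega>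
    show "ennreal (f \<omega>) = (SUP m. ennreal (min (f \<omega>) (real m)))"
    proof (rule antisym)
      obtain m :: nat where "f \<omega> \<le> real m" using real_arch_simple by blast
      then have "ennreal (f \<omega>) = ennreal (min (f \<omega>) (real m))" by simp
      then show "ennreal (f \<omega>) \<le> (SUP m. ennreal (min (f \<omega>) (real m)))" by (metis SUP_upper UNIV_I)
      show "(SUP m. ennreal (min (f \<omega>) (real m))) \<le> ennreal (f \<omega>)" by (intro SUP_least ennreal_leI) simp
    qed
  qed
  also have "\<dots> = (SUP m. \<integral>\<^sup>+\<omega>. ennreal (min (f \<omega>) (real m)) \<partial>\<mu>)"
    by (rule nn_integral_monotone_convergence_SUP) (auto intro!: incseq_SucI le_funI ennreal_leI)
  also have "\<dots> \<le> ennreal B"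
  proof (rule SUP_least)
    fix m :: nat
    have "(\<integral>\<^sup>+\<omega>. ennreal (min (f \<omega>) (real m)) \<partial>\<mu>) = ennreal (\<integral>\<omega>. min (f \<omega>) (real m) \<partial>\<mu>)"
      by (rule nn_integral_eq_integral[OF int]) (use pos in \<open>auto intro!: AE_I2 simp: less_imp_le\<close>)
    also have "\<dots> \<le> ennreal B" by (rule ennreal_leI[OF le])
    finally show "(\<integral>\<^sup>+\<omega>. ennreal (min (f \<omega>) (real m)) \<partial>\<mu>) \<le> ennreal B" .
  qed
  finally have "(\<integral>\<^sup>+\<omega>. ennreal (f \<omega>) \<partial>\<mu>) < \<infinity>" by (rule le_less_trans) simp
  then have "integrable \<mu> f"
    using pos by (intro integrableI_nonneg) (auto intro!: AE_I2 less_imp_le)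
  with nonint show False by contradiction
qed

lemma conductance_walk_environment:
  assumes pos: "\<And>\<omega>. \<omega> \<in> space \<mu> \<Longrightarrow> 0 < c \<omega>" and "\<omega> \<in> space \<mu>"
    and walk: "variable_speed_walk P (conductance (space \<mu>) T c \<omega>) 0 S \<tau>"
  shows "conductance_walk P (conductance (space \<mu>) T c \<omega>) S \<tau> (\<lambda>x. c (int_iterate (space \<mu>) T x \<omega>))"
  using assms int_iterate_in_space[of \<omega>]
  by (intro conductance_walk.intro walk conductance_walk_axioms.intro) (auto simp: conductance_def)

end

theorem mainTheorem4:
  fixes \<mu> :: "'w measure" and T :: "'w \<Rightarrow> 'w" and c :: "'w \<Rightarrow> real"
    and P :: "'w \<Rightarrow> 's measure" and S :: "nat \<Rightarrow> 's \<Rightarrow> int" and \<tau> :: "nat \<Rightarrow> 's \<Rightarrow> real"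
  assumes "invertible_ergodic_system \<mu> T"
    and "c \<in> borel_measurable \<mu>"
    and "\<And>\<omega>. \<omega> \<in> space \<mu> \<Longrightarrow> 0 < c \<omega>"
    and "\<And>\<omega>. \<omega> \<in> space \<mu> \<Longrightarrow>
           variable_speed_walk (P \<omega>) (conductance (space \<mu>) T c \<omega>) 0 S \<tau>"
  shows "(integrable \<mu> (\<lambda>\<omega>. 1 / c \<omega>) \<longrightarrow>
           (AE \<omega> in \<mu>. \<forall>x0::real.
             ((\<lambda>t. sqrt t * measure (P \<omega>)
                 {y \<in> space (P \<omega>). walk_position S \<tau> t y = \<lfloor>x0 * sqrt t\<rfloor>})
               \<longlongrightarrow> sqrt (\<integral>\<omega>'. 1 / c \<omega>' \<partial>\<mu>) / (2 * sqrt pi)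
                   * exp (- ((\<integral>\<omega>'. 1 / c \<omega>' \<partial>\<mu>) / 4) * x0\<^sup>2)) at_top))
       \<and> (\<not> integrable \<mu> (\<lambda>\<omega>. 1 / c \<omega>) \<longrightarrow>
           (AE \<omega> in \<mu>. \<forall>x::int.
             filterlim (\<lambda>t. sqrt t * measure (P \<omega>)
                 {y \<in> space (P \<omega>). walk_position S \<tau> t y = x}) at_top at_top))"
proof -
  interpret env: invertible_ergodic_system \<mu> T by fact
  note [measurable] = assms(2)
  note pos = assms(3)
  let ?c = "\<lambda>\<omega> x. c (int_iterate (space \<mu>) T x \<omega>)"
  have walk: "conductance_walk (P \<omega>) (conductance (space \<mu>) T c \<omega>) S \<tau> (?c \<omega>)" if "\<omega> \<in> space \<mu>" for \<omega>
    using that assms by (intro env.conductance_walk_environment) auto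
  have rpos: "0 < 1 / c \<omega>" if "\<omega> \<in> space \<mu>" for \<omega> using pos[OF that] by simp
  show ?thesis
  proof (intro conjI impI)
    assume int: "integrable \<mu> (\<lambda>\<omega>. 1 / c \<omega>)"
    define A where "A = (\<integral>\<omega>. 1 / c \<omega> \<partial>\<mu>)"
    have "0 < A"
    proof -
      have "A \<noteq> 0"
      proof
        assume "A = 0"
        then have "AE \<omega> in \<mu>. 1 / c \<omega> = 0"
          unfolding A_def using int rpos by (subst (asm) integral_nonneg_eq_0_iff_AE) (auto intro!: AE_I2 less_imp_le)
        then have "AE \<omega> in \<mu>. False" using AE_space by eventually_elim (frule pos, simp)
        then show False by simp
      qed
      moreover have "0 \<le> A" unfolding A_def using rpos by (intro integral_nonneg_AE AE_I2) (auto intro: less_imp_le)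
      ultimately show ?thesis by simp
    qed
    show "AE \<omega> in \<mu>. \<forall>x0::real.
             ((\<lambda>t. sqrt t * measure (P \<omega>)
                 {y \<in> space (P \<omega>). walk_position S \<tau> t y = \<lfloor>x0 * sqrt t\<rfloor>})
               \<longlongrightarrow> sqrt (\<integral>\<omega>'. 1 / c \<omega>' \<partial>\<mu>) / (2 * sqrt pi)
                   * exp (- ((\<integral>\<omega>'. 1 / c \<omega>' \<partial>\<mu>) / 4) * x0\<^sup>2)) at_top"
      using env.birkhoff_two_sided[OF int] AE_space unfolding A_def[symmetric]
    proof eventually_elim
      case (elim \<omega>)
      interpret conductance_walk "P \<omega>" "conductance (space \<mu>) T c \<omega>" S \<tau> "?c \<omega>" by (rule walk[OF elim(2)])
      have "homogenizes A"
        unfolding homogenizes_def using elim(1) \<open>0 < A\<close> by (intro conjI growth_isum_1I) auto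
      from local_limit[OF this] show ?case unfolding heat_kernel_def by blast
    qed
  next
    assume nonint: "\<not> integrable \<mu> (\<lambda>\<omega>. 1 / c \<omega>)"
    \<comment> \<open>The level m + 1 keeps \<open>f m\<close> positive, as the growth lemmas
      require of resistances.\<close>
    define f where "f m \<omega> = min (1 / c \<omega>) (real (Suc m))" for m \<omega>
    have f_pos: "0 < f m \<omega>" if "\<omega> \<in> space \<mu>" for m \<omega> using rpos[OF that] by (simp add: f_def)
    have f_int: "integrable \<mu> (f m)" for m
      by (rule env.integrable_const_bound[of _ "real (Suc m)"])
        (use f_pos in \<open>auto intro!: AE_I2 simp: f_def[abs_def] abs_of_pos\<close>)
    have f_unb: "\<exists>m. B < (\<integral>\<omega>. f m \<omega> \<partial>\<mu>)" for B
    proof -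
      have [measurable]: "(\<lambda>\<omega>. 1 / c \<omega>) \<in> borel_measurable \<mu>" by measurable
      \<comment> \<open>Asking for more than max 0 B excludes level 0, where the truncated integral
        vanishes.\<close>
      obtain m :: nat where m: "max 0 B < (\<integral>\<omega>. min (1 / c \<omega>) (real m) \<partial>\<mu>)"
        using env.integral_truncation_unbounded[of "\<lambda>\<omega>. 1 / c \<omega>" "max 0 B"] rpos nonint by auto
      show ?thesis
      proof (cases m)
        case 0
        have "(\<integral>\<omega>. min (1 / c \<omega>) (real m) \<partial>\<mu>) = (\<integral>\<omega>. 0 \<partial>\<mu>)"
          unfolding 0 of_nat_0
          by (rule Bochner_Integration.integral_cong[OF refl]) (rule min_absorb2[OF less_imp_le[OF rpos]])
        with m show ?thesis by simp
      next
        case (Suc l)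
        then show ?thesis using m by (intro exI[of _ l]) (simp add: f_def)
      qed
    qed
    \<comment> \<open>One null set for all levels, so that the level may be chosen afterwards
      depending on M.\<close>
    have "AE \<omega> in \<mu>. \<forall>m. (\<lambda>n. (\<Sum>i<n. f m (int_iterate (space \<mu>) T (int i) \<omega>)) / n) \<longlonglongrightarrow> (\<integral>\<omega>. f m \<omega> \<partial>\<mu>)
        \<and> (\<lambda>n. (\<Sum>i<n. f m (int_iterate (space \<mu>) T (- int i - 1) \<omega>)) / n) \<longlonglongrightarrow> (\<integral>\<omega>. f m \<omega> \<partial>\<mu>)"
      unfolding AE_all_countable by (intro allI env.birkhoff_two_sided f_int)
    then show "AE \<omega> in \<mu>. \<forall>x::int.
             filterlim (\<lambda>t. sqrt t * measure (P \<omega>)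
                 {y \<in> space (P \<omega>). walk_position S \<tau> t y = x}) at_top at_top"
      using AE_space
    proof eventually_elim
      case (elim \<omega>)
      interpret conductance_walk "P \<omega>" "conductance (space \<mu>) T c \<omega>" S \<tau> "?c \<omega>" by (rule walk[OF elim(2)])
      have superquadratic
        unfolding superquadratic_def
      proof
        fix M :: real
        \<comment> \<open>The polynomial of degree 2 built from \<open>f m\<close> has leading
          coefficient A / 2, which must exceed M; the absolute value also gives A > 0.\<close>
        obtain m where m: "2 * \<bar>M\<bar> < (\<integral>\<omega>. f m \<omega> \<partial>\<mu>)" using f_unb by blast
        define A where "A = (\<integral>\<omega>. f m \<omega> \<partial>\<mu>)"
        define r where "r x = f m (int_iterate (space \<mu>) T x \<omega>)" for x
        have A: "0 < A" "M < A / 2" using m by (auto simp: A_def)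
        have r: "0 < r x" for x unfolding r_def by (intro f_pos env.int_iterate_in_space elim)
        have "growth (isum r) 1 A"
          unfolding r_def A_def using elim(1) by (intro growth_isum_1I) auto
        from growth_heat_poly[OF r A(1) this, of 2]
        have "growth (heat_poly r 2) 2 (A / 2)" by (simp add: fact_numeral)
        from growth_square_lower[OF this A(2)]
        show "\<forall>\<^sub>F n in sequentially. poly2_above M n"
        proof eventually_elim
          case (elim n)
          have "heat_poly r 2 x \<le> heat_poly resistance 2 x" for x
            by (rule heat_poly_2_mono) (use r in \<open>auto simp: less_imp_le\<close>, simp add: r_def f_def)
          with elim show ?case by (meson order_trans)
        qed
      qed
      from superquadratic_imp_slow_decay[OF this] show ?case unfolding heat_kernel_def by blast
    qed
  qed
qed

end
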